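(* Suppose that $0 \to \rho' \to \rho \to \rho'' \to 0$ is a short exact sequence of monodromy representations of $\mathbf{Y}_{(0,1,\infty)} = \mathbb{P}^1 - \{0,1,\infty\}$ with $\rho$ two-dimensional and $\rho', \rho''$ one-dimensional. Let $$0 \to \mathcal{O}(\xi') \to \mathcal{V}_{\mathrm{Log}(\rho)} \to \mathcal{O}(\xi'') \to 0$$ be the induced short exact sequence of the vector bundles underlying the associated extended logarithmic connections (so $\mathcal{V}_{\mathrm{Log}(\rho')} \cong \mathcal{O}(\xi')$ and $\mathcal{V}_{\mathrm{Log}(\rho'')} \cong \mathcal{O}(\xi'')$). (1) If $(\xi', \xi'') \neq (-2, 0)$, then $0 \to \mathcal{O}(\xi') \to \mathcal{V}_{\mathrm{Log}(\rho)} \to \mathcal{O}(\xi'') \to 0$ splits. (2) If $(\xi', \xi'') = (-2, 0)$, then $\mathcal{V}_{\mathrm{Log}(\rho)} \cong \mathcal{O}(-1) \oplus \mathcal{O}(-1)$ or $\mathcal{V}_{\mathrm{Log}(\rho)} \cong \mathcal{O}(0) \oplus \mathcal{O}(-2)$.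
   Context: $\mathbb{P}^1$ is the complex projective line and $\mathbf{Y}_{(0,1,\infty)} = \mathbb{P}^1 - \{0,1,\infty\}$. Its fundamental group is identified with the free group $\mathbb{Z}*\mathbb{Z}$ on generators $\gamma_0,\gamma_1$ (loops around $0$ and $1$); a monodromy representation of $\mathbf{Y}_{(0,1,\infty)}$ is a finite-dimensional complex representation $\rho$ of this group. The local monodromies at $0, 1, \infty$ are $\rho(\gamma_0)$, $\rho(\gamma_1)$, $(\rho(\gamma_0)\rho(\gamma_1))^{-1}$. Finite-dimensional monodromy representations $\rho$ are equivalent, as a category, to holomorphic connections $(\mathcal{Q}_\rho, \nabla_\rho)$ on $\mathbf{Y}_{(0,1,\infty)}$. A connection with logarithmic poles along a finite set $S \subset \mathbb{P}^1$ is a pair $(\overline{\mathcal{E}}, \overline{\nabla})$ with $\overline{\mathcal{E}}$ a locally free sheaf of finite rank on $\mathbb{P}^1$ and $\overline{\nabla}: \overline{\mathcal{E}} \to \overline{\mathcal{E}} \otimes \Omega^1_{\mathbb{P}^1}(S)$ a $\mathbb{C}$-linear map satisfying the Leibniz rule, where $\Omega^1_{\mathbb{P}^1}(S)$ is the sheaf of 1-forms with logarithmic poles along $S$. The associated extended logarithmic connection $(\mathcal{V}_{\mathrm{Log}(\rho)}, \nabla_{\mathrm{Log}(\rho)})$ is the unique connection on $\mathbb{P}^1$ with logarithmic poles along $\{0,1,\infty\}$ which restricts to $(\mathcal{Q}_\rho,\nabla_\rho)$ and whose residue at each pole is (up to conjugation) the principal logarithm of the local monodromy there. Here the principal logarithm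 of an invertible matrix $A$ is the unique matrix $L$ with $\exp(2\pi i L) = A$ all of whose eigenvalues have real part in $[0,1)$ (so an eigenvalue $re^{2\pi i q}$, $r>0$, $0\le q<1$, gives $q + \frac{1}{2\pi i}\log r$). The loops are oriented so that the local monodromy at a pole with such a residue $L$ is conjugate to $\exp(2\pi i L)$. The assignment $\rho \mapsto (\mathcal{V}_{\mathrm{Log}(\rho)}, \nabla_{\mathrm{Log}(\rho)})$ is functorial and exact. $\mathcal{O}(k)$ is the twisting sheaf of degree $k$ on $\mathbb{P}^1$. *)

theory Defs
  imports "HOL-Analysis.Analysis"
begin

section \<open>The projective line\<close>

text \<open>
  Points of the projective line are complex numbers \<open>Some z\<close> together with \<open>None\<close>, the point at
  infinity.  The complex structure is given by the two charts \<open>Some\<close> and \<open>chart_inf\<close>.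
\<close>

type_synonym P1 = "complex option"

definition P1_top :: "P1 topology" where
  "P1_top = Alexandroff_compactification euclidean"

definition chart_inf :: "complex \<Rightarrow> P1" where
  "chart_inf w = (if w = 0 then None else Some (1 / w))"

definition hol_fun :: "P1 set \<Rightarrow> (P1 \<Rightarrow> complex) \<Rightarrow> bool" where
  "hol_fun U f \<longleftrightarrow>
     (\<lambda>z. f (Some z)) holomorphic_on {z. Some z \<in> U} \<and>
     (\<lambda>w. f (chart_inf w)) holomorphic_on {w. chart_inf w \<in> U}"

definition punctures :: "P1 set" where
  "punctures = {Some 0, Some 1, None}"


section \<open>Vector bundles on the projective line\<close>

text \<open>
  A vector bundle of rank \<open>CARD('n)\<close> is given by its sheaf of holomorphic sections.  The fibre over
  each point is identified, as a bare vector space and independently of the other points, with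
  \<open>complex^'n\<close>, so that a section is a function on points; nothing relates the identifications at
  different points, and a section need not be continuous as a function to \<open>complex^'n\<close>.  The
  holomorphic structure is carried entirely by the choice of the sheaf.  Choosing a basis of every
  fibre turns an arbitrary locally free sheaf of finite rank into one of this kind.  A section over
  \<open>U\<close> is represented by any function with the right values on \<open>U\<close>; values outside are irrelevant.
\<close>

type_synonym 'n presheaf = "P1 set \<Rightarrow> (P1 \<Rightarrow> complex^'n) set"

definition is_sheaf :: "'n::finite presheaf \<Rightarrow> bool" where
  "is_sheaf E \<longleftrightarrow>
     (\<forall>U s s'. openin P1_top U \<and> s \<in> E U \<and> (\<forall>q\<in>U. s' q = s q) \<longrightarrow> s' \<in> E U) \<and>
     (\<forall>U V s. openin P1_top U \<and> openin P1_top V \<and> V \<subseteq> U \<and> s \<in> E U \<longrightarrow> s \<in> E V) \<and>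
     (\<forall>U s. openin P1_top U \<and>
        (\<forall>p\<in>U. \<exists>V. openin P1_top V \<and> p \<in> V \<and> V \<subseteq> U \<and> s \<in> E V) \<longrightarrow> s \<in> E U)"

text \<open>The columns of \<open>e\<close> form a frame of \<open>E\<close> over \<open>U\<close>.\<close>

definition local_frame :: "'n::finite presheaf \<Rightarrow> P1 set \<Rightarrow> (P1 \<Rightarrow> complex^'n^'n) \<Rightarrow> bool" where
  "local_frame E U e \<longleftrightarrow>
     (\<forall>q\<in>U. invertible (e q)) \<and>
     (\<forall>W s. openin P1_top W \<and> W \<subseteq> U \<longrightarrow>
        (s \<in> E W \<longleftrightarrow> (\<exists>c. (\<forall>i. hol_fun W (\<lambda>q. c q $ i)) \<and> (\<forall>q\<in>W. s q = e q *v c q))))"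

definition vector_bundle :: "'n::finite presheaf \<Rightarrow> bool" where
  "vector_bundle E \<longleftrightarrow>
     is_sheaf E \<and> (\<forall>p. \<exists>U e. openin P1_top U \<and> p \<in> U \<and> local_frame E U e)"

text \<open>
  Homomorphisms of sheaves of modules between vector bundles are the fibrewise linear maps that
  preserve holomorphic sections.
\<close>

definition bundle_hom ::
    "'n::finite presheaf \<Rightarrow> 'm::finite presheaf \<Rightarrow> (P1 \<Rightarrow> complex^'n^'m) \<Rightarrow> bool" where
  "bundle_hom E F \<phi> \<longleftrightarrow>
     (\<forall>U s. openin P1_top U \<and> s \<in> E U \<longrightarrow> (\<lambda>q. \<phi> q *v s q) \<in> F U)"

definition bundle_iso :: "'n::finite presheaf \<Rightarrow> 'm::finite presheaf \<Rightarrow> bool" where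
  "bundle_iso E F \<longleftrightarrow>
     (\<exists>\<phi> \<psi>. bundle_hom E F \<phi> \<and> bundle_hom F E \<psi> \<and>
        (\<forall>q. \<phi> q ** \<psi> q = mat 1 \<and> \<psi> q ** \<phi> q = mat 1))"

definition exact_maps :: "complex^'k^'n \<Rightarrow> complex^'n^'m \<Rightarrow> bool" where
  "exact_maps A B \<longleftrightarrow>
     inj ((*v) A) \<and> range ((*v) A) = {v. B *v v = 0} \<and> surj ((*v) B)"

definition bundle_short_exact ::
    "'k::finite presheaf \<Rightarrow> 'n::finite presheaf \<Rightarrow> 'm::finite presheaf \<Rightarrow>
     (P1 \<Rightarrow> complex^'k^'n) \<Rightarrow> (P1 \<Rightarrow> complex^'n^'m) \<Rightarrow> bool" where
  "bundle_short_exact E' E E'' f g \<longleftrightarrow>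
     bundle_hom E' E f \<and> bundle_hom E E'' g \<and> (\<forall>q. exact_maps (f q) (g q))"

definition bundle_split_exact ::
    "'k::finite presheaf \<Rightarrow> 'n::finite presheaf \<Rightarrow> 'm::finite presheaf \<Rightarrow>
     (P1 \<Rightarrow> complex^'k^'n) \<Rightarrow> (P1 \<Rightarrow> complex^'n^'m) \<Rightarrow> bool" where
  "bundle_split_exact E' E E'' f g \<longleftrightarrow>
     bundle_short_exact E' E E'' f g \<and>
     (\<exists>\<sigma>. bundle_hom E'' E \<sigma> \<and> (\<forall>q. g q ** \<sigma> q = mat 1))"

text \<open>
  \<open>\<O>(k)\<close>, trivialised on the complement of infinity by the values \<open>s (Some z)\<close> and
  near infinity by \<open>z powi (- k) * s (Some z)\<close>, where \<open>z = 1 / w\<close>.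
\<close>

definition twisting_sheaf :: "int \<Rightarrow> 1 presheaf" where
  "twisting_sheaf k U =
     {s. (\<lambda>z. s (Some z) $ 1) holomorphic_on {z. Some z \<in> U} \<and>
         (\<lambda>w. if w = 0 then s None $ 1 else w powi k * s (Some (1 / w)) $ 1)
           holomorphic_on {w. chart_inf w \<in> U}}"

definition direct_sum :: "'n::finite presheaf \<Rightarrow> 'm::finite presheaf \<Rightarrow> ('n + 'm) presheaf" where
  "direct_sum E F U =
     {s. (\<lambda>q. \<chi> i. s q $ Inl i) \<in> E U \<and> (\<lambda>q. \<chi> j. s q $ Inr j) \<in> F U}"


section \<open>Logarithmic connections\<close>

text \<open>
  A section of \<open>E \<otimes> \<Omega>\<^sup>1(log {0, 1, \<infinity>})\<close> over \<open>U\<close> is represented by its \<open>dz\<close>-coefficient \<open>t\<close> on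
  \<open>U - {0, 1, \<infinity>}\<close>; values of \<open>t\<close> elsewhere are irrelevant.  With the local coordinates
  \<open>x = z\<close>, \<open>x = z - 1\<close>, \<open>x = 1 / z\<close> at \<open>0\<close>, \<open>1\<close>, \<open>\<infinity>\<close> one has \<open>t dz = (log_factor p z * t) dx / x\<close>,
  and the pole at \<open>p\<close> is logarithmic iff the coefficient of \<open>dx / x\<close> extends to a
  section of \<open>E\<close> at \<open>p\<close>.
\<close>

definition log_factor :: "P1 \<Rightarrow> complex \<Rightarrow> complex" where
  "log_factor p z = (case p of Some a \<Rightarrow> z - a | None \<Rightarrow> - z)"

definition log_extends ::
    "'n::finite presheaf \<Rightarrow> P1 set \<Rightarrow> (P1 \<Rightarrow> complex^'n) \<Rightarrow> P1 \<Rightarrow> (P1 \<Rightarrow> complex^'n) \<Rightarrow> bool" where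
  "log_extends E U t p u \<longleftrightarrow>
     u \<in> E (insert p (U - punctures)) \<and>
     (\<forall>z. Some z \<in> U - punctures \<longrightarrow> u (Some z) = log_factor p z *s t (Some z))"

definition log_forms :: "'n::finite presheaf \<Rightarrow> 'n presheaf" where
  "log_forms E U =
     {t. t \<in> E (U - punctures) \<and> (\<forall>p \<in> U \<inter> punctures. \<exists>u. log_extends E U t p u)}"

type_synonym 'n conn = "P1 set \<Rightarrow> (P1 \<Rightarrow> complex^'n) \<Rightarrow> (P1 \<Rightarrow> complex^'n)"

text \<open>
  The four conditions say that \<open>D\<close> maps sections of \<open>E\<close> to sections of
  \<open>E \<otimes> \<Omega>\<^sup>1(log {0, 1, \<infinity>})\<close>, is well defined and compatible with restriction, is
  \<open>\<complex>\<close>-linear, and satisfies the Leibniz rule \<open>D (f s) = df \<otimes> s + f D s\<close>.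
\<close>

definition log_connection :: "'n::finite presheaf \<Rightarrow> 'n conn \<Rightarrow> bool" where
  "log_connection E D \<longleftrightarrow>
     vector_bundle E \<and>
     (\<forall>U s. openin P1_top U \<and> s \<in> E U \<longrightarrow> D U s \<in> log_forms E U) \<and>
     (\<forall>U V s s'. openin P1_top U \<and> openin P1_top V \<and> V \<subseteq> U \<and> s \<in> E U \<and> (\<forall>q\<in>V. s' q = s q) \<longrightarrow>
        (\<forall>q \<in> V - punctures. D V s' q = D U s q)) \<and>
     (\<forall>U s s' a b. openin P1_top U \<and> s \<in> E U \<and> s' \<in> E U \<longrightarrow>
        (\<forall>q \<in> U - punctures.
           D U (\<lambda>x. a *s s x + b *s s' x) q = a *s D U s q + b *s D U s' q)) \<and>
     (\<forall>U f s. openin P1_top U \<and> hol_fun U f \<and> s \<in> E U \<longrightarrow>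
        (\<forall>z. Some z \<in> U - punctures \<longrightarrow>
           D U (\<lambda>x. f x *s s x) (Some z) =
             deriv (\<lambda>x. f (Some x)) z *s s (Some z) + f (Some z) *s D U s (Some z)))"

definition conn_hom ::
    "'n::finite presheaf \<Rightarrow> 'n conn \<Rightarrow> 'm::finite presheaf \<Rightarrow> 'm conn \<Rightarrow>
     (P1 \<Rightarrow> complex^'n^'m) \<Rightarrow> bool" where
  "conn_hom E D F D' \<phi> \<longleftrightarrow>
     bundle_hom E F \<phi> \<and>
     (\<forall>U s. openin P1_top U \<and> s \<in> E U \<longrightarrow>
        (\<forall>q \<in> U - punctures. D' U (\<lambda>x. \<phi> x *v s x) q = \<phi> q *v D U s q))"

text \<open>The residue at \<open>p\<close>, as an endomorphism \<open>R\<close> of the fibre over \<open>p\<close>.\<close>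

definition residue_at :: "'n::finite presheaf \<Rightarrow> 'n conn \<Rightarrow> P1 \<Rightarrow> complex^'n^'n \<Rightarrow> bool" where
  "residue_at E D p R \<longleftrightarrow>
     (\<forall>U s u. openin P1_top U \<and> p \<in> U \<and> s \<in> E U \<and> log_extends E U (D U s) p u \<longrightarrow>
        u p = R *v s p)"


section \<open>Monodromy\<close>

text \<open>
  A representation of the free group on \<open>\<gamma>\<^sub>0\<close>, \<open>\<gamma>\<^sub>1\<close> on \<open>complex^'n\<close> is the pair of the images of
  the two generators, which may be arbitrary invertible matrices.
\<close>

type_synonym 'n rep = "(complex^'n^'n) \<times> (complex^'n^'n)"

definition monodromy_rep :: "'n::finite rep \<Rightarrow> bool" where
  "monodromy_rep \<rho> \<longleftrightarrow> invertible (fst \<rho>) \<and> invertible (snd \<rho>)"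

definition rep_hom :: "'n::finite rep \<Rightarrow> 'm::finite rep \<Rightarrow> complex^'n^'m \<Rightarrow> bool" where
  "rep_hom \<rho> \<tau> A \<longleftrightarrow> A ** fst \<rho> = fst \<tau> ** A \<and> A ** snd \<rho> = snd \<tau> ** A"

definition rep_short_exact ::
    "'k::finite rep \<Rightarrow> 'n::finite rep \<Rightarrow> 'm::finite rep \<Rightarrow>
     complex^'k^'n \<Rightarrow> complex^'n^'m \<Rightarrow> bool" where
  "rep_short_exact \<rho>' \<rho> \<rho>'' A B \<longleftrightarrow>
     rep_hom \<rho>' \<rho> A \<and> rep_hom \<rho> \<rho>'' B \<and> exact_maps A B"

definition local_monodromy :: "'n::finite rep \<Rightarrow> P1 \<Rightarrow> complex^'n^'n" where
  "local_monodromy \<rho> p =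
     (if p = Some 0 then fst \<rho> else if p = Some 1 then snd \<rho>
      else matrix_inv (fst \<rho> ** snd \<rho>))"

text \<open>
  Loops based at \<open>1/2\<close>.  Both run clockwise: for \<open>D = d + L dz / z\<close> the flat sections are
  \<open>z powr (- L) v\<close>, which clockwise continuation around \<open>0\<close> multiplies by \<open>exp (2 \<pi> i L)\<close>.
\<close>

definition base_pt :: complex where "base_pt = 1 / 2"

definition loop0 :: "real \<Rightarrow> complex" where
  "loop0 t = exp (- 2 * of_real pi * \<i> * of_real t) / 2"

definition loop1 :: "real \<Rightarrow> complex" where
  "loop1 t = 1 - exp (- 2 * of_real pi * \<i> * of_real t) / 2"

text \<open>\<open>\<sigma>\<close> is the continuation of a flat section of \<open>(E, D)\<close> along the path \<open>\<gamma>\<close>.\<close>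

definition flat_along ::
    "'n::finite presheaf \<Rightarrow> 'n conn \<Rightarrow> (real \<Rightarrow> complex) \<Rightarrow> (real \<Rightarrow> complex^'n) \<Rightarrow> bool" where
  "flat_along E D \<gamma> \<sigma> \<longleftrightarrow>
     (\<forall>t\<in>{0..1}. \<exists>U s \<delta>. openin P1_top U \<and> U \<inter> punctures = {} \<and> s \<in> E U \<and>
        (\<forall>q\<in>U. D U s q = 0) \<and> \<delta> > 0 \<and>
        (\<forall>t'\<in>{0..1}. \<bar>t' - t\<bar> < \<delta> \<longrightarrow> Some (\<gamma> t') \<in> U \<and> \<sigma> t' = s (Some (\<gamma> t'))))"

text \<open>
  \<open>\<Phi>\<close> identifies the representation space of \<open>\<rho>\<close> with the fibre over the base point, in such a way
  that parallel transport along the two loops becomes \<open>\<rho>\<close>.  This is the identification of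
  \<open>(E, D)\<close>, restricted to the complement of the punctures, with the holomorphic connection that
  corresponds to \<open>\<rho>\<close>.
\<close>

definition has_monodromy ::
    "'n::finite presheaf \<Rightarrow> 'n conn \<Rightarrow> complex^'n^'n \<Rightarrow> 'n rep \<Rightarrow> bool" where
  "has_monodromy E D \<Phi> \<rho> \<longleftrightarrow>
     invertible \<Phi> \<and>
     (\<forall>v. \<exists>\<sigma>. flat_along E D loop0 \<sigma> \<and> \<sigma> 0 = \<Phi> *v v \<and> \<sigma> 1 = \<Phi> *v (fst \<rho> *v v)) \<and>
     (\<forall>v. \<exists>\<sigma>. flat_along E D loop1 \<sigma> \<and> \<sigma> 0 = \<Phi> *v v \<and> \<sigma> 1 = \<Phi> *v (snd \<rho> *v v))"


section \<open>The extended logarithmic connection\<close>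

text \<open>Powers are spelt out because \<open>*\<close> and \<open>^\<close> act componentwise on matrices.\<close>

definition matrix_exp :: "complex^'n::finite^'n \<Rightarrow> complex^'n^'n" where
  "matrix_exp A = (\<Sum>k. (1 / fact k) *\<^sub>R (((**) A) ^^ k) (mat 1))"

definition principal_log :: "complex^'n::finite^'n \<Rightarrow> complex^'n^'n \<Rightarrow> bool" where
  "principal_log A L \<longleftrightarrow>
     matrix_exp (mat (2 * of_real pi * \<i>) ** L) = A \<and>
     (\<forall>c v. v \<noteq> 0 \<and> L *v v = c *s v \<longrightarrow> 0 \<le> Re c \<and> Re c < 1)"

text \<open>
  \<open>(E, D)\<close> is the extended logarithmic connection of \<open>\<rho>\<close>; it is unique up to
  a unique isomorphism compatible with \<open>\<Phi>\<close>.
\<close>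

definition log_extension ::
    "'n::finite rep \<Rightarrow> 'n presheaf \<Rightarrow> 'n conn \<Rightarrow> complex^'n^'n \<Rightarrow> bool" where
  "log_extension \<rho> E D \<Phi> \<longleftrightarrow>
     log_connection E D \<and> has_monodromy E D \<Phi> \<rho> \<and>
     (\<forall>p\<in>punctures. \<exists>L P. principal_log (local_monodromy \<rho> p) L \<and> invertible P \<and>
        residue_at E D p (P ** L ** matrix_inv P))"

text \<open>
  \<open>\<phi>\<close> is the homomorphism of logarithmic connections induced by the intertwiner \<open>A\<close>: the one
  which over the base point is \<open>A\<close>.
\<close>

definition induced_hom ::
    "'n::finite presheaf \<Rightarrow> 'n conn \<Rightarrow> complex^'n^'n \<Rightarrow>
     'm::finite presheaf \<Rightarrow> 'm conn \<Rightarrow> complex^'m^'m \<Rightarrow>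
     complex^'n^'m \<Rightarrow> (P1 \<Rightarrow> complex^'n^'m) \<Rightarrow> bool" where
  "induced_hom E D \<Phi> F D' \<Psi> A \<phi> \<longleftrightarrow>
     conn_hom E D F D' \<phi> \<and> \<phi> (Some base_pt) ** \<Phi> = \<Psi> ** A"

end

theory Submission
  imports Defs "HOL-Complex_Analysis.Cauchy_Integral_Formula" "HOL-Complex_Analysis.Winding_Numbers"
begin

text \<open>
  Three ideas combine: the extension of bundles is exact on every fibre, the degrees \<open>\<xi>'\<close>, \<open>\<xi>''\<close>
  lie between \<open>-2\<close> and \<open>0\<close>, and the class of an extension of \<open>\<O>(b)\<close> by \<open>\<O>(a)\<close> with
  \<open>a - b \<ge> -2\<close> is one complex number, which is zero unless \<open>a - b = -2\<close>.

  \<^emph>\<open>Exactness.\<close>  In frames near a point \<open>p\<close> with local coordinate \<open>x\<close>, a homomorphism \<open>\<phi>\<close> of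
  logarithmic connections is a holomorphic matrix \<open>M\<close> with \<open>x M' + A' M = M A\<close>, where \<open>A(0)\<close> and
  \<open>A'(0)\<close> are conjugate to the residues.  A leading coefficient \<open>N\<close> of degree \<open>n \<ge> 1\<close> would satisfy
  \<open>n N + A'(0) N = N A(0)\<close>, so an eigenvalue of one residue would differ by \<open>n\<close> from one of the
  other; but all real parts lie in \<open>[0, 1)\<close>.  Hence \<open>\<phi>\<close> vanishes near every point where it
  vanishes, and as the projective line is connected, \<open>\<phi>\<close> is either zero or nowhere zero
  (\<open>conn_hom_zero_or_nowhere_zero\<close>).  Applied to \<open>f\<close>, \<open>g\<close> and \<open>g f\<close>, whose values over the base
  point are prescribed by \<open>\<alpha>\<close> and \<open>\<beta>\<close>, this gives \<open>induced_short_exact\<close>.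

  \<^emph>\<open>Degrees.\<close>  For a line bundle of degree \<open>k\<close> with a logarithmic connection, the residues at \<open>0\<close>,
  \<open>1\<close>, \<open>\<infinity>\<close> add up to \<open>-k\<close>, by Liouville's theorem (\<open>residue_theorem_P1\<close>).  Their real parts lie in
  \<open>[0, 1)\<close>, so \<open>-2 \<le> k \<le> 0\<close> (\<open>degree_bounds\<close>).  In particular \<open>\<xi>' - \<xi>'' \<ge> -2\<close>, with equality only
  for \<open>(-2, 0)\<close>.

  \<^emph>\<open>Extensions.\<close>  A splitting is a global way to lift sections of the quotient line bundle.  Local
  lifts of a generator exist, and two of them differ by a holomorphic multiple of a generator of the
  subbundle.  Cousin's method, which splits such differences by Cauchy integrals over the sides of
  rectangles, yields a lift on any disc (\<open>exists_on_ball\<close>).  It is compared on an annulus with a lift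
  near infinity: the nonnegative Laurent coefficients of the difference are absorbed by the lift on
  the disc, and the coefficients of \<open>z\<^sup>j\<close> with \<open>j \<le> a - b\<close> by the lift near infinity.  For
  \<open>a - b \<ge> -1\<close> nothing remains; for \<open>a - b = -2\<close> the coefficient \<open>c\<close> of \<open>1 / z\<close> remains
  (\<open>normal_form\<close>).  If \<open>c = 0\<close>, the lifts agree and split the sequence.  If \<open>c \<noteq> 0\<close>, an explicit
  change of frames turns the transition matrix into \<open>z powi (-1)\<close> times the identity, so that the
  bundle is \<open>\<O>(-1) \<oplus> \<O>(-1)\<close>.
\<close>

section \<open>Additive splitting on rectangles\<close>

lemma Cauchy_transform_holomorphic:
  assumes "valid_path \<gamma>" and "\<And>t. t \<in> {0..1} \<Longrightarrow> norm (vector_derivative \<gamma> (at t)) \<le> B"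
    and f: "continuous_on (path_image \<gamma>) f"
    and int: "\<And>z. z \<notin> path_image \<gamma> \<Longrightarrow> (\<lambda>\<zeta>. f \<zeta> / (\<zeta> - z)) contour_integrable_on \<gamma>"
  shows "(\<lambda>z. contour_integral \<gamma> (\<lambda>\<zeta>. f \<zeta> / (\<zeta> - z))) holomorphic_on (- path_image \<gamma>)"
proof -
  have op: "open (- path_image \<gamma>)"
    using assms(1) closed_valid_path_image by blast
  have *: "((\<lambda>u. f u / (u - w) ^ 1) has_contour_integral
          contour_integral \<gamma> (\<lambda>\<zeta>. f \<zeta> / (\<zeta> - w))) \<gamma>" if "w \<in> UNIV - path_image \<gamma>" for w
    using that int has_contour_integral_integral by simp
  have "\<exists>D. ((\<lambda>z. contour_integral \<gamma> (\<lambda>\<zeta>. f \<zeta> / (\<zeta> - z))) has_field_derivative D) (at w)"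
    if "w \<in> - path_image \<gamma>" for w
    using Cauchy_next_derivative(2)[OF f assms(2) * _ open_UNIV assms(1), of w] that by auto
  then show ?thesis
    using op by (simp add: holomorphic_on_open)
qed

lemma Cauchy_transform_linepath_holomorphic:
  assumes "continuous_on (closed_segment a b) f"
  shows "(\<lambda>z. contour_integral (linepath a b) (\<lambda>\<zeta>. f \<zeta> / (\<zeta> - z)))
    holomorphic_on (- closed_segment a b)"
proof -
  have "(\<lambda>\<zeta>. f \<zeta> / (\<zeta> - z)) contour_integrable_on linepath a b"
    if "z \<notin> closed_segment a b" for z
    using that assms
    by (intro contour_integrable_continuous_linepath continuous_intros) auto
  then show ?thesis
    using Cauchy_transform_holomorphic[of "linepath a b" "norm (b - a)" f] assms by auto
qed

lemma Cauchy_transform_circlepath_holomorphic: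
  assumes "continuous_on (sphere 0 r) f" "r > 0"
  shows "(\<lambda>z. contour_integral (circlepath 0 r) (\<lambda>\<zeta>. f \<zeta> / (\<zeta> - z)))
    holomorphic_on (- sphere 0 r)"
proof -
  have "(\<lambda>\<zeta>. f \<zeta> / (\<zeta> - z)) contour_integrable_on circlepath 0 r"
    if "z \<notin> sphere 0 r" for z
    using that assms
    by (intro contour_integrable_continuous_circlepath continuous_intros) auto
  then show ?thesis
    using Cauchy_transform_holomorphic[of "circlepath 0 r" "2 * pi * \<bar>r\<bar>" f] assms
    by (simp add: vector_derivative_circlepath norm_mult)
qed

definition rect :: "real \<Rightarrow> real \<Rightarrow> real \<Rightarrow> real \<Rightarrow> complex set" where
  "rect a b c d = {z. a < Re z \<and> Re z < b \<and> c < Im z \<and> Im z < d}"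

lemma rect_eq_box: "rect a b c d = box (Complex a c) (Complex b d)"
  by (auto simp: rect_def in_box_complex_iff)

lemma open_rect [simp]: "open (rect a b c d)"
  unfolding rect_eq_box by (rule open_box)

text \<open>
  Cauchy's formula writes \<open>h\<close> as a sum of four integrals over the sides of a smaller rectangle, and
  each is holomorphic off its side.  The integral over the left side extends to everything on its
  right, and the other three extend to the left.
\<close>

lemma rect_split_Re:
  assumes h: "h holomorphic_on rect a b c d"
    and "a < a'" "a' < b'" "b' < b" "c < c'" "c' < d'" "d' < d"
  shows "\<exists>l r. l holomorphic_on {z. a' < Re z} \<and>
    r holomorphic_on {z. Re z < b' \<and> c' < Im z \<and> Im z < d'} \<and>
    (\<forall>z\<in>rect a' b' c' d'. h z = l z - r z)"
proof -
  define p1 p2 p3 p4 where p: "p1 = Complex a' c'" "p2 = Complex b' c'"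
    "p3 = Complex b' d'" "p4 = Complex a' d'"
  define T where "T = (\<lambda>u v z. contour_integral (linepath u v) (\<lambda>\<zeta>. h \<zeta> / (\<zeta> - z)) / (2 * pi * \<i>))"
  have cont: "continuous_on (rect a b c d) h"
    using h holomorphic_on_imp_continuous_on by blast
  have cv: "convex (rect a b c d)" by (simp add: rect_eq_box)
  have pin: "{p1,p2,p3,p4} \<subseteq> rect a b c d"
    using assms by (auto simp: p rect_def)
  have seg: "closed_segment u v \<subseteq> rect a b c d" if "u \<in> {p1,p2,p3,p4}" "v \<in> {p1,p2,p3,p4}" for u v
    using that pin cv by (meson closed_segment_subset subsetD)
  have T: "T u v holomorphic_on - closed_segment u v"
    if "u \<in> {p1,p2,p3,p4}" "v \<in> {p1,p2,p3,p4}" for u v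
    unfolding T_def using that seg cont
    by (intro holomorphic_intros Cauchy_transform_linepath_holomorphic)
      (auto intro: continuous_on_subset)
  have segs: "closed_segment p1 p2 \<subseteq> {z. Im z = c'}" "closed_segment p2 p3 \<subseteq> {z. Re z = b'}"
    "closed_segment p3 p4 \<subseteq> {z. Im z = d'}" "closed_segment p4 p1 \<subseteq> {z. Re z = a'}"
    using assms by (auto simp: p closed_segment_same_Im closed_segment_same_Re)
  show ?thesis
  proof (intro exI conjI ballI)
    show "T p4 p1 holomorphic_on {z. a' < Re z}"
      using segs by (intro holomorphic_on_subset[OF T]) auto
    show "(\<lambda>z. - (T p1 p2 z + T p2 p3 z + T p3 p4 z)) holomorphic_on
        {z. Re z < b' \<and> c' < Im z \<and> Im z < d'}"
      using segs by (intro holomorphic_intros holomorphic_on_subset[OF T]) auto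
    fix z assume z: "z \<in> rect a' b' c' d'"
    have zbox: "z \<in> box p1 p3"
      using z by (simp add: rect_eq_box p)
    have nin: "z \<notin> closed_segment u v" if "(u,v) \<in> {(p1,p2),(p2,p3),(p3,p4),(p4,p1)}" for u v
      using that segs z by (auto simp: rect_def)
    have zin: "z \<in> rect a b c d"
      using z assms by (auto simp: rect_def)
    have le: "Re p1 \<le> Re p3" "Im p1 \<le> Im p3" using assms by (auto simp: p)
    have "path_image (rectpath p1 p3) \<subseteq> cbox p1 p3"
      using path_image_rectpath_subset_cbox[OF le] .
    moreover have "cbox p1 p3 \<subseteq> rect a b c d"
      using assms by (auto simp: rect_def p in_cbox_complex_iff)
    moreover have "z \<notin> path_image (rectpath p1 p3)"
      using path_image_rectpath_cbox_minus_box[OF le] zbox by auto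
    ultimately have pi: "path_image (rectpath p1 p3) \<subseteq> rect a b c d - {z}" by auto
    have wn: "winding_number (rectpath p1 p3) z = 1"
      using winding_number_rectpath[OF zbox] .
    have "((\<lambda>w. h w / (w - z)) has_contour_integral (2 * pi * \<i> * h z)) (rectpath p1 p3)"
      using Cauchy_integral_formula_convex_simple[OF cv h _ valid_path_rectpath pi] zin wn
      by (simp add: interior_open)
    then have 1: "contour_integral (rectpath p1 p3) (\<lambda>w. h w / (w - z)) = 2 * pi * \<i> * h z"
      by (rule contour_integral_unique)
    have ci: "(\<lambda>w. h w / (w - z)) contour_integrable_on linepath u v"
      if "(u,v) \<in> {(p1,p2),(p2,p3),(p3,p4),(p4,p1)}" for u v
    proof -
      have "closed_segment u v \<subseteq> rect a b c d" using that seg by auto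
      then show ?thesis
        using nin[OF that]
        by (intro contour_integrable_continuous_linepath continuous_intros
            continuous_on_subset[OF cont]) auto
    qed
    have ci3: "(\<lambda>w. h w / (w - z)) contour_integrable_on linepath p3 p4 +++ linepath p4 p1"
      by (subst contour_integrable_join) (auto simp: ci)
    have ci2: "(\<lambda>w. h w / (w - z)) contour_integrable_on
        linepath p2 p3 +++ linepath p3 p4 +++ linepath p4 p1"
      by (subst contour_integrable_join) (use ci3 in \<open>auto simp: ci\<close>)
    have "contour_integral (rectpath p1 p3) (\<lambda>w. h w / (w - z)) =
        2 * pi * \<i> * (T p1 p2 z + T p2 p3 z + T p3 p4 z + T p4 p1 z)"
      unfolding rectpath_def T_def Let_def
      using ci ci2 ci3 by (simp add: p field_simps)
    with 1 have "h z = T p1 p2 z + T p2 p3 z + T p3 p4 z + T p4 p1 z" by simp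
    then show "h z = T p4 p1 z - - (T p1 p2 z + T p2 p3 z + T p3 p4 z)"
      by (simp add: add.commute add.left_commute)
  qed
qed

text \<open>
  The horizontal splitting, transported by the rotation \<open>w \<mapsto> \<i> w\<close>.
\<close>

lemma rect_split_Im:
  assumes h: "h holomorphic_on rect a b c d"
    and "a < a'" "a' < b'" "b' < b" "c < c'" "c' < d'" "d' < d"
  shows "\<exists>l r. l holomorphic_on {z. c' < Im z} \<and>
    r holomorphic_on {z. Im z < d' \<and> a' < Re z \<and> Re z < b'} \<and>
    (\<forall>z\<in>rect a' b' c' d'. h z = l z - r z)"
proof -
  have "(h \<circ> (\<lambda>w. \<i> * w)) holomorphic_on rect c d (-b) (-a)"
    by (intro holomorphic_on_compose_gen[OF _ h] holomorphic_intros) (auto simp: rect_def)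
  then obtain l r where l: "l holomorphic_on {z. c' < Re z}"
    and r: "r holomorphic_on {z. Re z < d' \<and> - b' < Im z \<and> Im z < - a'}"
    and lr: "\<forall>z\<in>rect c' d' (- b') (- a'). (h \<circ> (\<lambda>w. \<i> * w)) z = l z - r z"
    using rect_split_Re[where a = c and b = d and c = "- b" and d = "- a" and
        a' = c' and b' = d' and c' = "- b'" and d' = "- a'" and h = "h \<circ> (\<lambda>w. \<i> * w)"] assms
    by auto
  show ?thesis
  proof (intro exI conjI ballI)
    show "(l \<circ> (\<lambda>z. - \<i> * z)) holomorphic_on {z. c' < Im z}"
      by (intro holomorphic_on_compose_gen[OF _ l] holomorphic_intros) auto
    show "(r \<circ> (\<lambda>z. - \<i> * z)) holomorphic_on {z. Im z < d' \<and> a' < Re z \<and> Re z < b'}"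
      by (intro holomorphic_on_compose_gen[OF _ r] holomorphic_intros) auto
    fix z assume "z \<in> rect a' b' c' d'"
    then have "- \<i> * z \<in> rect c' d' (- b') (- a')" by (auto simp: rect_def)
    from bspec[OF lr this] show "h z = (l \<circ> (\<lambda>z. - \<i> * z)) z - (r \<circ> (\<lambda>z. - \<i> * z)) z"
      by (simp add: o_def mult.assoc[symmetric])
  qed
qed

section \<open>Affine sheaves over the holomorphic functions\<close>

text \<open>
  \<open>L U s\<close> is meant to say that \<open>s\<close> is an admissible section over \<open>U\<close> (later: a lift of a fixed
  section of a quotient bundle).  The admissible sections form a torsor under the holomorphic
  multiples of \<open>k\<close>; the point of the locale is that such a torsor has sections over every disc.
\<close>

locale holomorphic_torsor =
  fixes L :: "complex set \<Rightarrow> (complex \<Rightarrow> complex^'n) \<Rightarrow> bool"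
    and k :: "complex \<Rightarrow> complex^'n"
  assumes shift: "\<lbrakk>open U; L U s; h holomorphic_on U\<rbrakk> \<Longrightarrow> L U (\<lambda>z. s z + h z *s k z)"
    and difference: "\<lbrakk>open U; L U s; L U t\<rbrakk> \<Longrightarrow>
      \<exists>h. h holomorphic_on U \<and> (\<forall>z\<in>U. t z = s z + h z *s k z)"
    and restrict: "\<lbrakk>open U; open W; W \<subseteq> U; L U s\<rbrakk> \<Longrightarrow> L W s"
    and glue: "\<lbrakk>open U; open W; L U s; L W t; \<forall>z\<in>U \<inter> W. s z = t z\<rbrakk> \<Longrightarrow>
      L (U \<union> W) (\<lambda>z. if z \<in> U then s z else t z)"
    and local: "\<exists>U s. open U \<and> z \<in> U \<and> L U s"
begin

text \<open>
  If differences of sections over \<open>A \<inter> B\<close> can be split additively, at the price of shrinking \<open>A\<close> and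
  \<open>B\<close>, then the two halves of the splitting correct \<open>s\<close> and \<open>t\<close> to sections that agree.
\<close>

lemma merge:
  assumes op: "open A" "open B" "open A'" "open B'" and sub: "A' \<subseteq> A" "B' \<subseteq> B"
    and L: "L A s" "L B t"
    and split: "\<And>h. h holomorphic_on A \<inter> B \<Longrightarrow>
      \<exists>l r. l holomorphic_on P \<and> r holomorphic_on Q \<and> (\<forall>z\<in>A' \<inter> B'. h z = l z - r z)"
    and PQ: "B' \<subseteq> P" "A' \<subseteq> Q"
  shows "\<exists>u. L (A' \<union> B') u"
proof -
  have opi: "open (A \<inter> B)" using op by auto
  have "L (A \<inter> B) s" "L (A \<inter> B) t"
    using restrict[OF op(1) opi _ L(1)] restrict[OF op(2) opi _ L(2)] by auto
  then obtain h where h: "h holomorphic_on A \<inter> B" "\<forall>z\<in>A \<inter> B. t z = s z + h z *s k z"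
    using difference[OF opi] by blast
  obtain l r where r: "r holomorphic_on A'" and l: "l holomorphic_on B'"
    and lr: "\<forall>z\<in>A' \<inter> B'. h z = l z - r z"
    using split[OF h(1)] PQ holomorphic_on_subset by metis
  have "L A' (\<lambda>z. s z + (- r z) *s k z)"
    using r by (intro shift op restrict[OF op(1) op(3) sub(1) L(1)] holomorphic_intros)
  moreover have "L B' (\<lambda>z. t z + (- l z) *s k z)"
    using l by (intro shift op restrict[OF op(2) op(4) sub(2) L(2)] holomorphic_intros)
  moreover have "\<forall>z\<in>A' \<inter> B'. s z + (- r z) *s k z = t z + (- l z) *s k z"
  proof
    fix z assume z: "z \<in> A' \<inter> B'"
    have "t z = s z + h z *s k z" using h(2) z sub by blast
    moreover have "h z = l z - r z" using lr z by blast
    ultimately show "s z + (- r z) *s k z = t z + (- l z) *s k z"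
      by (simp add: vec_eq_iff algebra_simps)
  qed
  ultimately show ?thesis
    using glue[OF op(3,4)] by blast
qed

lemma merge_Re:
  assumes "a \<le> a1" "b1 \<le> b" "L (rect a b1 c d) s" "L (rect a1 b c d) t"
    and "a1 < b1" "c < c'" "c' < d'" "d' < d"
  shows "\<exists>u. L (rect a b c' d') u"
proof -
  define m n where "m = a1 + (b1 - a1) / 3" "n = a1 + 2 * (b1 - a1) / 3"
  have mn: "a1 < m" "m < n" "n < b1" using assms by (auto simp: m_n_def field_simps)
  have "\<exists>u. L (rect a n c' d' \<union> rect m b c' d') u"
  proof (rule merge[OF open_rect open_rect open_rect open_rect _ _ assms(3,4)])
    have "rect a b1 c d \<inter> rect a1 b c d = rect a1 b1 c d" "rect a n c' d' \<inter> rect m b c' d' = rect m n c' d'"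
      using assms mn by (auto simp: rect_def)
    then show "\<And>h. h holomorphic_on rect a b1 c d \<inter> rect a1 b c d \<Longrightarrow> \<exists>l r. l holomorphic_on {z. m < Re z} \<and>
        r holomorphic_on {z. Re z < n \<and> c' < Im z \<and> Im z < d'} \<and>
        (\<forall>z\<in>rect a n c' d' \<inter> rect m b c' d'. h z = l z - r z)"
      using rect_split_Re[OF _ mn assms(6-8)] by simp
  qed (use assms mn in \<open>auto simp: rect_def\<close>)
  moreover have "rect a n c' d' \<union> rect m b c' d' = rect a b c' d'"
    using assms mn by (auto simp: rect_def)
  ultimately show ?thesis by simp
qed

lemma merge_Im:
  assumes "c \<le> c1" "d1 \<le> d" "L (rect a b c d1) s" "L (rect a b c1 d) t"
    and "c1 < d1" "a < a'" "a' < b'" "b' < b"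
  shows "\<exists>u. L (rect a' b' c d) u"
proof -
  define m n where "m = c1 + (d1 - c1) / 3" "n = c1 + 2 * (d1 - c1) / 3"
  have mn: "c1 < m" "m < n" "n < d1" using assms by (auto simp: m_n_def field_simps)
  have "\<exists>u. L (rect a' b' c n \<union> rect a' b' m d) u"
  proof (rule merge[OF open_rect open_rect open_rect open_rect _ _ assms(3,4)])
    have "rect a b c d1 \<inter> rect a b c1 d = rect a b c1 d1" "rect a' b' c n \<inter> rect a' b' m d = rect a' b' m n"
      using assms mn by (auto simp: rect_def)
    then show "\<And>h. h holomorphic_on rect a b c d1 \<inter> rect a b c1 d \<Longrightarrow> \<exists>l r. l holomorphic_on {z. m < Im z} \<and>
        r holomorphic_on {z. Im z < n \<and> a' < Re z \<and> Re z < b'} \<and>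
        (\<forall>z\<in>rect a' b' c n \<inter> rect a' b' m d. h z = l z - r z)"
      using rect_split_Im[OF _ assms(6-8) mn] by simp
  qed (use assms mn in \<open>auto simp: rect_def\<close>)
  moreover have "rect a' b' c n \<union> rect a' b' m d = rect a' b' c d"
    using assms mn by (auto simp: rect_def)
  ultimately show ?thesis by simp
qed

lemma restrict_rect:
  assumes "L (rect a b c d) s" "a \<le> a'" "b' \<le> b" "c \<le> c'" "d' \<le> d"
  shows "L (rect a' b' c' d') s"
proof (rule restrict[OF open_rect open_rect _ assms(1)])
  show "rect a' b' c' d' \<subseteq> rect a b c d" using assms by (auto simp: rect_def)
qed

lemma exists_near_point: "\<exists>e>0. \<exists>s. L (rect (x - e) (x + e) (y - e) (y + e)) s"
proof -
  obtain U s where U: "open U" "Complex x y \<in> U" "L U s"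
    using local by blast
  then obtain e where e: "e > 0" "ball (Complex x y) e \<subseteq> U"
    using openE by blast
  have "rect (x - e/2) (x + e/2) (y - e/2) (y + e/2) \<subseteq> ball (Complex x y) e"
  proof
    fix z assume "z \<in> rect (x - e/2) (x + e/2) (y - e/2) (y + e/2)"
    then have "\<bar>Re (Complex x y - z)\<bar> < e/2" "\<bar>Im (Complex x y - z)\<bar> < e/2"
      unfolding rect_def abs_less_iff by simp_all
    then have "norm (Complex x y - z) < e"
      using cmod_le[of "Complex x y - z"] by linarith
    then show "z \<in> ball (Complex x y) e" by (simp add: dist_norm)
  qed
  then have "L (rect (x - e/2) (x + e/2) (y - e/2) (y + e/2)) s"
    using U e restrict[OF U(1) open_rect] by blast
  then show ?thesis using e by (meson half_gt_zero)
qed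

text \<open>
  Bisection: sections exist over neighbourhoods of short segments, and sections over neighbourhoods of
  two adjacent segments merge.  The splitting shrinks the rectangles transversally, so the claim must
  be about some neighbourhood and not about one of fixed height.
\<close>

lemma exists_near_horizontal_segment:
  assumes "a \<le> b"
  shows "\<exists>e>0. \<exists>s. L (rect (a - e) (b + e) (y - e) (y + e)) s"
  using assms
proof (induction rule: Bolzano)
  case (trans a b c)
  then obtain e1 s e2 t where e: "e1 > 0" "e2 > 0"
    and st: "L (rect (a - e1) (b + e1) (y - e1) (y + e1)) s"
      "L (rect (b - e2) (c + e2) (y - e2) (y + e2)) t" by blast
  define e where "e = min e1 e2"
  have e0: "e > 0" "e \<le> e1" "e \<le> e2" using e by (auto simp: e_def)
  have "L (rect (a - e) (b + e) (y - e) (y + e)) s"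
    by (rule restrict_rect[OF st(1)]) (use e0 in auto)
  moreover have "L (rect (b - e) (c + e) (y - e) (y + e)) t"
    by (rule restrict_rect[OF st(2)]) (use e0 in auto)
  ultimately have "\<exists>u. L (rect (a - e) (c + e) (y - e/2) (y + e/2)) u"
    by (intro merge_Re[of "a - e" "b - e" "b + e" "c + e"]) (use e0 trans in auto)
  then obtain u where "L (rect (a - e) (c + e) (y - e/2) (y + e/2)) u" by blast
  then have "L (rect (a - e/2) (c + e/2) (y - e/2) (y + e/2)) u"
    by (rule restrict_rect) (use e0 in auto)
  then show ?case using e0 by (meson half_gt_zero)
next
  case (local x)
  obtain e s where e: "e > 0" "L (rect (x - e) (x + e) (y - e) (y + e)) s"
    using exists_near_point by blast
  show ?case
  proof (rule exI[of _ "e/2"], intro conjI allI impI)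
    fix u v assume uv: "u \<le> x \<and> x \<le> v \<and> v - u < e/2"
    have "L (rect (u - e/2) (v + e/2) (y - e/2) (y + e/2)) s"
      by (rule restrict_rect[OF e(2)]) (use uv e in auto)
    then show "\<exists>e>0. \<exists>s. L (rect (u - e) (v + e) (y - e) (y + e)) s"
      using e by (meson half_gt_zero)
  qed (use e in auto)
qed

lemma exists_near_rectangle:
  assumes "c \<le> d" and ab: "a \<le> b"
  shows "\<exists>e>0. \<exists>s. L (rect (a - e) (b + e) (c - e) (d + e)) s"
  using assms(1)
proof (induction rule: Bolzano)
  case (trans c d f)
  then obtain e1 s e2 t where e: "e1 > 0" "e2 > 0"
    and st: "L (rect (a - e1) (b + e1) (c - e1) (d + e1)) s"
      "L (rect (a - e2) (b + e2) (d - e2) (f + e2)) t" by blast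
  define e where "e = min e1 e2"
  have e0: "e > 0" "e \<le> e1" "e \<le> e2" using e by (auto simp: e_def)
  have "L (rect (a - e) (b + e) (c - e) (d + e)) s"
    by (rule restrict_rect[OF st(1)]) (use e0 in auto)
  moreover have "L (rect (a - e) (b + e) (d - e) (f + e)) t"
    by (rule restrict_rect[OF st(2)]) (use e0 in auto)
  ultimately have "\<exists>u. L (rect (a - e/2) (b + e/2) (c - e) (f + e)) u"
    by (intro merge_Im[of "c - e" "d - e" "d + e" "f + e"]) (use e0 trans ab in auto)
  then obtain u where "L (rect (a - e/2) (b + e/2) (c - e) (f + e)) u" by blast
  then have "L (rect (a - e/2) (b + e/2) (c - e/2) (f + e/2)) u"
    by (rule restrict_rect) (use e0 in auto)
  then show ?case using e0 by (meson half_gt_zero)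
next
  case (local y)
  obtain e s where e: "e > 0" "L (rect (a - e) (b + e) (y - e) (y + e)) s"
    using exists_near_horizontal_segment[OF ab] by blast
  show ?case
  proof (rule exI[of _ "e/2"], intro conjI allI impI)
    fix u v assume uv: "u \<le> y \<and> y \<le> v \<and> v - u < e/2"
    have "L (rect (a - e/2) (b + e/2) (u - e/2) (v + e/2)) s"
      by (rule restrict_rect[OF e(2)]) (use uv e in auto)
    then show "\<exists>e>0. \<exists>s. L (rect (a - e) (b + e) (u - e) (v + e)) s"
      using e by (meson half_gt_zero)
  qed (use e in auto)
qed

theorem exists_on_ball: "\<exists>s. L (ball 0 r) s"
proof (cases "r > 0")
  case True
  then obtain e s where e: "e > 0" "L (rect (- r - e) (r + e) (- r - e) (r + e)) s"
    using exists_near_rectangle[of "- r" r "- r" r] by auto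
  have "ball 0 r \<subseteq> rect (- r - e) (r + e) (- r - e) (r + e)"
  proof
    fix z :: complex assume "z \<in> ball 0 r"
    then have "\<bar>Re z\<bar> < r" "\<bar>Im z\<bar> < r"
      using abs_Re_le_cmod[of z] abs_Im_le_cmod[of z] by auto
    then show "z \<in> rect (- r - e) (r + e) (- r - e) (r + e)"
      using e(1) by (auto simp: rect_def)
  qed
  then show ?thesis using restrict[OF open_rect open_ball _ e(2)] by blast
next
  case False
  then have e: "ball (0::complex) r = {}" by auto
  obtain U s where "open U" "L U s" using local by blast
  then have "L {} s" using restrict[of U "{}"] by auto
  then show ?thesis unfolding e by blast
qed

end

section \<open>Laurent splitting on an annulus\<close>

text \<open>
  The difference quotient of \<open>h\<close> at \<open>z\<close> is holomorphic on the whole annulus, so its integrals over the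
  two homotopic circles agree; \<open>z\<close> is inside only the outer one.
\<close>

lemma annulus_Cauchy:
  assumes h: "h holomorphic_on {z. r < norm z \<and> norm z < R}"
    and r: "0 \<le> r" "r < a" "a < norm z" "norm z < b" "b < R"
  shows "2 * pi * \<i> * h z = contour_integral (circlepath 0 b) (\<lambda>\<zeta>. h \<zeta> / (\<zeta> - z)) -
    contour_integral (circlepath 0 a) (\<lambda>\<zeta>. h \<zeta> / (\<zeta> - z))"
proof -
  define A where "A = {z::complex. r < norm z \<and> norm z < R}"
  have A: "open A" unfolding A_def
    by (intro open_Collect_conj open_Collect_less continuous_intros)
  have zA: "z \<in> A" using r by (auto simp: A_def)
  define q where "q = (\<lambda>\<zeta>. if \<zeta> = z then deriv h z else (h \<zeta> - h z) / (\<zeta> - z))"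
  have q: "q holomorphic_on A"
    unfolding q_def using h zA A by (intro pole_lemma) (auto simp: A_def[symmetric] interior_open)
  have sph: "sphere 0 s \<subseteq> A" if "s \<in> {a..b}" for s
    using that r by (auto simp: A_def)
  have "homotopic_loops A (circlepath 0 a) (circlepath 0 b)"
  proof (rule homotopic_loops_linear)
    fix t :: real assume "t \<in> {0..1}"
    show "closed_segment (circlepath 0 a t) (circlepath 0 b t) \<subseteq> A"
    proof
      fix x assume "x \<in> closed_segment (circlepath 0 a t) (circlepath 0 b t)"
      then obtain u where u: "0 \<le> u" "u \<le> 1"
        and x: "x = (1 - u) *\<^sub>R circlepath 0 a t + u *\<^sub>R circlepath 0 b t"
        by (auto simp: in_segment)
      have "x = of_real ((1 - u) * a + u * b) * exp (2 * of_real pi * \<i> * of_real t)"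
        unfolding x circlepath by (simp add: scaleR_conv_of_real algebra_simps)
      then have nx: "norm x = \<bar>(1 - u) * a + u * b\<bar>"
        by (simp add: norm_mult del: of_real_add of_real_mult of_real_diff)
      have "a \<le> (1 - u) * a + u * b" "(1 - u) * a + u * b \<le> b"
        using u r mult_left_mono[of a b u] mult_left_mono[of a b "1 - u"] by (auto simp: algebra_simps)
      then show "x \<in> A" using nx r by (auto simp: A_def)
    qed
  qed auto
  then have eq: "contour_integral (circlepath 0 a) q = contour_integral (circlepath 0 b) q"
    using Cauchy_theorem_homotopic_loops[OF _ A q] by auto
  have cont: "continuous_on (sphere 0 s) h" if "s \<in> {a..b}" for s
    using h sph[OF that] by (auto simp: A_def intro: holomorphic_on_imp_continuous_on holomorphic_on_subset)
  have ci: "(\<lambda>\<zeta>. h \<zeta> / (\<zeta> - z)) contour_integrable_on circlepath 0 s"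
      "(\<lambda>\<zeta>. h z / (\<zeta> - z)) contour_integrable_on circlepath 0 s"
      "contour_integral (circlepath 0 s) q = contour_integral (circlepath 0 s) (\<lambda>\<zeta>. h \<zeta> / (\<zeta> - z))
        - contour_integral (circlepath 0 s) (\<lambda>\<zeta>. h z / (\<zeta> - z))" if s: "s = a \<or> s = b" for s
  proof -
    have s0: "s > 0" "norm z \<noteq> s" "s \<in> {a..b}" using s r by auto
    show 1: "(\<lambda>\<zeta>. h \<zeta> / (\<zeta> - z)) contour_integrable_on circlepath 0 s"
      and 2: "(\<lambda>\<zeta>. h z / (\<zeta> - z)) contour_integrable_on circlepath 0 s"
      using s0 by (intro contour_integrable_continuous_circlepath continuous_intros;
          use cont[OF s0(3)] in auto)+
    have "contour_integral (circlepath 0 s) q =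
        contour_integral (circlepath 0 s) (\<lambda>\<zeta>. h \<zeta> / (\<zeta> - z) - h z / (\<zeta> - z))"
      by (rule contour_integral_eq) (use s0 in \<open>auto simp: q_def diff_divide_distrib\<close>)
    also have "\<dots> = contour_integral (circlepath 0 s) (\<lambda>\<zeta>. h \<zeta> / (\<zeta> - z))
        - contour_integral (circlepath 0 s) (\<lambda>\<zeta>. h z / (\<zeta> - z))"
      by (rule contour_integral_diff[OF 1 2])
    finally show "contour_integral (circlepath 0 s) q =
      contour_integral (circlepath 0 s) (\<lambda>\<zeta>. h \<zeta> / (\<zeta> - z))
        - contour_integral (circlepath 0 s) (\<lambda>\<zeta>. h z / (\<zeta> - z))" .
  qed
  have "contour_integral (circlepath 0 b) (\<lambda>\<zeta>. h z / (\<zeta> - z)) = 2 * pi * \<i> * h z"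
    using Cauchy_integral_circlepath_simple[of "\<lambda>_. h z" 0 b z] r
    by (intro contour_integral_unique) (auto simp: mult.commute)
  moreover have "contour_integral (circlepath 0 a) (\<lambda>\<zeta>. h z / (\<zeta> - z)) = 0"
  proof (rule contour_integral_unique, rule Cauchy_theorem_convex_simple[of _ "ball 0 (norm z)"])
    show "(\<lambda>\<zeta>. h z / (\<zeta> - z)) holomorphic_on ball 0 (cmod z)"
      by (intro holomorphic_intros) auto
  qed (use r in auto)
  ultimately show ?thesis using ci(3)[of a] ci(3)[of b] eq by (simp add: algebra_simps)
qed

lemma Cauchy_transform_tendsto_0:
  assumes "continuous_on (sphere 0 a) f" "a > 0"
  shows "((\<lambda>z. contour_integral (circlepath 0 a) (\<lambda>\<zeta>. f \<zeta> / (\<zeta> - z))) \<longlongrightarrow> 0) at_infinity"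
proof -
  obtain M where M: "M > 0" "\<forall>x\<in>f ` sphere 0 a. norm x \<le> M"
    using compact_imp_bounded[OF compact_continuous_image[OF assms(1) compact_sphere]]
    unfolding bounded_pos by blast
  have *: "norm (contour_integral (circlepath 0 a) (\<lambda>\<zeta>. f \<zeta> / (\<zeta> - z))) \<le> M / (norm z - a) * (2 * pi * a)"
    if z: "norm z > a" for z
  proof (rule has_contour_integral_bound_circlepath)
    show "((\<lambda>\<zeta>. f \<zeta> / (\<zeta> - z)) has_contour_integral
        contour_integral (circlepath 0 a) (\<lambda>\<zeta>. f \<zeta> / (\<zeta> - z))) (circlepath 0 a)"
      using z assms by (intro has_contour_integral_integral
          contour_integrable_continuous_circlepath continuous_intros) auto
    fix \<zeta> :: complex assume "norm (\<zeta> - 0) = a"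
    then show "norm (f \<zeta> / (\<zeta> - z)) \<le> M / (norm z - a)"
      using M z norm_triangle_ineq2[of z \<zeta>]
      by (auto simp: norm_divide norm_minus_commute intro!: frac_le)
  qed (use M z assms in auto)
  have lim: "((\<lambda>z::complex. M / (norm z - a) * (2 * pi * a)) \<longlongrightarrow> 0) at_infinity"
  proof -
    have "filterlim (\<lambda>z::complex. - a + norm z) at_top at_infinity"
      by (rule filterlim_tendsto_add_at_top[OF tendsto_const filterlim_norm_at_top])
    then have "((\<lambda>z::complex. M / (norm z - a)) \<longlongrightarrow> 0) at_infinity"
      by (intro tendsto_divide_0[OF tendsto_const] filterlim_at_top_imp_at_infinity) simp
    then show ?thesis by (rule tendsto_mult_left_zero)
  qed
  show ?thesis
  proof (rule Lim_null_comparison[OF _ lim])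
    show "\<forall>\<^sub>F z in at_infinity. norm (contour_integral (circlepath 0 a) (\<lambda>\<zeta>. f \<zeta> / (\<zeta> - z)))
        \<le> M / (norm z - a) * (2 * pi * a)"
      unfolding eventually_at_infinity by (rule exI[of _ "a + 1"]) (use * in auto)
  qed
qed

text \<open>
  The Laurent expansion of \<open>h\<close>, kept in closed form: \<open>l\<close> collects the nonnegative powers, \<open>c\<close> is the
  coefficient of \<open>1 / z\<close>, and \<open>g\<close> collects the powers below.  The integral over the inner circle tends
  to \<open>0\<close> at infinity, so that as a function of \<open>1 / z\<close> it has a removable singularity and a zero at \<open>0\<close>.
\<close>

lemma annulus_split:
  fixes h :: "complex \<Rightarrow> complex"
  assumes h: "h holomorphic_on {z. r < norm z \<and> norm z < R}" and r: "0 \<le> r" "r < R"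
  obtains l c g r' R' where "r < r'" "r' < R'" "R' < R"
    and "l holomorphic_on ball 0 R'" and "g holomorphic_on ball 0 (1 / r')"
    and "\<And>z::complex. r' < norm z \<Longrightarrow> norm z < R' \<Longrightarrow> h z = l z + c / z + g (1 / z) / z ^ 2"
proof -
  define a b where ab_def: "a = r + (R - r) / 3" "b = r + 2 * (R - r) / 3"
  have ab: "r < a" "a < b" "b < R" "0 < a" using r by (auto simp: ab_def field_simps)
  define F where "F = (\<lambda>s z. contour_integral (circlepath 0 s) (\<lambda>\<zeta>. h \<zeta> / (\<zeta> - z)) / (2 * pi * \<i>))"
  have cont: "continuous_on (sphere 0 s) h" if "s \<in> {a..b}" for s
    using that ab by (intro holomorphic_on_imp_continuous_on holomorphic_on_subset[OF h]) auto
  have F: "F s holomorphic_on - sphere 0 s" if "s \<in> {a..b}" for s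
    unfolding F_def using that cont[OF that] ab
    by (intro holomorphic_intros Cauchy_transform_circlepath_holomorphic) auto
  have lim0: "(F a \<longlongrightarrow> 0) at_infinity"
    unfolding F_def using Cauchy_transform_tendsto_0[OF cont, of a] ab
    by (intro tendsto_divide_zero) auto
  \<comment> \<open>The part holomorphic outside the inner circle, in the coordinate \<open>w = 1 / z\<close>.\<close>
  define P where "P = (\<lambda>w. if w = 0 then 0 else - F a (1 / w))"
  have "P holomorphic_on ball 0 (1/a)"
  proof (rule no_isolated_singularity[of _ _ "{0}"])
    have "(\<lambda>w. - F a (1 / w)) holomorphic_on ball 0 (1/a) - {0}"
    proof (rule holomorphic_on_minus)
      have "(F a \<circ> (\<lambda>w. 1 / w)) holomorphic_on ball 0 (1/a) - {0}"
        by (intro holomorphic_on_compose_gen[OF _ F[of a]] holomorphic_intros)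
          (use ab in \<open>auto simp: norm_divide field_simps\<close>)
      then show "(\<lambda>w. F a (1 / w)) holomorphic_on ball 0 (1/a) - {0}" by (simp add: o_def)
    qed
    then show hol: "P holomorphic_on ball 0 (1/a) - {0}"
      by (rule holomorphic_transform) (auto simp: P_def)
    have "((\<lambda>w. - F a (1 / w)) \<longlongrightarrow> - 0) (at 0)"
      using lim0 by (intro tendsto_minus) (simp add: lim_at_infinity_0 o_def inverse_eq_divide)
    then have "(P \<longlongrightarrow> P 0) (at 0)"
      by (subst tendsto_cong[of _ "\<lambda>w. - F a (1 / w)"]) (auto simp: P_def eventually_at_filter)
    then have "isCont P 0" by (simp add: isCont_def)
    moreover have "isCont P w" if "w \<in> ball 0 (1/a) - {0}" for w
      using hol that by (meson continuous_on_eq_continuous_at holomorphic_on_imp_continuous_on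
          open_Diff open_ball finite_imp_closed finite.emptyI finite.insertI)
    ultimately show "continuous_on (ball 0 (1/a)) P"
      by (metis DiffI continuous_at_imp_continuous_on singletonD)
  qed auto
  define Q where "Q = (\<lambda>w. if w = 0 then deriv P 0 else (P w - P 0) / (w - 0))"
  have Q: "Q holomorphic_on ball 0 (1/a)"
    unfolding Q_def by (rule pole_lemma) (use ab \<open>P holomorphic_on _\<close> in auto)
  define g where "g = (\<lambda>w. if w = 0 then deriv Q 0 else (Q w - Q 0) / (w - 0))"
  have g: "g holomorphic_on ball 0 (1/a)"
    unfolding g_def by (rule pole_lemma) (use ab Q in auto)
  show ?thesis
  proof (rule that[OF ab(1-3) _ g])
    show "F b holomorphic_on ball 0 b"
      using ab by (intro holomorphic_on_subset[OF F]) auto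
    fix z :: complex assume z: "a < norm z" "norm z < b"
    then have z0: "z \<noteq> 0" using ab by auto
    have "h z = F b z - F a z"
      using annulus_Cauchy[OF h r(1) ab(1) z ab(3)] by (simp add: F_def field_simps)
    also have "\<dots> = F b z + P (1 / z)" using z0 by (simp add: P_def)
    also have "\<dots> = F b z + Q (1 / z) / z" using z0 by (simp add: Q_def P_def)
    also have "\<dots> = F b z + (Q 0 + g (1 / z) / z) / z" using z0 by (simp add: g_def)
    finally show "h z = F b z + Q 0 / z + g (1 / z) / z ^ 2"
      using z0 by (simp add: add_divide_distrib power2_eq_square)
  qed
qed

section \<open>Charts of the projective line\<close>

text \<open>
  The one-point compactification carries the topology of a complex manifold with charts \<open>Some\<close> and
  \<open>chart_inf\<close>, so that openness and holomorphy can be tested in the same charts.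
\<close>

lemma openin_P1_iff:
  "openin P1_top U \<longleftrightarrow> open {z. Some z \<in> U} \<and> open {w. chart_inf w \<in> U}"
proof
  assume U: "openin P1_top U"
  have 1: "open {z. Some z \<in> U}"
    using U openin_continuous_map_preimage[OF continuous_map_Some, of euclidean U]
    by (simp add: P1_top_def)
  have inv: "open {w. w \<noteq> 0 \<and> Some (1 / w) \<in> U}"
  proof -
    have "open (- {0} \<inter> (\<lambda>w. 1 / w) -` {z. Some z \<in> U})"
      using 1 by (intro continuous_open_preimage continuous_intros) auto
    moreover have "- {0} \<inter> (\<lambda>w. 1 / w) -` {z. Some z \<in> U} = {w. w \<noteq> 0 \<and> Some (1 / w) \<in> U}" by auto
    ultimately show ?thesis by simp
  qed
  have "open {w. chart_inf w \<in> U}"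
  proof (cases "None \<in> U")
    case False
    then have "{w. chart_inf w \<in> U} = {w. w \<noteq> 0 \<and> Some (1 / w) \<in> U}"
      by (auto simp: chart_inf_def)
    then show ?thesis using inv by simp
  next
    case True
    then obtain C where C: "compact C" "U = insert None (Some ` (- C))"
      using U by (auto simp: P1_top_def openin_Alexandroff_compactification Compl_eq_Diff_UNIV)
    then obtain B where B: "B > 0" "\<forall>z\<in>C. norm z \<le> B"
      using compact_imp_bounded bounded_pos by blast
    have "{w. chart_inf w \<in> U} = {w. w \<noteq> 0 \<and> Some (1 / w) \<in> U} \<union> ball 0 (1 / B)"
    proof -
      have "chart_inf w \<in> U" if "norm w < 1 / B" for w
      proof (cases "w = 0")
        case False
        then have "norm (1 / w) > B" using that B by (simp add: norm_divide field_simps)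
        then have "1 / w \<notin> C" using B by force
        then show ?thesis using C False by (auto simp: chart_inf_def)
      qed (use True in \<open>auto simp: chart_inf_def\<close>)
      then have "ball 0 (1 / B) \<subseteq> {w. chart_inf w \<in> U}" by auto
      moreover have "{w. w \<noteq> 0 \<and> Some (1 / w) \<in> U} \<subseteq> {w. chart_inf w \<in> U}"
        by (auto simp: chart_inf_def)
      moreover have "w \<in> {w. w \<noteq> 0 \<and> Some (1 / w) \<in> U} \<union> ball 0 (1 / B)" if "chart_inf w \<in> U" for w
        using that B by (cases "w = 0") (auto simp: chart_inf_def)
      ultimately show ?thesis by blast
    qed
    then show ?thesis using open_Un[OF inv open_ball[of 0 "1 / B"]] by (simp only:)
  qed
  with 1 show "open {z. Some z \<in> U} \<and> open {w. chart_inf w \<in> U}" ..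
next
  assume U: "open {z. Some z \<in> U} \<and> open {w. chart_inf w \<in> U}"
  show "openin P1_top U"
  proof (cases "None \<in> U")
    case False
    then have "U \<subseteq> range Some" by (metis UNIV_I image_eqI not_None_eq subsetI)
    then have eq: "U = Some ` {z. Some z \<in> U}" by auto
    show ?thesis unfolding P1_top_def
      by (subst eq) (use U in simp)
  next
    case True
    define C where "C = - {z. Some z \<in> U}"
    have "closed C" using U by (simp add: C_def closed_Compl)
    have "0 \<in> {w. chart_inf w \<in> U}" using True by (simp add: chart_inf_def)
    then obtain e where e: "e > 0" "ball 0 e \<subseteq> {w. chart_inf w \<in> U}"
      using U openE by blast
    have "norm z \<le> 1 / e" if "z \<in> C" for z
    proof (rule ccontr)
      assume "\<not> norm z \<le> 1 / e"
      then have n: "norm z > 1 / e" "norm z > 0"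
        using e by (auto intro: less_trans[of 0 "1/e"])
      then have "1 / z \<in> ball 0 e" using e by (simp add: norm_divide field_simps)
      then have "chart_inf (1 / z) \<in> U" using e by auto
      then show False using that n by (auto simp: C_def chart_inf_def)
    qed
    then have "bounded C" by (auto simp: bounded_iff)
    with \<open>closed C\<close> have "compact C" by (simp add: compact_eq_bounded_closed)
    moreover have "U = insert None (Some ` (- C))"
    proof -
      have "x \<in> insert None (Some ` (- C))" if "x \<in> U" for x
        using that by (cases x) (auto simp: C_def)
      then show ?thesis using True by (auto simp: C_def)
    qed
    ultimately show ?thesis
      using \<open>closed C\<close> unfolding P1_top_def openin_Alexandroff_compactification
      by (intro disjI2 exI[of _ C]) (auto simp: Compl_eq_Diff_UNIV)
  qed
qed

lemma open_Some_preimage: "openin P1_top U \<Longrightarrow> open {z. Some z \<in> U}"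
  and open_inf_preimage: "openin P1_top U \<Longrightarrow> open {w. chart_inf w \<in> U}"
  by (auto simp: openin_P1_iff)

lemma openin_P1_UNIV [simp]: "openin P1_top UNIV"
  by (simp add: openin_P1_iff)

lemma openin_P1_Compl_finite: "finite F \<Longrightarrow> openin P1_top (- F)"
proof (induction rule: finite_induct)
  case (insert p F)
  have "openin P1_top (- {p})"
  proof (cases p)
    case None
    have "{z. Some z \<in> - {p}} = UNIV" "{w. chart_inf w \<in> - {p}} = - {0}"
      by (auto simp: None chart_inf_def)
    then show ?thesis by (simp add: openin_P1_iff open_Compl)
  next
    case (Some a)
    have "{z. Some z \<in> - {p}} = - {a}" by (auto simp: Some)
    moreover have "{w. chart_inf w \<in> - {p}} = (if a = 0 then UNIV else - {1 / a})"
      by (auto simp: Some chart_inf_def)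
    ultimately show ?thesis by (simp add: openin_P1_iff open_Compl)
  qed
  moreover have "- insert p F = - {p} \<inter> - F" by auto
  ultimately show ?case using insert by (metis openin_Int)
qed simp

lemma openin_P1_Diff_finite: "openin P1_top U \<Longrightarrow> finite F \<Longrightarrow> openin P1_top (U - F)"
  by (metis Diff_eq openin_Int openin_P1_Compl_finite)

lemma openin_P1_Some_image: "openin P1_top (Some ` A) \<longleftrightarrow> open A"
  unfolding P1_top_def by simp

section \<open>Holomorphic functions\<close>

lemma hol_fun_subset: "hol_fun U f \<Longrightarrow> V \<subseteq> U \<Longrightarrow> hol_fun V f"
  unfolding hol_fun_def
  using holomorphic_on_subset[of _ "{z. Some z \<in> U}" "{z. Some z \<in> V}"]
    holomorphic_on_subset[of _ "{z. chart_inf z \<in> U}" "{z. chart_inf z \<in> V}"] by blast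

lemma hol_fun_cong: "(\<And>q. q \<in> U \<Longrightarrow> f q = g q) \<Longrightarrow> hol_fun U f \<longleftrightarrow> hol_fun U g"
  unfolding hol_fun_def by (intro arg_cong2[where f = "(\<and>)"] holomorphic_cong) auto

lemma hol_fun_const [simp]: "hol_fun U (\<lambda>q. c)"
  by (simp add: hol_fun_def)

lemma hol_fun_add: "hol_fun U f \<Longrightarrow> hol_fun U g \<Longrightarrow> hol_fun U (\<lambda>q. f q + g q)"
  and hol_fun_diff: "hol_fun U f \<Longrightarrow> hol_fun U g \<Longrightarrow> hol_fun U (\<lambda>q. f q - g q)"
  and hol_fun_mult: "hol_fun U f \<Longrightarrow> hol_fun U g \<Longrightarrow> hol_fun U (\<lambda>q. f q * g q)"
  and hol_fun_minus: "hol_fun U f \<Longrightarrow> hol_fun U (\<lambda>q. - f q)"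
  and hol_fun_divide: "hol_fun U f \<Longrightarrow> hol_fun U g \<Longrightarrow> (\<And>q. q \<in> U \<Longrightarrow> g q \<noteq> 0) \<Longrightarrow>
    hol_fun U (\<lambda>q. f q / g q)"
  unfolding hol_fun_def by (auto intro!: holomorphic_intros)

lemma hol_fun_sum: "(\<And>i. i \<in> I \<Longrightarrow> hol_fun U (f i)) \<Longrightarrow> hol_fun U (\<lambda>q. \<Sum>i\<in>I. f i q)"
  and hol_fun_prod: "(\<And>i. i \<in> I \<Longrightarrow> hol_fun U (f i)) \<Longrightarrow> hol_fun U (\<lambda>q. \<Prod>i\<in>I. f i q)"
  unfolding hol_fun_def by (auto intro!: holomorphic_intros)

lemmas hol_fun_intros = hol_fun_const hol_fun_add hol_fun_diff hol_fun_mult hol_fun_minus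
  hol_fun_divide hol_fun_sum hol_fun_prod

lemma hol_fun_local:
  assumes "\<And>p. p \<in> U \<Longrightarrow> \<exists>V. openin P1_top V \<and> p \<in> V \<and> hol_fun V f"
  shows "hol_fun U f"
  unfolding hol_fun_def holomorphic_on_def
proof (intro conjI ballI)
  fix z assume "z \<in> {z. Some z \<in> U}"
  then obtain V where V: "openin P1_top V" "Some z \<in> V" "hol_fun V f"
    using assms[of "Some z"] by blast
  have "(\<lambda>z. f (Some z)) field_differentiable at z"
    using V by (intro holomorphic_on_imp_differentiable_at[OF _ open_Some_preimage[OF V(1)]])
      (simp_all add: hol_fun_def)
  then show "(\<lambda>z. f (Some z)) field_differentiable at z within {z. Some z \<in> U}"
    by (rule field_differentiable_at_within)
next
  fix w assume "w \<in> {w. chart_inf w \<in> U}"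
  then obtain V where V: "openin P1_top V" "chart_inf w \<in> V" "hol_fun V f"
    using assms[of "chart_inf w"] by blast
  have "(\<lambda>w. f (chart_inf w)) field_differentiable at w"
    using V by (intro holomorphic_on_imp_differentiable_at[OF _ open_inf_preimage[OF V(1)]])
      (simp_all add: hol_fun_def)
  then show "(\<lambda>w. f (chart_inf w)) field_differentiable at w within {w. chart_inf w \<in> U}"
    by (rule field_differentiable_at_within)
qed

text \<open>
  On a set that misses one of the two points \<open>0\<close>, \<open>\<infinity>\<close> a single chart decides.
\<close>

lemma hol_fun_Some_iff:
  assumes "None \<notin> U"
  shows "hol_fun U f \<longleftrightarrow> (\<lambda>z. f (Some z)) holomorphic_on {z. Some z \<in> U}"
proof
  assume h: "(\<lambda>z. f (Some z)) holomorphic_on {z. Some z \<in> U}"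
  have n: "w \<noteq> 0 \<and> Some (1 / w) \<in> U" if "chart_inf w \<in> U" for w
    using that assms by (cases "w = 0") (simp_all add: chart_inf_def)
  have 1: "(\<lambda>w. 1 / w) holomorphic_on {w. chart_inf w \<in> U}"
    by (intro holomorphic_intros) (use n in blast)
  have 2: "(\<lambda>w. 1 / w) ` {w. chart_inf w \<in> U} \<subseteq> {z. Some z \<in> U}"
    using n by blast
  have "((\<lambda>z. f (Some z)) \<circ> (\<lambda>w. 1 / w)) holomorphic_on {w. chart_inf w \<in> U}"
    by (rule holomorphic_on_compose_gen[OF 1 h 2])
  then have "(\<lambda>w. f (chart_inf w)) holomorphic_on {w. chart_inf w \<in> U}"
  proof (rule holomorphic_transform)
    fix w assume "w \<in> {w. chart_inf w \<in> U}"
    then have "w \<noteq> 0" using n by blast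
    then show "((\<lambda>z. f (Some z)) \<circ> (\<lambda>w. 1 / w)) w = f (chart_inf w)"
      by (simp add: chart_inf_def)
  qed
  with h show "hol_fun U f" by (simp add: hol_fun_def)
qed (simp add: hol_fun_def)

lemma hol_fun_inf_iff:
  assumes "Some 0 \<notin> U"
  shows "hol_fun U f \<longleftrightarrow> (\<lambda>w. f (chart_inf w)) holomorphic_on {w. chart_inf w \<in> U}"
proof
  assume h: "(\<lambda>w. f (chart_inf w)) holomorphic_on {w. chart_inf w \<in> U}"
  have n: "z \<noteq> 0 \<and> chart_inf (1 / z) = Some z" if "Some z \<in> U" for z
    using that assms by (auto simp: chart_inf_def)
  have 1: "(\<lambda>z. 1 / z) holomorphic_on {z. Some z \<in> U}"
    by (intro holomorphic_intros) (use n in blast)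
  have 2: "(\<lambda>z. 1 / z) ` {z. Some z \<in> U} \<subseteq> {w. chart_inf w \<in> U}"
    using n by (simp add: image_subset_iff)
  have "((\<lambda>w. f (chart_inf w)) \<circ> (\<lambda>z. 1 / z)) holomorphic_on {z. Some z \<in> U}"
    by (rule holomorphic_on_compose_gen[OF 1 h 2])
  then have "(\<lambda>z. f (Some z)) holomorphic_on {z. Some z \<in> U}"
    by (rule holomorphic_transform) (simp add: n)
  with h show "hol_fun U f" by (simp add: hol_fun_def)
qed (simp add: hol_fun_def)

lemma hol_fun_nonzero_open:
  assumes "openin P1_top U" "hol_fun U f"
  shows "openin P1_top {q \<in> U. f q \<noteq> 0}"
proof -
  have *: "open {x. x \<in> S \<and> g x \<noteq> 0}" if "open S" "g holomorphic_on S" for S and g :: "complex \<Rightarrow> complex"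
  proof -
    have "open (S \<inter> g -` (- {0}))"
      using that by (intro continuous_open_preimage holomorphic_on_imp_continuous_on) auto
    moreover have "S \<inter> g -` (- {0}) = {x. x \<in> S \<and> g x \<noteq> 0}" by auto
    ultimately show ?thesis by simp
  qed
  show ?thesis
    unfolding openin_P1_iff
    using *[OF open_Some_preimage[OF assms(1)], of "\<lambda>z. f (Some z)"]
      *[OF open_inf_preimage[OF assms(1)], of "\<lambda>z. f (chart_inf z)"] assms(2)
    unfolding hol_fun_def mem_Collect_eq by blast
qed

lemma hol_fun_det:
  fixes N :: "P1 \<Rightarrow> complex^'n^'n"
  assumes "\<And>i j. hol_fun U (\<lambda>q. N q $ i $ j)"
  shows "hol_fun U (\<lambda>q. det (N q))"
  unfolding det_def by (intro hol_fun_intros assms)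

text \<open>
  A coordinate centred at \<open>p\<close>, so that local arguments at finite points and at infinity can be given
  once.  For it, \<open>log_factor p z \<partial>/\<partial>z\<close> is the Euler operator \<open>\<zeta> \<partial>/\<partial>\<zeta>\<close> (see \<open>chart_deriv\<close> below).
\<close>

definition chart :: "P1 \<Rightarrow> complex \<Rightarrow> P1" where
  "chart p \<zeta> = (case p of Some a \<Rightarrow> Some (a + \<zeta>) | None \<Rightarrow> chart_inf \<zeta>)"

lemma chart_0 [simp]: "chart p 0 = p"
  by (cases p) (auto simp: chart_def chart_inf_def)

lemma hol_fun_chart:
  assumes "hol_fun U f"
  shows "(\<lambda>\<zeta>. f (chart p \<zeta>)) holomorphic_on {\<zeta>. chart p \<zeta> \<in> U}"
proof (cases p)
  case (Some a)
  have "((\<lambda>z. f (Some z)) \<circ> (\<lambda>\<zeta>. a + \<zeta>)) holomorphic_on {\<zeta>. Some (a + \<zeta>) \<in> U}"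
    using assms unfolding hol_fun_def
    by (intro holomorphic_on_compose_gen[where g = "\<lambda>z. f (Some z)" and t = "{z. Some z \<in> U}"])
      (auto intro!: holomorphic_intros)
  then show ?thesis by (simp add: chart_def Some o_def)
qed (use assms in \<open>simp add: chart_def hol_fun_def\<close>)

lemma chart_in_open:
  assumes "openin P1_top U" "p \<in> U"
  obtains r where "r > 0" "chart p ` ball 0 r \<subseteq> U"
proof (cases p)
  case None
  have "0 \<in> {w. chart_inf w \<in> U}" using assms None by (simp add: chart_inf_def)
  then obtain r where "r > 0" "ball 0 r \<subseteq> {w. chart_inf w \<in> U}"
    using open_inf_preimage[OF assms(1)] openE by blast
  then show ?thesis using that[of r] by (auto simp: chart_def None)
next
  case (Some a)
  obtain r where "r > 0" "ball a r \<subseteq> {z. Some z \<in> U}"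
    using open_Some_preimage[OF assms(1)] openE assms(2) Some by blast
  then have "chart p ` ball 0 r \<subseteq> U" by (auto simp: chart_def Some dist_norm subset_iff)
  then show ?thesis using that \<open>r > 0\<close> by blast
qed

lemma Some_in_chart_inf_ball:
  assumes "r > 0"
  shows "Some z \<in> chart None ` ball 0 (1 / r) \<longleftrightarrow> r < norm z"
proof
  assume z: "r < norm z"
  then have z0: "z \<noteq> 0" using assms by auto
  have "1 / norm z < 1 / r" using z z0 assms by (intro divide_strict_left_mono) simp_all
  then have "norm (1 / z) < 1 / r" by (simp add: norm_divide)
  then show "Some z \<in> chart None ` ball 0 (1 / r)"
    using z0 by (intro image_eqI[of _ _ "1 / z"]) (simp_all add: chart_def chart_inf_def)
next
  assume "Some z \<in> chart None ` ball 0 (1 / r)"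
  then obtain w where w: "norm w < 1 / r" "w \<noteq> 0" "z = 1 / w"
    by (auto simp: chart_def chart_inf_def split: if_splits)
  then have "norm w * r < 1" using assms by (simp add: pos_less_divide_eq)
  then show "r < norm z" using w by (simp add: norm_divide pos_less_divide_eq mult.commute)
qed

lemma openin_chart_ball:
  assumes "r > 0"
  shows "openin P1_top (chart p ` ball 0 r)"
proof (cases p)
  case (Some a)
  have "chart p ` ball 0 r = Some ` ((+) a ` ball 0 r)"
    unfolding image_image by (simp add: chart_def Some)
  then show ?thesis using openin_P1_Some_image open_translation[OF open_ball] by metis
next
  case None
  have "{w. chart_inf w \<in> chart p ` ball 0 r} = ball 0 r"
    by (auto simp: chart_def None chart_inf_def split: if_splits)
  moreover have "{z. Some z \<in> chart p ` ball 0 r} = - cball 0 (1 / r)"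
    using Some_in_chart_inf_ball[of "1 / r"] assms by (auto simp: None)
  ultimately show ?thesis by (simp add: openin_P1_iff open_Compl)
qed

section \<open>Frames\<close>

lemma local_frame_subset: "local_frame E U e \<Longrightarrow> V \<subseteq> U \<Longrightarrow> local_frame E V e"
  unfolding local_frame_def by (simp add: subset_iff)

lemma local_frame_section_iff:
  assumes "local_frame E U e" "openin P1_top W" "W \<subseteq> U"
  shows "s \<in> E W \<longleftrightarrow> (\<exists>c. (\<forall>i. hol_fun W (\<lambda>q. c q $ i)) \<and> (\<forall>q\<in>W. s q = e q *v c q))"
proof -
  have "\<forall>W s. openin P1_top W \<and> W \<subseteq> U \<longrightarrow>
      (s \<in> E W \<longleftrightarrow> (\<exists>c. (\<forall>i. hol_fun W (\<lambda>q. c q $ i)) \<and> (\<forall>q\<in>W. s q = e q *v c q)))"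
    using assms(1) unfolding local_frame_def by (rule conjunct2)
  then show ?thesis using assms(2-) by simp
qed

lemma local_frame_coordinates:
  assumes "local_frame E U e" "openin P1_top W" "W \<subseteq> U" "s \<in> E W"
  shows "\<exists>c. (\<forall>i. hol_fun W (\<lambda>q. c q $ i)) \<and> (\<forall>q\<in>W. s q = e q *v c q)"
  using local_frame_section_iff[OF assms(1-3)] assms(4) by (rule iffD1)

lemma local_frame_section:
  assumes "local_frame E U e" "openin P1_top W" "W \<subseteq> U"
    and "\<And>i. hol_fun W (\<lambda>q. c q $ i)" "\<And>q. q \<in> W \<Longrightarrow> s q = e q *v c q"
  shows "s \<in> E W"
  unfolding local_frame_section_iff[OF assms(1-3)] using assms(4,5) by (intro exI[of _ c]) simp

lemma matrix_vector_mult_columns: "(A::complex^'n^'m) *v x = (\<Sum>j\<in>UNIV. x $ j *s column j A)"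
  by (simp add: vec_eq_iff matrix_vector_mult_def column_def mult.commute)

lemma local_frame_column:
  assumes "local_frame E U e" "openin P1_top W" "W \<subseteq> U"
  shows "(\<lambda>q. column j (e q)) \<in> E W"
  unfolding local_frame_section_iff[OF assms]
proof (intro exI[of _ "\<lambda>q. axis j 1"] conjI allI ballI)
  show "hol_fun W (\<lambda>q. axis j 1 $ i)" for i by simp
  show "column j (e q) = e q *v axis j 1" for q
    by (simp add: vec_eq_iff column_def matrix_vector_mult_def axis_def mult_delta_right)
qed

lemma vector_bundle_frame:
  assumes "vector_bundle E" "openin P1_top U" "p \<in> U"
  obtains W e where "openin P1_top W" "p \<in> W" "W \<subseteq> U" "local_frame E W e"
proof -
  have "\<exists>U e. openin P1_top U \<and> p \<in> U \<and> local_frame E U e"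
    using assms(1) by (simp add: vector_bundle_def)
  then obtain V e where V: "openin P1_top V" "p \<in> V" "local_frame E V e"
    by (elim exE conjE)
  have 1: "openin P1_top (U \<inter> V)" using assms(2) V(1) by (rule openin_Int)
  have 2: "local_frame E (U \<inter> V) e" using V(3) by (rule local_frame_subset) simp
  have 3: "p \<in> U \<inter> V" using assms(3) V(2) by simp
  show thesis by (rule that[OF 1 3 Int_lower1 2])
qed

lemma section_cong:
  assumes "vector_bundle E" "openin P1_top U" "s \<in> E U" "\<And>q. q \<in> U \<Longrightarrow> s' q = s q"
  shows "s' \<in> E U"
  using assms(1)[unfolded vector_bundle_def is_sheaf_def, THEN conjunct1, THEN conjunct1]
    assms(2-) by blast

lemma section_restrict:
  assumes "vector_bundle E" "openin P1_top U" "openin P1_top V" "V \<subseteq> U" "s \<in> E U"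
  shows "s \<in> E V"
  using assms(1)[unfolded vector_bundle_def is_sheaf_def, THEN conjunct1, THEN conjunct2, THEN conjunct1]
    assms(2-) by blast

lemma section_local:
  assumes "vector_bundle E" "openin P1_top U"
    and "\<And>p. p \<in> U \<Longrightarrow> \<exists>V. openin P1_top V \<and> p \<in> V \<and> V \<subseteq> U \<and> s \<in> E V"
  shows "s \<in> E U"
  using assms(1)[unfolded vector_bundle_def is_sheaf_def, THEN conjunct1, THEN conjunct2, THEN conjunct2]
    assms(2-) by blast

lemma section_Union:
  assumes E: "vector_bundle E" and "openin P1_top U" "openin P1_top V" "s \<in> E U" "s \<in> E V"
  shows "s \<in> E (U \<union> V)"
proof (rule section_local[OF E])
  show "openin P1_top (U \<union> V)" using assms by blast
  show "\<exists>W. openin P1_top W \<and> p \<in> W \<and> W \<subseteq> U \<union> V \<and> s \<in> E W" if "p \<in> U \<union> V" for p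
    using that assms(2-) by (meson Un_iff Un_upper1 Un_upper2)
qed

lemma section_combination:
  assumes E: "vector_bundle E" and U: "openin P1_top U" and st: "s \<in> E U" "t \<in> E U"
    and fg: "hol_fun U f" "hol_fun U g"
  shows "(\<lambda>q. f q *s s q + g q *s t q) \<in> E U"
proof (rule section_local[OF E U])
  fix p assume "p \<in> U"
  then obtain W e where W: "openin P1_top W" "p \<in> W" "W \<subseteq> U" "local_frame E W e"
    using vector_bundle_frame[OF E U] by blast
  obtain c where c: "\<And>i. hol_fun W (\<lambda>q. c q $ i)" "\<And>q. q \<in> W \<Longrightarrow> s q = e q *v c q"
    using local_frame_coordinates[OF W(4,1) order_refl section_restrict[OF E U W(1,3) st(1)]] by blast
  obtain d where d: "\<And>i. hol_fun W (\<lambda>q. d q $ i)" "\<And>q. q \<in> W \<Longrightarrow> t q = e q *v d q"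
    using local_frame_coordinates[OF W(4,1) order_refl section_restrict[OF E U W(1,3) st(2)]] by blast
  have "(\<lambda>q. f q *s s q + g q *s t q) \<in> E W"
  proof (rule local_frame_section[OF W(4,1) order_refl])
    show "hol_fun W (\<lambda>q. (f q *s c q + g q *s d q) $ i)" for i
      using hol_fun_subset[OF fg(1) W(3)] hol_fun_subset[OF fg(2) W(3)] c(1) d(1)
      by (simp add: hol_fun_add hol_fun_mult)
    show "f q *s s q + g q *s t q = e q *v (f q *s c q + g q *s d q)" if "q \<in> W" for q
      using that by (simp add: c d matrix_vector_right_distrib vector_scalar_commute)
  qed
  then show "\<exists>V. openin P1_top V \<and> p \<in> V \<and> V \<subseteq> U \<and> (\<lambda>q. f q *s s q + g q *s t q) \<in> E V"
    using W by blast
qed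

lemma section_zero:
  assumes E: "vector_bundle E" and U: "openin P1_top U"
  shows "(\<lambda>q. 0) \<in> E U"
proof (rule section_local[OF E U])
  fix p assume "p \<in> U"
  then obtain W e where W: "openin P1_top W" "p \<in> W" "W \<subseteq> U" "local_frame E W e"
    using vector_bundle_frame[OF E U] by blast
  have "(\<lambda>q. 0) \<in> E W"
    by (rule local_frame_section[OF W(4,1) order_refl, of "\<lambda>q. 0"]) simp_all
  then show "\<exists>V. openin P1_top V \<and> p \<in> V \<and> V \<subseteq> U \<and> (\<lambda>q. 0) \<in> E V" using W by blast
qed

lemma section_scale:
  assumes "vector_bundle E" "openin P1_top U" "s \<in> E U" "hol_fun U f"
  shows "(\<lambda>q. f q *s s q) \<in> E U"
  using section_combination[OF assms(1,2,3,3,4) hol_fun_const[of _ 0]] by simp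

lemma section_sum:
  assumes E: "vector_bundle E" and U: "openin P1_top U"
    and "finite I" "\<And>i. i \<in> I \<Longrightarrow> s i \<in> E U" "\<And>i. i \<in> I \<Longrightarrow> hol_fun U (f i)"
  shows "(\<lambda>q. \<Sum>i\<in>I. f i q *s s i q) \<in> E U"
  using assms(3-)
proof (induction rule: finite_induct)
  case empty
  then show ?case using section_zero[OF E U] by simp
next
  case (insert i I)
  then have "(\<lambda>q. f i q *s s i q + 1 *s (\<Sum>i\<in>I. f i q *s s i q)) \<in> E U"
    by (intro section_combination[OF E U]) auto
  then show ?case using insert by simp
qed

lemma matrix_inv_inverse:
  assumes "invertible (A::complex^'n^'m)"
  shows "A ** matrix_inv A = mat 1" "matrix_inv A ** A = mat 1"
proof -
  have "A ** matrix_inv A = mat 1 \<and> matrix_inv A ** A = mat 1"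
    using assms unfolding invertible_def matrix_inv_def by (rule someI_ex)
  then show "A ** matrix_inv A = mat 1" "matrix_inv A ** A = mat 1" by auto
qed

lemma invertible_solve:
  assumes "invertible (A::complex^'n^'m)"
  shows "A *v (matrix_inv A *v x) = x" "matrix_inv A *v (A *v y) = y"
  using matrix_inv_inverse[OF assms] by (simp_all add: matrix_vector_mul_assoc)

text \<open>
  Sections that are a basis of every fibre are already a frame: by Cramer's rule the coordinates of a
  holomorphic section with respect to them are quotients of holomorphic determinants.
\<close>

lemma local_frame_of_sections:
  fixes E :: "'n::finite presheaf"
  assumes E: "vector_bundle E" and U: "openin P1_top U"
    and sec: "\<And>j. (\<lambda>q. column j (m q)) \<in> E U" and inv: "\<And>q. q \<in> U \<Longrightarrow> invertible (m q)"
  shows "local_frame E U m"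
  unfolding local_frame_def
proof (intro conjI ballI allI impI)
  fix W s assume W': "openin P1_top W \<and> W \<subseteq> U"
  then have W: "openin P1_top W" "W \<subseteq> U" by auto
  show "s \<in> E W \<longleftrightarrow> (\<exists>c. (\<forall>i. hol_fun W (\<lambda>q. c q $ i)) \<and> (\<forall>q\<in>W. s q = m q *v c q))"
  proof
    assume "\<exists>c. (\<forall>i. hol_fun W (\<lambda>q. c q $ i)) \<and> (\<forall>q\<in>W. s q = m q *v c q)"
    then obtain c where c: "\<And>i. hol_fun W (\<lambda>q. c q $ i)" "\<And>q. q \<in> W \<Longrightarrow> s q = m q *v c q" by blast
    have "(\<lambda>q. \<Sum>j\<in>UNIV. c q $ j *s column j (m q)) \<in> E W"
      using c section_restrict[OF E U W sec] by (intro section_sum[OF E W(1)]) auto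
    then show "s \<in> E W"
      by (rule section_cong[OF E W(1)]) (simp add: c matrix_vector_mult_columns)
  next
    assume s: "s \<in> E W"
    define c where "c = (\<lambda>q. matrix_inv (m q) *v s q)"
    have sc: "s q = m q *v c q" if "q \<in> W" for q
      using that W inv by (simp add: c_def invertible_solve subset_iff)
    have "hol_fun W (\<lambda>q. c q $ k)" for k
    proof (rule hol_fun_local)
      fix p assume "p \<in> W"
      then obtain V e where V: "openin P1_top V" "p \<in> V" "V \<subseteq> W" "local_frame E V e"
        using vector_bundle_frame[OF E W(1)] by blast
      have V': "V \<subseteq> U" using V W by simp
      obtain d where d: "\<And>i. hol_fun V (\<lambda>q. d q $ i)" "\<And>q. q \<in> V \<Longrightarrow> s q = e q *v d q"
        using local_frame_coordinates[OF V(4,1) order_refl section_restrict[OF E W(1) V(1,3) s]] by blast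
      have "\<exists>n. (\<forall>i. hol_fun V (\<lambda>q. n q $ i)) \<and> (\<forall>q\<in>V. column j (m q) = e q *v n q)" for j
        by (rule local_frame_coordinates[OF V(4,1) order_refl section_restrict[OF E U V(1) V' sec[of j]]])
      then obtain n where n: "\<And>j i. hol_fun V (\<lambda>q. n j q $ i)"
        "\<And>j q. q \<in> V \<Longrightarrow> column j (m q) = e q *v n j q" by metis
      define N where "N = (\<lambda>q. \<chi> i j. n j q $ i)"
      have mN: "m q = e q ** N q" if "q \<in> V" for q
        using n(2)[OF that] by (auto simp: vec_eq_iff column_def N_def matrix_vector_mult_def matrix_matrix_mult_def)
      have Nd: "N q *v c q = d q" "det (N q) \<noteq> 0" if "q \<in> V" for q
      proof -
        have q: "invertible (m q)" "invertible (e q)"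
          using that V W inv unfolding local_frame_def by auto
        have "e q *v (N q *v c q) = e q *v d q"
          using sc[of q] d(2)[OF that] mN[OF that] that V by (simp add: matrix_vector_mul_assoc subset_iff)
        then show "N q *v c q = d q" using invertible_solve(2)[OF q(2)] by metis
        show "det (N q) \<noteq> 0"
          using q mN[OF that] by (metis det_mul invertible_det_nz mult_zero_right)
      qed
      have "c q $ k = det (\<chi> i j. if j = k then d q $ i else N q $ i $ j) / det (N q)" if "q \<in> V" for q
        using cramer[OF Nd(2)[OF that], of "c q" "d q"] Nd(1)[OF that] by simp
      moreover have "hol_fun V (\<lambda>q. det (\<chi> i j. if j = k then d q $ i else N q $ i $ j) / det (N q))"
      proof (intro hol_fun_divide hol_fun_det)
        show "hol_fun V (\<lambda>q. (\<chi> i j. if j = k then d q $ i else N q $ i $ j) $ i $ j)" for i j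
          using d n by (cases "j = k") (auto simp: N_def)
      qed (use n Nd in \<open>auto simp: N_def\<close>)
      ultimately have "hol_fun V (\<lambda>q. c q $ k)" by (subst hol_fun_cong) auto
      then show "\<exists>V. openin P1_top V \<and> p \<in> V \<and> hol_fun V (\<lambda>q. c q $ k)" using V by blast
    qed
    with sc show "\<exists>c. (\<forall>i. hol_fun W (\<lambda>q. c q $ i)) \<and> (\<forall>q\<in>W. s q = m q *v c q)" by blast
  qed
qed (use inv in auto)

section \<open>Homomorphisms in frames\<close>

lemma matrix_add_rdistrib: "((A::complex^'n^'m) + B) ** (C::complex^'k^'n) = A ** C + B ** C"
  by (simp add: vec_eq_iff matrix_matrix_mult_def distrib_right sum.distrib)

lemma mat_mult_eq: "mat c ** (N::complex^'n^'m) = (\<chi> i j. c * N $ i $ j)"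
  by (simp add: vec_eq_iff matrix_matrix_mult_def mat_def mult_delta_left)

lemma column_matrix_mult: "column j ((A::complex^'n^'m) ** B) = A *v column j B"
  by (simp add: vec_eq_iff matrix_vector_mult_def matrix_matrix_mult_def column_def)

lemma bundle_hom_in_frames:
  fixes E :: "'n::finite presheaf" and F :: "'m::finite presheaf"
  assumes hom: "bundle_hom E F \<phi>" and U: "openin P1_top U"
    and e: "local_frame E U e" and e': "local_frame F U e'"
  shows "\<exists>M. (\<forall>i j. hol_fun U (\<lambda>q. M q $ i $ j)) \<and> (\<forall>q\<in>U. \<phi> q ** e q = e' q ** M q)"
proof -
  have "\<exists>c. (\<forall>i. hol_fun U (\<lambda>q. c q $ i)) \<and> (\<forall>q\<in>U. \<phi> q *v column j (e q) = e' q *v c q)" for j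
  proof (rule local_frame_coordinates[OF e' U order_refl])
    show "(\<lambda>q. \<phi> q *v column j (e q)) \<in> F U"
      using hom U local_frame_column[OF e U order_refl] unfolding bundle_hom_def by blast
  qed
  then obtain c where c: "\<And>j i. hol_fun U (\<lambda>q. c j q $ i)"
    "\<And>j q. q \<in> U \<Longrightarrow> \<phi> q *v column j (e q) = e' q *v c j q" by metis
  define M where "M = (\<lambda>q. \<chi> i j. c j q $ i)"
  have "\<phi> q ** e q = e' q ** M q" if "q \<in> U" for q
  proof -
    have "(\<phi> q ** e q) $ i $ j = (e' q ** M q) $ i $ j" for i j
      using arg_cong[OF c(2)[OF that, of j], of "\<lambda>v. v $ i"]
      by (simp add: M_def matrix_vector_mult_def matrix_matrix_mult_def column_def)
    then show ?thesis by (simp add: vec_eq_iff)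
  qed
  moreover have "hol_fun U (\<lambda>q. M q $ i $ j)" for i j
    using c(1) by (simp add: M_def)
  ultimately show ?thesis by blast
qed

section \<open>Logarithmic connections\<close>

lemma finite_punctures [simp]: "finite punctures"
  by (simp add: punctures_def)

lemma log_connection_bundle: "log_connection E D \<Longrightarrow> vector_bundle E"
  unfolding log_connection_def by (elim conjE)

lemma log_connection_forms:
  assumes "log_connection E D" "openin P1_top U" "s \<in> E U"
  shows "D U s \<in> log_forms E U"
  using assms(1)[unfolded log_connection_def, THEN conjunct2, THEN conjunct1]
    assms(2,3) by blast

lemma log_connection_section:
  assumes "log_connection E D" "openin P1_top U" "s \<in> E U"
  shows "D U s \<in> E (U - punctures)"
  using log_connection_forms[OF assms] unfolding log_forms_def mem_Collect_eq by (rule conjunct1)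

lemma log_connection_extends:
  assumes "log_connection E D" "openin P1_top U" "s \<in> E U" "p \<in> U" "p \<in> punctures"
  shows "\<exists>u. log_extends E U (D U s) p u"
proof -
  have "\<forall>p\<in>U \<inter> punctures. \<exists>u. log_extends E U (D U s) p u"
    using log_connection_forms[OF assms(1-3)] unfolding log_forms_def mem_Collect_eq by (rule conjunct2)
  then show ?thesis using assms(4,5) by blast
qed

lemma log_connection_restrict:
  assumes "log_connection E D" "openin P1_top U" "openin P1_top V" "V \<subseteq> U" "s \<in> E U"
    "\<And>q. q \<in> V \<Longrightarrow> s' q = s q" "q \<in> V" "q \<notin> punctures"
  shows "D V s' q = D U s q"
  using assms(1)[unfolded log_connection_def, THEN conjunct2, THEN conjunct2, THEN conjunct1]
    assms(2-) by blast

lemma log_connection_linear: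
  assumes "log_connection E D" "openin P1_top U" "s \<in> E U" "s' \<in> E U" "q \<in> U" "q \<notin> punctures"
  shows "D U (\<lambda>x. a *s s x + b *s s' x) q = a *s D U s q + b *s D U s' q"
  using assms(1)[unfolded log_connection_def, THEN conjunct2, THEN conjunct2, THEN conjunct2, THEN conjunct1]
    assms(2-) by blast

lemma log_connection_Leibniz:
  assumes "log_connection E D" "openin P1_top U" "s \<in> E U" "hol_fun U f" "Some z \<in> U" "Some z \<notin> punctures"
  shows "D U (\<lambda>x. f x *s s x) (Some z) =
             deriv (\<lambda>x. f (Some x)) z *s s (Some z) + f (Some z) *s D U s (Some z)"
  using assms(1)[unfolded log_connection_def, THEN conjunct2, THEN conjunct2, THEN conjunct2, THEN conjunct2]
    assms(2-) by blast

lemma log_connection_sum: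
  assumes D: "log_connection E D" and U: "openin P1_top U" and z: "Some z \<in> U" "Some z \<notin> punctures"
    and "finite I" "\<And>i. i \<in> I \<Longrightarrow> s i \<in> E U" "\<And>i. i \<in> I \<Longrightarrow> hol_fun U (f i)"
  shows "D U (\<lambda>x. \<Sum>i\<in>I. f i x *s s i x) (Some z) =
    (\<Sum>i\<in>I. deriv (\<lambda>x. f i (Some x)) z *s s i (Some z) + f i (Some z) *s D U (s i) (Some z))"
  using assms(5-)
proof (induction rule: finite_induct)
  case empty
  have "D U (\<lambda>x. 0 *s (0::complex^'a) + 0 *s (0::complex^'a)) (Some z)
      = 0 *s D U (\<lambda>x. 0) (Some z) + 0 *s D U (\<lambda>x. 0) (Some z)"
    by (rule log_connection_linear[OF D U _ _ z]) (rule section_zero[OF log_connection_bundle[OF D] U])+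
  then show ?case by simp
next
  case (insert i I)
  note E = log_connection_bundle[OF D]
  have 1: "(\<lambda>x. f i x *s s i x) \<in> E U"
    using insert.prems by (intro section_scale[OF E U]) auto
  have 2: "(\<lambda>x. \<Sum>i\<in>I. f i x *s s i x) \<in> E U"
    using insert.prems insert.hyps by (intro section_sum[OF E U]) auto
  have "D U (\<lambda>x. 1 *s (f i x *s s i x) + 1 *s (\<Sum>i\<in>I. f i x *s s i x)) (Some z) =
      1 *s D U (\<lambda>x. f i x *s s i x) (Some z) + 1 *s D U (\<lambda>x. \<Sum>i\<in>I. f i x *s s i x) (Some z)"
    by (rule log_connection_linear[OF D U 1 2 z])
  also have "D U (\<lambda>x. f i x *s s i x) (Some z) =
      deriv (\<lambda>x. f i (Some x)) z *s s i (Some z) + f i (Some z) *s D U (s i) (Some z)"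
    using insert.prems by (intro log_connection_Leibniz[OF D U _ _ z]) auto
  also have "D U (\<lambda>x. \<Sum>i\<in>I. f i x *s s i x) (Some z) =
    (\<Sum>i\<in>I. deriv (\<lambda>x. f i (Some x)) z *s s i (Some z) + f i (Some z) *s D U (s i) (Some z))"
    using insert.prems by (intro insert.IH) auto
  finally show ?case using insert.hyps by simp
qed

text \<open>
  \<open>R\<close> is the value at \<open>p\<close> of the operator \<open>\<nabla>\<close> along \<open>x \<partial>/\<partial>x\<close>, where \<open>x\<close> is a coordinate at \<open>p\<close>.
  At a puncture this is the residue, elsewhere it is zero; so punctures and ordinary points can be
  treated alike.
\<close>

definition log_derivative_at ::
  "'n::finite presheaf \<Rightarrow> 'n conn \<Rightarrow> P1 \<Rightarrow> complex^'n^'n \<Rightarrow> bool" where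
  "log_derivative_at E D p R \<longleftrightarrow>
     (\<forall>U s. openin P1_top U \<and> p \<in> U \<and> U \<inter> punctures \<subseteq> {p} \<and> s \<in> E U \<longrightarrow>
       (\<exists>u\<in>E U. u p = R *v s p \<and>
          (\<forall>z. Some z \<in> U - punctures \<longrightarrow> u (Some z) = log_factor p z *s D U s (Some z))))"

definition principal_spectrum :: "complex^'n::finite^'n \<Rightarrow> bool" where
  "principal_spectrum A \<longleftrightarrow> (\<forall>c v. v \<noteq> 0 \<and> A *v v = c *s v \<longrightarrow> 0 \<le> Re c \<and> Re c < 1)"

lemma principal_spectrum_conj:
  fixes L P :: "complex^'n::finite^'n"
  assumes "principal_spectrum L" "invertible P"
  shows "principal_spectrum (P ** L ** matrix_inv P)"
  unfolding principal_spectrum_def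
proof (intro allI impI)
  fix c and v :: "complex^'n" assume v: "v \<noteq> 0 \<and> (P ** L ** matrix_inv P) *v v = c *s v"
  define w where "w = matrix_inv P *v v"
  have vw: "v = P *v w" using invertible_solve(1)[OF assms(2)] by (simp add: w_def)
  then have w0: "w \<noteq> 0" using v by auto
  have "P *v (L *v w) = c *s v" using v by (simp add: w_def matrix_vector_mul_assoc matrix_mul_assoc)
  also have "\<dots> = P *v (c *s w)" by (simp add: vw vector_scalar_commute)
  finally have "L *v w = c *s w" using invertible_solve(2)[OF assms(2)] by metis
  then show "0 \<le> Re c \<and> Re c < 1" using assms(1) w0 unfolding principal_spectrum_def by blast
qed

lemma log_derivative_at_puncture:
  assumes D: "log_connection E D" and p: "p \<in> punctures" and R: "residue_at E D p R"
  shows "log_derivative_at E D p R"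
  unfolding log_derivative_at_def
proof (intro allI impI, elim conjE)
  fix U s assume U: "openin P1_top U" "p \<in> U" "U \<inter> punctures \<subseteq> {p}" and s: "s \<in> E U"
  obtain u where u: "log_extends E U (D U s) p u"
    using log_connection_extends[OF D U(1) s U(2) p] by blast
  have "insert p (U - punctures) = U" using U by blast
  then have "u \<in> E U" using u unfolding log_extends_def by simp
  moreover have "u p = R *v s p"
    using R U s u unfolding residue_at_def by blast
  moreover have "\<forall>z. Some z \<in> U - punctures \<longrightarrow> u (Some z) = log_factor p z *s D U s (Some z)"
    using u unfolding log_extends_def by (rule conjunct2)
  ultimately show "\<exists>u\<in>E U. u p = R *v s p \<and>
      (\<forall>z. Some z \<in> U - punctures \<longrightarrow> u (Some z) = log_factor p z *s D U s (Some z))" by blast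
qed

lemma log_derivative_at_ordinary:
  assumes D: "log_connection E D" and p: "p \<notin> punctures"
  shows "log_derivative_at E D p 0"
  unfolding log_derivative_at_def
proof (intro allI impI, elim conjE)
  fix U s assume U: "openin P1_top U" "p \<in> U" "U \<inter> punctures \<subseteq> {p}" and s: "s \<in> E U"
  obtain a where a: "p = Some a" using p by (cases p) (auto simp: punctures_def)
  have U': "U - punctures = U" using U p by blast
  have N: "None \<notin> U" using U a by (auto simp: punctures_def)
  define h where "h = (\<lambda>q. case q of Some z \<Rightarrow> z - a | None \<Rightarrow> 0)"
  have "hol_fun U h"
    unfolding hol_fun_Some_iff[OF N] by (auto simp: h_def intro!: holomorphic_intros)
  moreover have "D U s \<in> E U" using log_connection_section[OF D U(1) s] U' by simp
  ultimately have "(\<lambda>q. h q *s D U s q) \<in> E U"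
    using section_scale[OF log_connection_bundle[OF D] U(1)] by blast
  then show "\<exists>u\<in>E U. u p = 0 *v s p \<and>
      (\<forall>z. Some z \<in> U - punctures \<longrightarrow> u (Some z) = log_factor p z *s D U s (Some z))"
    by (rule bexI[rotated]) (simp add: h_def a log_factor_def)
qed

lemma log_extension_log_derivative:
  assumes "log_extension \<rho> E D \<Phi>"
  shows "\<exists>R. log_derivative_at E D p R \<and> principal_spectrum R"
proof (cases "p \<in> punctures")
  case True
  have "\<forall>p\<in>punctures. \<exists>L P. principal_log (local_monodromy \<rho> p) L \<and> invertible P \<and>
        residue_at E D p (P ** L ** matrix_inv P)"
    and D: "log_connection E D"
    using assms unfolding log_extension_def by auto
  then obtain L P where L: "principal_log (local_monodromy \<rho> p) L" "invertible P"
    "residue_at E D p (P ** L ** matrix_inv P)" using True by blast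
  have "principal_spectrum L" using L(1) unfolding principal_log_def principal_spectrum_def by blast
  then show ?thesis
    using log_derivative_at_puncture[OF D True L(3)] principal_spectrum_conj[OF _ L(2)] by blast
next
  case False
  have "principal_spectrum 0"
    unfolding principal_spectrum_def by auto
  then show ?thesis
    using log_derivative_at_ordinary[OF _ False] assms unfolding log_extension_def by blast
qed

section \<open>Rigidity\<close>

lemma chart_deriv:
  assumes W: "openin P1_top W" and G: "hol_fun W G" and z: "chart p \<zeta> = Some z" "Some z \<in> W" "\<zeta> \<noteq> 0"
  shows "log_factor p z * deriv (\<lambda>x. G (Some x)) z = \<zeta> * deriv (\<lambda>\<zeta>. G (chart p \<zeta>)) \<zeta>"
proof -
  have G': "((\<lambda>x. G (Some x)) has_field_derivative deriv (\<lambda>x. G (Some x)) z) (at z)"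
    using G z W unfolding hol_fun_def
    by (intro holomorphic_derivI[OF _ open_Some_preimage[OF W]]) auto
  show ?thesis
  proof (cases p)
    case (Some a)
    then have za: "z = a + \<zeta>" using z by (simp add: chart_def)
    have "((\<lambda>\<zeta>. G (Some (a + \<zeta>))) has_field_derivative deriv (\<lambda>x. G (Some x)) z * 1) (at \<zeta>)"
      by (rule DERIV_chain2[where f = "\<lambda>x. G (Some x)"]) (use G' za in \<open>auto intro!: derivative_eq_intros\<close>)
    then have "deriv (\<lambda>\<zeta>. G (Some (a + \<zeta>))) \<zeta> = deriv (\<lambda>x. G (Some x)) z"
      by (simp add: DERIV_imp_deriv)
    then show ?thesis by (simp add: chart_def Some log_factor_def za)
  next
    case None
    then have za: "z = 1 / \<zeta>" using z by (simp add: chart_def chart_inf_def)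
    have "((\<lambda>\<zeta>. G (Some (1 / \<zeta>))) has_field_derivative deriv (\<lambda>x. G (Some x)) z * (- 1 / \<zeta> ^ 2)) (at \<zeta>)"
      by (rule DERIV_chain2[where f = "\<lambda>x. G (Some x)"])
        (use G' za z in \<open>auto intro!: derivative_eq_intros simp: power2_eq_square\<close>)
    then have "((\<lambda>\<zeta>. G (chart p \<zeta>)) has_field_derivative deriv (\<lambda>x. G (Some x)) z * (- 1 / \<zeta> ^ 2)) (at \<zeta>)"
      by (rule has_field_derivative_transform_within_open[where S = "- {0}"])
        (use z None in \<open>auto simp: chart_def chart_inf_def\<close>)
    then have "deriv (\<lambda>\<zeta>. G (chart p \<zeta>)) \<zeta> = deriv (\<lambda>x. G (Some x)) z * (- 1 / \<zeta> ^ 2)"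
      by (rule DERIV_imp_deriv)
    then show ?thesis using z by (simp add: None log_factor_def za power2_eq_square)
  qed
qed

lemma higher_deriv_mult_first:
  assumes "f holomorphic_on ball 0 r" "g holomorphic_on ball 0 r" "r > 0"
    and "\<And>k. k < n \<Longrightarrow> (deriv ^^ k) g 0 = 0"
  shows "(deriv ^^ n) (\<lambda>w. f w * g w) 0 = f 0 * (deriv ^^ n) g 0"
proof -
  have "(deriv ^^ n) (\<lambda>w. f w * g w) 0 =
      (\<Sum>i = 0..n. of_nat (n choose i) * (deriv ^^ i) f 0 * (deriv ^^ (n - i)) g 0)"
    by (rule higher_deriv_mult[OF assms(1,2)]) (use assms in auto)
  also have "\<dots> = (\<Sum>i = 0..n. if i = 0 then f 0 * (deriv ^^ n) g 0 else 0)"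
    by (rule sum.cong) (use assms(4) in auto)
  finally show ?thesis by simp
qed

lemma higher_deriv_Euler:
  assumes "g holomorphic_on ball 0 r" "r > 0"
  shows "(deriv ^^ n) (\<lambda>w. w * deriv g w) 0 = of_nat n * (deriv ^^ n) g 0"
proof -
  have "(deriv ^^ n) (\<lambda>w. w * deriv g w) 0 =
      (\<Sum>i = 0..n. of_nat (n choose i) * (deriv ^^ i) (\<lambda>w. w) 0 * (deriv ^^ (n - i)) (deriv g) 0)"
    by (rule higher_deriv_mult[of _ "ball 0 r"])
      (use assms in \<open>auto intro!: holomorphic_intros holomorphic_deriv\<close>)
  also have "\<dots> = (\<Sum>i = 0..n. if i = 1 then of_nat n * (deriv ^^ n) g 0 else 0)"
  proof (rule sum.cong)
    fix i assume i: "i \<in> {0..n}"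
    show "of_nat (n choose i) * (deriv ^^ i) (\<lambda>w. w) 0 * (deriv ^^ (n - i)) (deriv g) 0 =
        (if i = 1 then of_nat n * (deriv ^^ n) g 0 else 0)"
    proof (cases "i = 1")
      case True
      then obtain k where "n = Suc k" using i by (cases n) auto
      then show ?thesis using True by (simp add: higher_deriv_ident funpow_Suc_right del: funpow.simps)
    qed (simp add: higher_deriv_ident)
  qed simp
  also have "\<dots> = of_nat n * (deriv ^^ n) g 0" by (cases n) simp_all
  finally show ?thesis .
qed

text \<open>
  The matrix equation determines the Taylor coefficients of \<open>M\<close> one after the other: if all those
  below \<open>n\<close> vanish, the \<open>n\<close>-th one satisfies the homogeneous equation of \<open>nonres\<close>.
\<close>

lemma nonresonant_solution_zero:
  fixes M :: "complex \<Rightarrow> complex^'n::finite^'m::finite"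
  assumes r: "r > 0"
    and hol: "\<And>i j. (\<lambda>\<zeta>. M \<zeta> $ i $ j) holomorphic_on ball 0 r"
      "\<And>i j. (\<lambda>\<zeta>. A \<zeta> $ i $ j) holomorphic_on ball 0 r"
      "\<And>i j. (\<lambda>\<zeta>. A' \<zeta> $ i $ j) holomorphic_on ball 0 r"
    and eq: "\<And>\<zeta> i j. \<zeta> \<in> ball 0 r \<Longrightarrow>
      \<zeta> * deriv (\<lambda>\<zeta>. M \<zeta> $ i $ j) \<zeta> + (A' \<zeta> ** M \<zeta>) $ i $ j = (M \<zeta> ** A \<zeta>) $ i $ j"
    and nonres: "\<And>n N. n \<ge> 1 \<Longrightarrow> mat (of_nat n) ** N + A' 0 ** N = N ** A 0 \<Longrightarrow> N = 0"
    and M0: "M 0 = 0" and \<zeta>: "\<zeta> \<in> ball 0 r"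
  shows "M \<zeta> = 0"
proof -
  have der: "(deriv ^^ n) (\<lambda>\<zeta>. M \<zeta> $ i $ j) 0 = 0" for n i j
  proof (induction n arbitrary: i j rule: less_induct)
    case (less n)
    show ?case
    proof (cases "n = 0")
      case False
      define N where "N = (\<chi> i j. (deriv ^^ n) (\<lambda>\<zeta>. M \<zeta> $ i $ j) 0)"
      have "(mat (of_nat n) ** N + A' 0 ** N) $ i $ j = (N ** A 0) $ i $ j" for i j
      proof -
        have holsum: "(\<lambda>\<zeta>. \<Sum>k\<in>UNIV. A' \<zeta> $ i $ k * M \<zeta> $ k $ j) holomorphic_on ball 0 r"
          by (intro holomorphic_intros hol)
        have holE: "(\<lambda>\<zeta>. \<zeta> * deriv (\<lambda>\<zeta>. M \<zeta> $ i $ j) \<zeta>) holomorphic_on ball 0 r"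
          by (intro holomorphic_intros holomorphic_deriv hol open_ball)
        have sumd: "(deriv ^^ n) (\<lambda>\<zeta>. \<Sum>k\<in>UNIV. f k \<zeta>) 0 = (\<Sum>k\<in>UNIV. (deriv ^^ n) (f k) 0)"
          if "\<And>k. f k holomorphic_on ball 0 r" for f :: "'a::finite \<Rightarrow> complex \<Rightarrow> complex"
        proof -
          have "(deriv ^^ n) (\<lambda>\<zeta>. \<Sum>k\<in>K. f k \<zeta>) 0 = (\<Sum>k\<in>K. (deriv ^^ n) (f k) 0)" if "finite K" for K
            using that
          proof (induction rule: finite_induct)
            case (insert k K)
            have "(deriv ^^ n) (\<lambda>\<zeta>. f k \<zeta> + (\<Sum>k\<in>K. f k \<zeta>)) 0 =
              (deriv ^^ n) (f k) 0 + (deriv ^^ n) (\<lambda>\<zeta>. \<Sum>k\<in>K. f k \<zeta>) 0"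
              by (rule higher_deriv_add[of _ "ball 0 r"])
                (use \<open>\<And>k. f k holomorphic_on ball 0 r\<close> r in \<open>auto intro!: holomorphic_intros\<close>)
            then show ?case using insert by simp
          qed (simp add: higher_deriv_const)
          then show ?thesis by simp
        qed
        have "(deriv ^^ n) (\<lambda>\<zeta>. \<zeta> * deriv (\<lambda>\<zeta>. M \<zeta> $ i $ j) \<zeta> + (\<Sum>k\<in>UNIV. A' \<zeta> $ i $ k * M \<zeta> $ k $ j)) 0
          = (deriv ^^ n) (\<lambda>\<zeta>. \<Sum>k\<in>UNIV. A \<zeta> $ k $ j * M \<zeta> $ i $ k) 0"
          by (rule higher_deriv_transform_within_open[of _ "ball 0 r"])
            (use eq r in \<open>auto intro!: holomorphic_intros holE holsum hol
              simp: matrix_matrix_mult_def mult.commute\<close>)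
        also have "(deriv ^^ n) (\<lambda>\<zeta>. \<zeta> * deriv (\<lambda>\<zeta>. M \<zeta> $ i $ j) \<zeta> + (\<Sum>k\<in>UNIV. A' \<zeta> $ i $ k * M \<zeta> $ k $ j)) 0
          = of_nat n * (deriv ^^ n) (\<lambda>\<zeta>. M \<zeta> $ i $ j) 0 + (\<Sum>k\<in>UNIV. A' 0 $ i $ k * (deriv ^^ n) (\<lambda>\<zeta>. M \<zeta> $ k $ j) 0)"
          by (subst higher_deriv_add[OF holE holsum])
            (use r less.IH in \<open>auto simp: higher_deriv_Euler[OF hol(1)] sumd[OF holomorphic_on_mult[OF hol(3) hol(1)]]
              higher_deriv_mult_first[OF hol(3) hol(1)]\<close>)
        also have "(deriv ^^ n) (\<lambda>\<zeta>. \<Sum>k\<in>UNIV. A \<zeta> $ k $ j * M \<zeta> $ i $ k) 0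
          = (\<Sum>k\<in>UNIV. A 0 $ k $ j * (deriv ^^ n) (\<lambda>\<zeta>. M \<zeta> $ i $ k) 0)"
          using r less.IH by (simp add: sumd[OF holomorphic_on_mult[OF hol(2) hol(1)]]
              higher_deriv_mult_first[OF hol(2) hol(1)])
        finally show ?thesis
          by (simp add: N_def matrix_matrix_mult_def mat_def mult_delta_left mult.commute)
      qed
      then have "mat (of_nat n) ** N + A' 0 ** N = N ** A 0" by (simp add: vec_eq_iff)
      then have "N = 0" by (rule nonres[rotated]) (use False in simp)
      then show ?thesis by (simp add: N_def vec_eq_iff)
    qed (use M0 in simp)
  qed
  have "M \<zeta> $ i $ j = 0" for i j
    by (rule holomorphic_fun_eq_0_on_ball[OF hol(1) \<zeta> der])
  then show ?thesis by (simp add: vec_eq_iff)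
qed

text \<open>
  In frames, compatibility of \<open>\<phi>\<close> with the connections is the equation of the preceding lemma.
\<close>

lemma conn_hom_vanishes_near:
  fixes E :: "'n::finite presheaf" and F :: "'m::finite presheaf"
  assumes D: "log_connection E D" and D': "log_connection F D'" and hom: "conn_hom E D F D' \<phi>"
    and R: "log_derivative_at E D p R" and R': "log_derivative_at F D' p R'"
    and nonres: "\<And>n N. n \<ge> 1 \<Longrightarrow> mat (of_nat n) ** N + R' ** N = N ** R \<Longrightarrow> N = 0"
    and \<phi>p: "\<phi> p = 0"
  shows "\<exists>V. openin P1_top V \<and> p \<in> V \<and> (\<forall>q\<in>V. \<phi> q = 0)"
proof -
  note vb = log_connection_bundle[OF D] log_connection_bundle[OF D']
  have "openin P1_top (- (punctures - {p}))" by (intro openin_P1_Compl_finite) auto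
  then obtain W0 e where W0: "openin P1_top W0" "p \<in> W0" "W0 \<subseteq> - (punctures - {p})" "local_frame E W0 e"
    using vector_bundle_frame[OF vb(1), of _ p] by blast
  obtain W e' where W: "openin P1_top W" "p \<in> W" "W \<subseteq> W0" and e': "local_frame F W e'"
    using vector_bundle_frame[OF vb(2) W0(1,2)] by blast
  have e: "local_frame E W e" using W0(4) W(3) by (rule local_frame_subset)
  have Wp: "W \<inter> punctures \<subseteq> {p}" using W0 W by blast
  have inv: "invertible (e q)" "invertible (e' q)" if "q \<in> W" for q
    using e e' that unfolding local_frame_def by auto
  have bh: "bundle_hom E F \<phi>" using hom unfolding conn_hom_def by (rule conjunct1)
  obtain M where M: "\<And>i j. hol_fun W (\<lambda>q. M q $ i $ j)" "\<And>q. q \<in> W \<Longrightarrow> \<phi> q ** e q = e' q ** M q"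
    using bundle_hom_in_frames[OF bh W(1) e e'] by blast
  have frame_matrix: "\<exists>A. (\<forall>i j. hol_fun W (\<lambda>q. A q $ i $ j)) \<and> R0 ** e0 p = e0 p ** A p \<and>
      (\<forall>z j. Some z \<in> W - punctures \<longrightarrow>
        log_factor p z *s D0 W (\<lambda>q. column j (e0 q)) (Some z) = e0 (Some z) *v column j (A (Some z)))"
    if D0: "log_connection G D0" and R0: "log_derivative_at G D0 p R0" and e0: "local_frame G W e0"
    for G :: "'k::finite presheaf" and D0 R0 e0
  proof -
    have col: "(\<lambda>q. column j (e0 q)) \<in> G W" for j
      by (rule local_frame_column[OF e0 W(1) order_refl])
    have "\<exists>u\<in>G W. u p = R0 *v column j (e0 p) \<and> (\<forall>z. Some z \<in> W - punctures \<longrightarrow>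
        u (Some z) = log_factor p z *s D0 W (\<lambda>q. column j (e0 q)) (Some z))" for j
      using R0 W(1,2) Wp col[of j] unfolding log_derivative_at_def by blast
    then obtain u where u: "\<And>j. u j \<in> G W" "\<And>j. u j p = R0 *v column j (e0 p)"
      "\<And>j z. Some z \<in> W - punctures \<Longrightarrow>
        u j (Some z) = log_factor p z *s D0 W (\<lambda>q. column j (e0 q)) (Some z)" by metis
    have "\<exists>a. (\<forall>i. hol_fun W (\<lambda>q. a q $ i)) \<and> (\<forall>q\<in>W. u j q = e0 q *v a q)" for j
      by (rule local_frame_coordinates[OF e0 W(1) order_refl u(1)])
    then obtain a where a: "\<And>j i. hol_fun W (\<lambda>q. a j q $ i)" "\<And>j q. q \<in> W \<Longrightarrow> u j q = e0 q *v a j q"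
      by metis
    define A where "A = (\<lambda>q. \<chi> i j. a j q $ i)"
    have colA: "column j (A q) = a j q" for j q by (simp add: A_def column_def vec_eq_iff)
    have "R0 ** e0 p = e0 p ** A p"
    proof -
      have "R0 *v column j (e0 p) = e0 p *v column j (A p)" for j
        using u(2)[of j] a(2)[OF W(2), of j] by (simp add: colA)
      then have "(R0 ** e0 p) $ i $ j = (e0 p ** A p) $ i $ j" for i j
        by (simp add: vec_eq_iff matrix_vector_mult_def matrix_matrix_mult_def column_def)
      then show ?thesis by (simp add: vec_eq_iff)
    qed
    moreover have "hol_fun W (\<lambda>q. A q $ i $ j)" for i j using a(1) by (simp add: A_def)
    moreover have "log_factor p z *s D0 W (\<lambda>q. column j (e0 q)) (Some z) = e0 (Some z) *v column j (A (Some z))"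
      if "Some z \<in> W - punctures" for z j
      using u(3)[OF that, of j] a(2)[of "Some z" j] that by (simp add: colA)
    ultimately show ?thesis by blast
  qed
  obtain A where A: "\<And>i j. hol_fun W (\<lambda>q. A q $ i $ j)" "R ** e p = e p ** A p"
    "\<And>z j. Some z \<in> W - punctures \<Longrightarrow>
        log_factor p z *s D W (\<lambda>q. column j (e q)) (Some z) = e (Some z) *v column j (A (Some z))"
    using frame_matrix[OF D R e] by blast
  obtain A' where A': "\<And>i j. hol_fun W (\<lambda>q. A' q $ i $ j)" "R' ** e' p = e' p ** A' p"
    "\<And>z j. Some z \<in> W - punctures \<Longrightarrow>
        log_factor p z *s D' W (\<lambda>q. column j (e' q)) (Some z) = e' (Some z) *v column j (A' (Some z))"
    using frame_matrix[OF D' R' e'] by blast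
  have eqn: "log_factor p z * deriv (\<lambda>x. M (Some x) $ i $ j) z + (A' (Some z) ** M (Some z)) $ i $ j
      = (M (Some z) ** A (Some z)) $ i $ j" if z: "Some z \<in> W - punctures" for z i j
  proof -
    let ?q = "Some z" and ?l = "log_factor p z"
    have z': "?q \<in> W" "?q \<notin> punctures" using z by auto
    have colM: "\<phi> q *v column j (e q) = (\<Sum>i\<in>UNIV. M q $ i $ j *s column i (e' q))" if "q \<in> W" for q
    proof -
      have "\<phi> q *v column j (e q) = e' q *v column j (M q)"
        by (simp add: M(2)[OF that] column_matrix_mult[symmetric])
      then show ?thesis by (simp add: matrix_vector_mult_columns[of "e' q"]) (simp add: column_def)
    qed
    have c1: "(\<lambda>q. column j (e q)) \<in> E W" by (rule local_frame_column[OF e W(1) order_refl])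
    have c2: "(\<lambda>q. column i (e' q)) \<in> F W" for i by (rule local_frame_column[OF e' W(1) order_refl])
    have s2: "(\<lambda>q. \<Sum>i\<in>UNIV. M q $ i $ j *s column i (e' q)) \<in> F W"
      by (intro section_sum[OF vb(2) W(1)] c2 M(1)) simp
    have "\<phi> ?q *v D W (\<lambda>q. column j (e q)) ?q = D' W (\<lambda>q. \<phi> q *v column j (e q)) ?q"
    proof -
      have "\<forall>U s. openin P1_top U \<and> s \<in> E U \<longrightarrow>
          (\<forall>q \<in> U - punctures. D' U (\<lambda>x. \<phi> x *v s x) q = \<phi> q *v D U s q)"
        using hom unfolding conn_hom_def by (rule conjunct2)
      then show ?thesis using W(1) c1 z by simp
    qed
    also have "\<dots> = D' W (\<lambda>q. \<Sum>i\<in>UNIV. M q $ i $ j *s column i (e' q)) ?q"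
      by (rule log_connection_restrict[OF D' W(1) W(1) order_refl s2 colM z'])
    also have "\<dots> = (\<Sum>i\<in>UNIV. deriv (\<lambda>x. M (Some x) $ i $ j) z *s column i (e' ?q) +
        M ?q $ i $ j *s D' W (\<lambda>q. column i (e' q)) ?q)"
      by (rule log_connection_sum[OF D' W(1) z']) (use c2 M(1) in auto)
    finally have "?l *s (\<phi> ?q *v D W (\<lambda>q. column j (e q)) ?q) =
        ?l *s (\<Sum>i\<in>UNIV. deriv (\<lambda>x. M (Some x) $ i $ j) z *s column i (e' ?q) +
        M ?q $ i $ j *s D' W (\<lambda>q. column i (e' q)) ?q)" by simp
    also have "\<dots> = (\<Sum>i\<in>UNIV. (?l * deriv (\<lambda>x. M (Some x) $ i $ j) z) *s column i (e' ?q)) +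
        (\<Sum>i\<in>UNIV. M ?q $ i $ j *s (?l *s D' W (\<lambda>q. column i (e' q)) ?q))"
      by (simp add: vec_eq_iff sum_distrib_left sum.distrib algebra_simps)
    also have "(\<Sum>i\<in>UNIV. M ?q $ i $ j *s (?l *s D' W (\<lambda>q. column i (e' q)) ?q)) =
        (\<Sum>i\<in>UNIV. M ?q $ i $ j *s (e' ?q *v column i (A' ?q)))"
      using A'(3)[OF z] by simp
    also have "\<dots> = e' ?q *v column j (A' ?q ** M ?q)"
      by (simp add: vec_eq_iff matrix_vector_mult_def matrix_matrix_mult_def column_def
          sum_distrib_left mult.left_commute mult.commute) (subst sum.swap, simp)
    also have "(\<Sum>i\<in>UNIV. (?l * deriv (\<lambda>x. M (Some x) $ i $ j) z) *s column i (e' ?q)) =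
        e' ?q *v (\<chi> i. ?l * deriv (\<lambda>x. M (Some x) $ i $ j) z)"
      by (simp add: matrix_vector_mult_columns)
    also have "?l *s (\<phi> ?q *v D W (\<lambda>q. column j (e q)) ?q) = \<phi> ?q *v (e ?q *v column j (A ?q))"
      by (simp only: A(3)[OF z, symmetric] vector_scalar_commute)
    also have "\<dots> = e' ?q *v (M ?q *v column j (A ?q))"
      using M(2)[OF z'(1)] by (simp add: matrix_vector_mul_assoc)
    finally have "e' ?q *v (M ?q *v column j (A ?q)) =
        e' ?q *v ((\<chi> i. ?l * deriv (\<lambda>x. M (Some x) $ i $ j) z) + column j (A' ?q ** M ?q))"
      by (simp add: matrix_vector_right_distrib)
    then have "M ?q *v column j (A ?q) =
        (\<chi> i. ?l * deriv (\<lambda>x. M (Some x) $ i $ j) z) + column j (A' ?q ** M ?q)"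
      using invertible_solve(2)[OF inv(2)[OF z'(1)]] by metis
    from arg_cong[OF this, of "\<lambda>v. v $ i"] show ?thesis
      by (simp add: column_def matrix_vector_mult_def matrix_matrix_mult_def)
  qed
  obtain r where r: "r > 0" "chart p ` ball 0 r \<subseteq> W"
    using chart_in_open[OF W(1,2)] by blast
  have Mp: "M p = 0"
  proof -
    have "e' p ** M p = 0" using M(2)[OF W(2)] \<phi>p by simp
    then have "matrix_inv (e' p) ** (e' p ** M p) = 0" by simp
    then show ?thesis using matrix_inv_inverse(2)[OF inv(2)[OF W(2)]] by (simp add: matrix_mul_assoc)
  qed
  have hol: "(\<lambda>\<zeta>. G (chart p \<zeta>)) holomorphic_on ball 0 r" if "hol_fun W G" for G
    by (rule holomorphic_on_subset[OF hol_fun_chart[OF that]]) (use r in auto)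
  have "M (chart p \<zeta>) = 0" if \<zeta>: "\<zeta> \<in> ball 0 r" for \<zeta>
  proof (rule nonresonant_solution_zero[where A = "\<lambda>\<zeta>. A (chart p \<zeta>)" and A' = "\<lambda>\<zeta>. A' (chart p \<zeta>)"
        and M = "\<lambda>\<zeta>. M (chart p \<zeta>)", OF r(1) hol[OF M(1)] hol[OF A(1)] hol[OF A'(1)] _ _ _ \<zeta>])
    fix \<zeta> :: complex and i j assume \<zeta>: "\<zeta> \<in> ball 0 r"
    show "\<zeta> * deriv (\<lambda>\<zeta>. M (chart p \<zeta>) $ i $ j) \<zeta> + (A' (chart p \<zeta>) ** M (chart p \<zeta>)) $ i $ j
        = (M (chart p \<zeta>) ** A (chart p \<zeta>)) $ i $ j"
    proof (cases "\<zeta> = 0")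
      case True
      then show ?thesis using Mp by simp
    next
      case False
      then obtain z where z: "chart p \<zeta> = Some z"
        by (cases p) (auto simp: chart_def chart_inf_def)
      have "chart p \<zeta> \<noteq> p" using False by (cases p) (auto simp: chart_def chart_inf_def)
      moreover have "chart p \<zeta> \<in> W" using r(2) \<zeta> by blast
      ultimately have zW: "Some z \<in> W - punctures" using z Wp by auto
      show ?thesis
        using eqn[OF zW, of i j] chart_deriv[OF W(1) M(1) z _ False, of i j] zW by (simp add: z)
    qed
  next
    fix n and N :: "complex^'n^'m"
    assume n: "n \<ge> 1" and "mat (of_nat n) ** N + A' (chart p 0) ** N = N ** A (chart p 0)"
    then have eq: "mat (of_nat n) ** N + A' p ** N = N ** A p" by simp
    let ?e = "e p" and ?e' = "e' p"
    note i = matrix_inv_inverse[OF inv(1)[OF W(2)]]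
    \<comment> \<open>\<open>K\<close> is \<open>N\<close> seen as a map between the fibres, where the residues act.\<close>
    define K where "K = ?e' ** N ** matrix_inv ?e"
    have Ke: "K ** ?e = ?e' ** N" by (simp add: K_def matrix_mul_assoc[symmetric] i)
    have "(mat (of_nat n) ** K + R' ** K) ** ?e = ?e' ** (mat (of_nat n) ** N + A' p ** N)"
    proof -
      have "mat (of_nat n) ** (?e' ** N) = ?e' ** (mat (of_nat n) ** N)"
        unfolding mat_mult_eq
        by (simp add: vec_eq_iff matrix_matrix_mult_def sum_distrib_left mult.left_commute)
      moreover have "R' ** (?e' ** N) = ?e' ** (A' p ** N)"
        using A'(2) by (simp add: matrix_mul_assoc)
      ultimately show ?thesis
        by (simp add: matrix_add_ldistrib matrix_add_rdistrib matrix_mul_assoc[symmetric] Ke)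
    qed
    also have "\<dots> = K ** R ** ?e"
      using A(2) Ke by (simp add: eq) (metis matrix_mul_assoc)
    finally have "(mat (of_nat n) ** K + R' ** K) ** ?e ** matrix_inv ?e = K ** R ** ?e ** matrix_inv ?e"
      by simp
    then have "mat (of_nat n) ** K + R' ** K = K ** R"
      by (simp add: matrix_mul_assoc[symmetric] i)
    then have "K = 0" by (rule nonres[OF n])
    then have "?e' ** N = 0" using Ke by simp
    then have "matrix_inv ?e' ** (?e' ** N) = 0" by simp
    then show "N = 0" using matrix_inv_inverse(2)[OF inv(2)[OF W(2)]] by (simp add: matrix_mul_assoc)
  qed (simp add: Mp)
  then have "\<phi> q = 0" if "q \<in> chart p ` ball 0 r" for q
  proof -
    have q: "q \<in> W" "M q = 0" using that r \<open>\<And>\<zeta>. \<zeta> \<in> ball 0 r \<Longrightarrow> M (chart p \<zeta>) = 0\<close> by auto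
    then have "\<phi> q ** e q ** matrix_inv (e q) = 0" using M(2)[OF q(1)] by simp
    then show ?thesis by (simp add: matrix_mul_assoc[symmetric] matrix_inv_inverse[OF inv(1)[OF q(1)]])
  qed
  moreover have "p \<in> chart p ` ball 0 r" using r(1) by (intro image_eqI[of _ _ 0]) auto
  ultimately show ?thesis using openin_chart_ball[OF r(1), of p] by blast
qed

lemma eigenvector_of_left_eigenvector:
  assumes "N \<noteq> 0" "(N::complex^'n^1) ** A = (\<chi> i j. c * N $ i $ j)"
  shows "\<exists>v. v \<noteq> 0 \<and> A *v v = c *s v"
proof (rule ccontr)
  assume no: "\<not> ?thesis"
  define B where "B = A - mat c"
  have Bv: "B *v v = A *v v - c *s v" for v
    by (simp add: B_def vec_eq_iff matrix_vector_mult_def mat_def left_diff_distrib sum_subtractf mult_delta_left)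
  have "\<forall>v. B *v v = 0 \<longrightarrow> v = 0" using no Bv by auto
  then obtain B' where "B' ** B = mat 1" using matrix_left_invertible_ker[of B] by blast
  then have B': "B ** B' = mat 1" using matrix_left_right_inverse by blast
  have "N ** B = 0"
    using assms(2) by (simp add: B_def vec_eq_iff matrix_matrix_mult_def mat_def right_diff_distrib
        sum_subtractf mult_delta_right mult.commute)
  then have "N ** B ** B' = 0" by simp
  then show False using assms(1) B' by (simp add: matrix_mul_assoc[symmetric])
qed

text \<open>
  The column \<open>N\<close> would be an eigenvector of \<open>R'\<close> for the eigenvalue of \<open>R\<close> lowered by \<open>n\<close>.
\<close>

lemma nonresonant_from_line:
  fixes N :: "complex^1^'m::finite"
  assumes "principal_spectrum R" "principal_spectrum R'" "n \<ge> 1"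
    and eq: "mat (of_nat n) ** N + R' ** N = N ** R"
  shows "N = 0"
proof (rule ccontr)
  assume N: "N \<noteq> 0"
  define v where "v = column 1 N"
  define c where "c = R $ 1 $ 1"
  have v0: "v \<noteq> 0" using N by (auto simp: v_def column_def vec_eq_iff forall_1)
  have "R *v (\<chi> i::1. (1::complex)) = c *s (\<chi> i::1. (1::complex))"
    by (simp add: vec_eq_iff matrix_vector_mult_def c_def forall_1 sum_1)
  moreover have "(\<chi> i::1. (1::complex)) \<noteq> 0" by (simp add: vec_eq_iff)
  ultimately have c: "Re c < 1" using assms(1) unfolding principal_spectrum_def by blast
  have "R' *v v = (c - of_nat n) *s v"
  proof -
    have "of_nat n * N $ i $ 1 + (R' ** N) $ i $ 1 = (N ** R) $ i $ 1" for i
      using arg_cong[OF eq[unfolded mat_mult_eq], of "\<lambda>X. X $ i $ 1"] by simp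
    moreover have "(R' ** N) $ i $ 1 = (R' *v v) $ i" "(N ** R) $ i $ 1 = c * N $ i $ 1" for i
      by (simp_all add: v_def c_def column_def matrix_vector_mult_def matrix_matrix_mult_def
          sum_1 mult.commute)
    ultimately have "of_nat n * N $ i $ 1 + (R' *v v) $ i = c * N $ i $ 1" for i by simp
    then show ?thesis by (simp add: vec_eq_iff v_def column_def left_diff_distrib eq_diff_eq add.commute)
  qed
  then have "0 \<le> Re (c - of_nat n)" using assms(2) v0 unfolding principal_spectrum_def by blast
  then show False using c assms(3) by simp
qed

text \<open>
  The row \<open>N\<close> would be a left eigenvector of \<open>R\<close> for the eigenvalue of \<open>R'\<close> raised by \<open>n\<close>, and left
  and right eigenvalues coincide.
\<close>

lemma nonresonant_to_line:
  fixes N :: "complex^'n::finite^1"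
  assumes "principal_spectrum R" "principal_spectrum R'" "n \<ge> 1"
    and eq: "mat (of_nat n) ** N + R' ** N = N ** R"
  shows "N = 0"
proof (rule ccontr)
  assume N: "N \<noteq> 0"
  define c where "c = R' $ 1 $ 1"
  have "R' *v (\<chi> i::1. (1::complex)) = c *s (\<chi> i::1. (1::complex))"
    by (simp add: vec_eq_iff matrix_vector_mult_def c_def forall_1 sum_1)
  moreover have "(\<chi> i::1. (1::complex)) \<noteq> 0" by (simp add: vec_eq_iff)
  ultimately have c: "0 \<le> Re c" using assms(2) unfolding principal_spectrum_def by blast
  have "N ** R = (\<chi> i j. (of_nat n + c) * N $ i $ j)"
    unfolding eq[symmetric]
    by (simp add: vec_eq_iff matrix_matrix_mult_def mat_def mult_delta_left forall_1 sum_1 c_def distrib_right)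
  then obtain v where "v \<noteq> 0" "R *v v = (of_nat n + c) *s v"
    using eigenvector_of_left_eigenvector[OF N] by blast
  then have "Re (of_nat n + c) < 1" using assms(1) unfolding principal_spectrum_def by blast
  then show False using c assms(3) by simp
qed

lemma P1_connected:
  assumes "openin P1_top A" "openin P1_top (- A)"
  shows "A = {} \<or> A = UNIV"
proof -
  have *: "B = {}" if "openin P1_top B" "{z. Some z \<in> B} = {}" for B
  proof -
    have "{w. chart_inf w \<in> B} \<subseteq> {0}" using that(2) by (auto simp: chart_inf_def split: if_splits)
    moreover have "open {w. chart_inf w \<in> B}" by (rule open_inf_preimage[OF that(1)])
    ultimately have "{w. chart_inf w \<in> B} = {}"
      by (metis not_open_singleton subset_singletonD)
    then have "chart_inf 0 \<notin> B" by blast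
    then have "None \<notin> B" by (simp add: chart_inf_def)
    then show ?thesis using that(2) by (metis (mono_tags, lifting) empty_Collect_eq equals0I not_Some_eq)
  qed
  have "open {z. Some z \<in> A}" "open {z. Some z \<in> - A}"
    using assms open_Some_preimage by blast+
  moreover have "- {z. Some z \<in> A} = {z. Some z \<in> - A}" by auto
  ultimately have "{z. Some z \<in> A} = {} \<or> {z. Some z \<in> A} = UNIV"
    by (metis clopen closed_def)
  then show ?thesis
  proof
    assume "{z. Some z \<in> A} = UNIV"
    then have "{z. Some z \<in> - A} = {}" by auto
    then show ?thesis using *[OF assms(2)] by auto
  qed (use *[OF assms(1)] in auto)
qed

lemma bundle_hom_nonzero_open:
  fixes E :: "'n::finite presheaf" and F :: "'m::finite presheaf"
  assumes E: "vector_bundle E" and F: "vector_bundle F" and hom: "bundle_hom E F \<phi>"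
  shows "openin P1_top {q. \<phi> q \<noteq> 0}"
proof (subst openin_subopen, intro ballI)
  fix p assume "p \<in> {q. \<phi> q \<noteq> 0}"
  then have p: "\<phi> p \<noteq> 0" by simp
  obtain W0 e where W0: "openin P1_top W0" "p \<in> W0" "local_frame E W0 e"
    by (rule vector_bundle_frame[OF E openin_P1_UNIV UNIV_I[of p]])
  obtain W e' where W: "openin P1_top W" "p \<in> W" "W \<subseteq> W0" and e': "local_frame F W e'"
    by (rule vector_bundle_frame[OF F W0(1,2)])
  have e: "local_frame E W e" using W0(3) W(3) by (rule local_frame_subset)
  have inv: "invertible (e q)" "invertible (e' q)" if "q \<in> W" for q
    using e e' that unfolding local_frame_def by auto
  obtain M where M: "\<And>i j. hol_fun W (\<lambda>q. M q $ i $ j)" "\<And>q. q \<in> W \<Longrightarrow> \<phi> q ** e q = e' q ** M q"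
    using bundle_hom_in_frames[OF hom W(1) e e'] by blast
  have "M p \<noteq> 0"
  proof
    assume "M p = 0"
    then have "\<phi> p ** e p ** matrix_inv (e p) = 0" using M(2)[OF W(2)] by simp
    then show False using p by (simp add: matrix_mul_assoc[symmetric] matrix_inv_inverse[OF inv(1)[OF W(2)]])
  qed
  then obtain i j where ij: "M p $ i $ j \<noteq> 0" by (auto simp: vec_eq_iff)
  let ?V = "{q \<in> W. M q $ i $ j \<noteq> 0}"
  have "\<phi> q \<noteq> 0" if "q \<in> ?V" for q
  proof
    assume "\<phi> q = 0"
    then have "e' q ** M q = 0" using M(2)[of q] that by simp
    then have "matrix_inv (e' q) ** (e' q ** M q) = 0" by simp
    then have "M q = 0" using that matrix_inv_inverse(2)[OF inv(2)[of q]] by (simp add: matrix_mul_assoc)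
    then show False using that by simp
  qed
  then show "\<exists>T. openin P1_top T \<and> p \<in> T \<and> T \<subseteq> {q. \<phi> q \<noteq> 0}"
    using hol_fun_nonzero_open[OF W(1) M(1), of i j] W(2) ij by (intro exI[of _ ?V]) auto
qed

text \<open>
  The set of zeros is open because vanishing spreads, and closed because \<open>\<phi>\<close> is holomorphic.
\<close>

lemma conn_hom_zero_or_nowhere_zero:
  fixes E :: "'n::finite presheaf" and F :: "'m::finite presheaf"
  assumes D: "log_connection E D" and D': "log_connection F D'" and hom: "conn_hom E D F D' \<phi>"
    and nonres: "\<And>p. \<exists>R R'. log_derivative_at E D p R \<and> log_derivative_at F D' p R' \<and>
      (\<forall>n N. n \<ge> 1 \<longrightarrow> mat (of_nat n) ** N + R' ** N = N ** R \<longrightarrow> N = 0)"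
  shows "(\<forall>q. \<phi> q = 0) \<or> (\<forall>q. \<phi> q \<noteq> 0)"
proof -
  note vb = log_connection_bundle[OF D] log_connection_bundle[OF D']
  have "bundle_hom E F \<phi>" using hom unfolding conn_hom_def by (rule conjunct1)
  then have 1: "openin P1_top {q. \<phi> q \<noteq> 0}" by (rule bundle_hom_nonzero_open[OF vb])
  have 2: "openin P1_top (- {q. \<phi> q \<noteq> 0})"
  proof (subst openin_subopen, intro ballI)
    fix p assume "p \<in> - {q. \<phi> q \<noteq> 0}"
    then have p: "\<phi> p = 0" by simp
    obtain R R' where R: "log_derivative_at E D p R" "log_derivative_at F D' p R'"
      "\<forall>n N. n \<ge> 1 \<longrightarrow> mat (of_nat n) ** N + R' ** N = N ** R \<longrightarrow> N = 0"
      using nonres[of p] by (elim exE conjE) (rule that; assumption)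
    have "\<exists>V. openin P1_top V \<and> p \<in> V \<and> (\<forall>q\<in>V. \<phi> q = 0)"
      by (rule conn_hom_vanishes_near[OF D D' hom R(1,2) _ p]) (use R(3) in simp)
    then obtain V where "openin P1_top V" "p \<in> V" "\<forall>q\<in>V. \<phi> q = 0" by (elim exE conjE)
    then show "\<exists>T. openin P1_top T \<and> p \<in> T \<and> T \<subseteq> - {q. \<phi> q \<noteq> 0}"
      by (intro exI[of _ V]) auto
  qed
  show ?thesis using P1_connected[OF 1 2] by auto
qed

lemma log_extension_connection: "log_extension \<rho> E D \<Phi> \<Longrightarrow> log_connection E D"
  unfolding log_extension_def by (elim conjE)

lemma log_extension_hom_zero_or_nowhere_zero:
  fixes E :: "'n::finite presheaf" and F :: "'m::finite presheaf"
  assumes E: "log_extension \<rho> E D \<Phi>" and F: "log_extension \<tau> F D' \<Psi>" and hom: "conn_hom E D F D' \<phi>"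
    and nonres: "\<And>R R' n (N :: complex^'n^'m). principal_spectrum R \<Longrightarrow> principal_spectrum R' \<Longrightarrow> n \<ge> 1 \<Longrightarrow>
      mat (of_nat n) ** N + R' ** N = N ** R \<Longrightarrow> N = 0"
  shows "(\<forall>q. \<phi> q = 0) \<or> (\<forall>q. \<phi> q \<noteq> 0)"
proof (rule conn_hom_zero_or_nowhere_zero[OF log_extension_connection[OF E]
      log_extension_connection[OF F] hom])
  fix p
  obtain R where R: "log_derivative_at E D p R" "principal_spectrum R"
    using log_extension_log_derivative[OF E, of p] by (elim exE conjE)
  obtain R' where R': "log_derivative_at F D' p R'" "principal_spectrum R'"
    using log_extension_log_derivative[OF F, of p] by (elim exE conjE)
  have "\<forall>n N. n \<ge> 1 \<longrightarrow> mat (of_nat n) ** N + R' ** N = N ** R \<longrightarrow> N = 0"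
    using nonres[OF R(2) R'(2)] by simp
  then show "\<exists>R R'. log_derivative_at E D p R \<and> log_derivative_at F D' p R' \<and>
      (\<forall>n N. n \<ge> 1 \<longrightarrow> mat (of_nat n) ** N + R' ** N = N ** R \<longrightarrow> N = 0)"
    using R(1) R'(1) by (intro exI[of _ R] exI[of _ R'] conjI)
qed

lemma conn_hom_compose:
  assumes "conn_hom E D F D' \<phi>" "conn_hom F D' G D'' \<psi>"
  shows "conn_hom E D G D'' (\<lambda>q. \<psi> q ** \<phi> q)"
  using assms unfolding conn_hom_def bundle_hom_def
  by (simp add: matrix_vector_mul_assoc[symmetric])

lemma exact_maps_iff_line_plane_line:
  fixes A :: "complex^1^2" and B :: "complex^2^1"
  shows "exact_maps A B \<longleftrightarrow> A \<noteq> 0 \<and> B \<noteq> 0 \<and> B ** A = 0"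
proof
  assume ex: "exact_maps A B"
  have "A \<noteq> 0"
  proof
    assume "A = 0"
    then have "A *v (\<chi> i. 1) = A *v 0" by simp
    then have "(\<chi> i::1. (1::complex)) = 0" using ex unfolding exact_maps_def by (blast dest: injD)
    then show False by (simp add: vec_eq_iff)
  qed
  moreover have "B \<noteq> 0"
  proof
    assume "B = 0"
    then have "range ((*v) B) = {0}" by auto
    then have "(\<chi> i::1. (1::complex)) = 0" using ex unfolding exact_maps_def by blast
    then show False by (simp add: vec_eq_iff)
  qed
  moreover have "B ** A = 0"
  proof -
    have "B *v (A *v x) = 0" for x using ex unfolding exact_maps_def by blast
    then have "(B ** A) *v x = 0" for x by (simp add: matrix_vector_mul_assoc)
    then show ?thesis by (metis matrix_eq matrix_vector_mult_0)
  qed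
  ultimately show "A \<noteq> 0 \<and> B \<noteq> 0 \<and> B ** A = 0" by blast
next
  assume h: "A \<noteq> 0 \<and> B \<noteq> 0 \<and> B ** A = 0"
  define a1 a2 b1 b2 where ab: "a1 = A $ 1 $ 1" "a2 = A $ 2 $ 1" "b1 = B $ 1 $ 1" "b2 = B $ 1 $ 2"
  have a0: "a1 \<noteq> 0 \<or> a2 \<noteq> 0" and b0: "b1 \<noteq> 0 \<or> b2 \<noteq> 0"
    using h by (auto simp: ab vec_eq_iff forall_1 forall_2)
  have BA: "b1 * a1 + b2 * a2 = 0"
    using h by (auto simp: ab vec_eq_iff forall_1 matrix_matrix_mult_def sum_2)
  have Av: "A *v x = (\<chi> i. (if i = 1 then a1 else a2) * x $ 1)" for x
    by (simp add: vec_eq_iff forall_2 matrix_vector_mult_def sum_1 ab)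
  have Bv: "B *v x = (\<chi> i. b1 * x $ 1 + b2 * x $ 2)" for x
    by (simp add: vec_eq_iff forall_1 matrix_vector_mult_def sum_2 ab)
  have "inj ((*v) A)"
  proof (rule injI)
    fix x y assume "A *v x = A *v y"
    then have "a1 * x $ 1 = a1 * y $ 1 \<and> a2 * x $ 1 = a2 * y $ 1"
      by (auto simp: Av vec_eq_iff forall_2)
    then show "x = y" using a0 by (auto simp: vec_eq_iff forall_1)
  qed
  moreover have "range ((*v) A) = {v. B *v v = 0}"
  proof (intro set_eqI iffI)
    fix v assume "v \<in> range ((*v) A)"
    then show "v \<in> {v. B *v v = 0}" using h by (auto simp: matrix_vector_mul_assoc)
  next
    fix v assume "v \<in> {v. B *v v = 0}"
    then have v: "b1 * v $ 1 + b2 * v $ 2 = 0" by (simp add: Bv vec_eq_iff)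
    have cross: "a1 * v $ 2 = a2 * v $ 1"
    proof (cases "b1 = 0")
      case True
      then show ?thesis using v BA b0 by simp
    next
      case False
      have "b1 * (a1 * v $ 2) = b1 * (a2 * v $ 1)" using v BA by algebra
      then show ?thesis using False by simp
    qed
    define t where "t = (if a1 \<noteq> 0 then v $ 1 / a1 else v $ 2 / a2)"
    have "A *v (\<chi> i. t) = v"
      using cross a0 by (auto simp: Av vec_eq_iff forall_2 t_def field_simps)
    then show "v \<in> range ((*v) A)" by (metis rangeI)
  qed
  moreover have "surj ((*v) B)"
  proof (rule surjI)
    fix y :: "complex^1"
    show "B *v (\<chi> i. if i = 1 then (if b1 \<noteq> 0 then y $ 1 / b1 else 0)
        else (if b1 \<noteq> 0 then 0 else y $ 1 / b2)) = y"
      using b0 by (auto simp: Bv vec_eq_iff forall_1)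
  qed
  ultimately show "exact_maps A B" unfolding exact_maps_def by blast
qed

lemma induced_short_exact:
  fixes \<rho>' \<rho>'' :: "1 rep" and \<rho> :: "2 rep"
  assumes "rep_short_exact \<rho>' \<rho> \<rho>'' \<alpha> \<beta>"
    and V': "log_extension \<rho>' V' D' \<Phi>'" and V: "log_extension \<rho> V D \<Phi>" and V'': "log_extension \<rho>'' V'' D'' \<Phi>''"
    and f: "induced_hom V' D' \<Phi>' V D \<Phi> \<alpha> f" and g: "induced_hom V D \<Phi> V'' D'' \<Phi>'' \<beta> g"
  shows "bundle_short_exact V' V V'' f g"
proof -
  let ?b = "Some base_pt"
  have ab: "\<alpha> \<noteq> 0" "\<beta> \<noteq> 0" "\<beta> ** \<alpha> = 0"
    using assms(1) unfolding rep_short_exact_def exact_maps_iff_line_plane_line by blast+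
  have cf: "conn_hom V' D' V D f" "f ?b ** \<Phi>' = \<Phi> ** \<alpha>"
    and cg: "conn_hom V D V'' D'' g" "g ?b ** \<Phi> = \<Phi>'' ** \<beta>"
    using f g unfolding induced_hom_def by blast+
  have inv: "invertible \<Phi>'" "invertible \<Phi>" "invertible \<Phi>''"
    using V' V V'' unfolding log_extension_def has_monodromy_def by blast+
  have fb: "f ?b \<noteq> 0"
  proof
    assume "f ?b = 0"
    then have "matrix_inv \<Phi> ** (\<Phi> ** \<alpha>) = 0" using cf(2)[symmetric] by simp
    then show False using ab matrix_inv_inverse(2)[OF inv(2)] by (simp add: matrix_mul_assoc)
  qed
  have gb: "g ?b \<noteq> 0"
  proof
    assume "g ?b = 0"
    then have "matrix_inv \<Phi>'' ** (\<Phi>'' ** \<beta>) = 0" using cg(2)[symmetric] by simp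
    then show False using ab matrix_inv_inverse(2)[OF inv(3)] by (simp add: matrix_mul_assoc)
  qed
  have gfb: "g ?b ** f ?b = 0"
  proof -
    have "g ?b ** f ?b ** \<Phi>' = \<Phi>'' ** (\<beta> ** \<alpha>)"
      using cf(2) cg(2) by (metis matrix_mul_assoc)
    then have "g ?b ** f ?b ** \<Phi>' ** matrix_inv \<Phi>' = 0" using ab by simp
    then show ?thesis using matrix_inv_inverse(1)[OF inv(1)] by (simp add: matrix_mul_assoc[symmetric])
  qed
  have "(\<forall>q. f q = 0) \<or> (\<forall>q. f q \<noteq> 0)"
    by (rule log_extension_hom_zero_or_nowhere_zero[OF V' V cf(1)]) (rule nonresonant_from_line)
  then have "\<forall>q. f q \<noteq> 0" using fb by blast
  moreover have "(\<forall>q. g q = 0) \<or> (\<forall>q. g q \<noteq> 0)"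
    by (rule log_extension_hom_zero_or_nowhere_zero[OF V V'' cg(1)]) (rule nonresonant_to_line)
  then have "\<forall>q. g q \<noteq> 0" using gb by blast
  moreover have "(\<forall>q. g q ** f q = 0) \<or> (\<forall>q. g q ** f q \<noteq> 0)"
    by (rule log_extension_hom_zero_or_nowhere_zero[OF V' V'' conn_hom_compose[OF cf(1) cg(1)]])
      (rule nonresonant_from_line)
  then have "\<forall>q. g q ** f q = 0" using gfb by blast
  moreover have "bundle_hom V' V f" "bundle_hom V V'' g"
    using cf(1) cg(1) unfolding conn_hom_def by blast+
  ultimately show ?thesis unfolding bundle_short_exact_def exact_maps_iff_line_plane_line by simp
qed

section \<open>Twisting sheaves\<close>

text \<open>
  The transition function \<open>z powi n\<close> of \<open>\<O>(n)\<close>.  The value \<open>1\<close> at infinity, which need not be a limit,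
  reflects that the values of sections of \<open>\<O>(n)\<close> there are already taken in the frame at infinity.
\<close>

definition zpow :: "int \<Rightarrow> P1 \<Rightarrow> complex" where
  "zpow n q = (case q of Some z \<Rightarrow> z powi n | None \<Rightarrow> 1)"

lemma zpow_nonzero: "q \<noteq> Some 0 \<Longrightarrow> zpow n q \<noteq> 0"
  by (cases q) (auto simp: zpow_def power_int_eq_0_iff)

lemma zpow_minus: "zpow (- n) q = inverse (zpow n q)"
  by (cases q) (auto simp: zpow_def power_int_minus)

lemma hol_fun_zpow:
  assumes "None \<notin> U" "Some 0 \<notin> U"
  shows "hol_fun U (zpow n)"
proof -
  have "(\<lambda>z. z powi n) holomorphic_on {z. Some z \<in> U}"
    by (intro holomorphic_intros) (use assms in auto)
  then show ?thesis unfolding hol_fun_Some_iff[OF assms(1)] by (simp add: zpow_def)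
qed

lemma twisting_sheaf_iff:
  "s \<in> twisting_sheaf k U \<longleftrightarrow>
     hol_fun (U - {None}) (\<lambda>q. s q $ 1) \<and> hol_fun (U - {Some 0}) (\<lambda>q. zpow (- k) q * s q $ 1)"
proof -
  have 1: "{z. Some z \<in> U - {None}} = {z. Some z \<in> U}" by auto
  have 2: "{w. chart_inf w \<in> U - {Some 0}} = {w. chart_inf w \<in> U}"
    by (auto simp: chart_inf_def)
  have 3: "zpow (- k) (chart_inf w) * s (chart_inf w) $ 1 =
      (if w = 0 then s None $ 1 else w powi k * s (Some (1 / w)) $ 1)" for w
    by (simp add: zpow_def chart_inf_def power_int_minus power_int_divide_distrib)
  have "hol_fun (U - {None}) (\<lambda>q. s q $ 1) \<longleftrightarrow> (\<lambda>z. s (Some z) $ 1) holomorphic_on {z. Some z \<in> U}"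
    using hol_fun_Some_iff[of "U - {None}" "\<lambda>q. s q $ 1"] 1 by simp
  moreover have "hol_fun (U - {Some 0}) (\<lambda>q. zpow (- k) q * s q $ 1) \<longleftrightarrow>
      (\<lambda>w. if w = 0 then s None $ 1 else w powi k * s (Some (1 / w)) $ 1)
        holomorphic_on {w. chart_inf w \<in> U}"
    using hol_fun_inf_iff[of "U - {Some 0}" "\<lambda>q. zpow (- k) q * s q $ 1"] 2 3 by simp
  ultimately show ?thesis unfolding twisting_sheaf_def by simp
qed

lemma zpow_cancel:
  assumes "z \<noteq> 0" "d + int n \<ge> 0"
  shows "zpow d (Some z) * (1 / z) ^ nat (d + int n) = 1 / z ^ n"
proof -
  have "zpow d (Some z) * (1 / z) ^ nat (d + int n) = z powi d * (1 / z) powi (d + int n)"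
    using assms by (simp add: zpow_def power_int_def)
  also have "\<dots> = z powi d / z powi (d + int n)" by (simp add: power_int_divide_distrib)
  also have "\<dots> = 1 / z ^ n" using assms(1) by (simp add: power_int_add)
  finally show ?thesis .
qed

lemma openin_Compl_None: "openin P1_top (- {None})" and openin_Compl_0: "openin P1_top (- {Some 0})"
  by (simp_all add: openin_P1_Compl_finite)

lemma line_bundle_generators:
  fixes E :: "1 presheaf"
  assumes "bundle_iso E (twisting_sheaf k)"
  shows "\<exists>e ei. e \<in> E (- {None}) \<and> ei \<in> E (- {Some 0}) \<and> (\<forall>q. e q \<noteq> 0) \<and>
    (\<forall>q. q \<noteq> Some 0 \<longrightarrow> ei q \<noteq> 0) \<and> (\<forall>z. z \<noteq> 0 \<longrightarrow> ei (Some z) = zpow k (Some z) *s e (Some z))"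
proof -
  obtain \<phi> \<psi> where *: "bundle_hom (twisting_sheaf k) E \<psi>" "\<forall>q. \<phi> q ** \<psi> q = mat 1 \<and> \<psi> q ** \<phi> q = mat 1"
    using assms unfolding bundle_iso_def by (elim exE conjE)
  have hom: "(\<lambda>q. \<psi> q *v s q) \<in> E U" if "openin P1_top U" "s \<in> twisting_sheaf k U" for U s
    using *(1) that unfolding bundle_hom_def by simp
  have nz: "\<psi> q *v x \<noteq> 0" if "x \<noteq> 0" for q x
  proof
    assume "\<psi> q *v x = 0"
    then have "\<phi> q *v (\<psi> q *v x) = 0" by simp
    then show False using that *(2) by (simp add: matrix_vector_mul_assoc)
  qed
  define e where "e = (\<lambda>q. \<psi> q *v (\<chi> i. 1))"
  define ei where "ei = (\<lambda>q. \<psi> q *v (\<chi> i. zpow k q))"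
  have "(\<lambda>q. \<chi> i. 1) \<in> twisting_sheaf k (- {None})"
    unfolding twisting_sheaf_iff using hol_fun_zpow[of "- {None} - {Some 0}" "- k"] by simp
  then have "e \<in> E (- {None})" unfolding e_def by (rule hom[OF openin_Compl_None])
  moreover have "(\<lambda>q. \<chi> i. zpow k q) \<in> twisting_sheaf k (- {Some 0})"
  proof -
    have "hol_fun (- {Some 0} - {Some 0}) (\<lambda>q. zpow (- k) q * zpow k q) \<longleftrightarrow>
        hol_fun (- {Some 0} - {Some 0}) (\<lambda>q. 1)"
      by (rule hol_fun_cong) (simp add: zpow_minus zpow_nonzero)
    then show ?thesis unfolding twisting_sheaf_iff
      using hol_fun_zpow[of "- {Some 0} - {None}" k] by simp
  qed
  then have "ei \<in> E (- {Some 0})" unfolding ei_def by (rule hom[OF openin_Compl_0])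
  moreover have "e q \<noteq> 0" for q
    unfolding e_def by (rule nz) (simp add: vec_eq_iff)
  moreover have "ei q \<noteq> 0" if "q \<noteq> Some 0" for q
    unfolding ei_def by (rule nz) (simp add: vec_eq_iff zpow_nonzero[OF that])
  moreover have "ei (Some z) = zpow k (Some z) *s e (Some z)" for z
    by (simp add: e_def ei_def vec_eq_iff matrix_vector_mult_def sum_1)
  ultimately show ?thesis by (intro exI[of _ e] exI[of _ ei]) simp
qed

lemma line_bundle_coordinate:
  fixes E :: "1 presheaf"
  assumes E: "vector_bundle E" and W: "openin P1_top W"
    and e: "e \<in> E W" "\<forall>q\<in>W. e q \<noteq> 0" and s: "s \<in> E W"
  shows "\<exists>c. hol_fun W c \<and> (\<forall>q\<in>W. s q = c q *s e q)"
proof -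
  define m :: "P1 \<Rightarrow> complex^1^1" where "m = (\<lambda>q. \<chi> i j. e q $ i)"
  have fr: "local_frame E W m"
  proof (rule local_frame_of_sections[OF E W])
    have "column j (m q) = e q" for j q by (simp add: m_def column_def vec_eq_iff)
    then show "(\<lambda>q. column j (m q)) \<in> E W" for j using e by simp
    show "invertible (m q)" if "q \<in> W" for q
      using e(2)[rule_format, OF that] by (simp add: invertible_det_nz det_1 m_def vec_eq_iff forall_1)
  qed
  obtain c where c: "\<And>i. hol_fun W (\<lambda>q. c q $ i)" "\<And>q. q \<in> W \<Longrightarrow> s q = m q *v c q"
    using local_frame_coordinates[OF fr W order_refl s] by blast
  have "s q = c q $ 1 *s e q" if "q \<in> W" for q
    using c(2)[OF that] by (simp add: m_def vec_eq_iff matrix_vector_mult_def sum_1 mult.commute)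
  then show ?thesis using c(1)[of 1] by blast
qed

section \<open>Degree\<close>

text \<open>
  In the frame \<open>e\<close> the connection form is \<open>\<alpha> dx / x\<close> for a coordinate \<open>x\<close> at \<open>p\<close>, and \<open>\<alpha> p\<close> is the
  residue.  The frame is chosen on the complement of the other two punctures, so that \<open>\<alpha>\<close> is global
  enough for Liouville's theorem.
\<close>

lemma log_coefficient:
  fixes E :: "1 presheaf"
  assumes ext: "log_extension \<rho> E D \<Phi>" and p: "p \<in> punctures"
    and e: "e \<in> E (- (punctures - {p}))" "\<forall>q\<in>- (punctures - {p}). e q \<noteq> 0"
  shows "\<exists>\<alpha>. hol_fun (- (punctures - {p})) \<alpha> \<and> 0 \<le> Re (\<alpha> p) \<and> Re (\<alpha> p) < 1 \<and>
    (\<forall>z. Some z \<notin> punctures \<longrightarrow> log_factor p z *s D (- punctures) e (Some z) = \<alpha> (Some z) *s e (Some z))"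
proof -
  let ?U = "- (punctures - {p})"
  have D: "log_connection E D" by (rule log_extension_connection[OF ext])
  note E = log_connection_bundle[OF D]
  have U: "openin P1_top ?U" "p \<in> ?U" by (rule openin_P1_Compl_finite, simp) simp
  obtain R where R: "log_derivative_at E D p R" "principal_spectrum R"
    using log_extension_log_derivative[OF ext, of p] by (elim exE conjE)
  have h: "openin P1_top ?U \<and> p \<in> ?U \<and> ?U \<inter> punctures \<subseteq> {p} \<and> e \<in> E ?U"
    using U e(1) by (intro conjI) blast+
  have "\<exists>u\<in>E ?U. u p = R *v e p \<and>
      (\<forall>z. Some z \<in> ?U - punctures \<longrightarrow> u (Some z) = log_factor p z *s D ?U e (Some z))"
    using R(1)[unfolded log_derivative_at_def, THEN spec, THEN spec, THEN mp, OF h] .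
  then obtain u where u: "u \<in> E ?U" "u p = R *v e p"
      "\<forall>z. Some z \<in> ?U - punctures \<longrightarrow> u (Some z) = log_factor p z *s D ?U e (Some z)"
    by (elim bexE conjE)
  obtain \<alpha> where \<alpha>: "hol_fun ?U \<alpha>" "\<forall>q\<in>?U. u q = \<alpha> q *s e q"
    using line_bundle_coordinate[OF E U(1) e u(1)] by (elim exE conjE)
  have "R *v e p = \<alpha> p *s e p" using \<alpha>(2) U(2) u(2) by simp
  moreover have "e p \<noteq> 0" using e(2) U(2) by simp
  ultimately have "0 \<le> Re (\<alpha> p) \<and> Re (\<alpha> p) < 1"
    using R(2) unfolding principal_spectrum_def by blast
  moreover have "log_factor p z *s D (- punctures) e (Some z) = \<alpha> (Some z) *s e (Some z)"
    if z: "Some z \<notin> punctures" for z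
  proof -
    have "D (- punctures) e (Some z) = D ?U e (Some z)"
      by (rule log_connection_restrict[OF D U(1) _ _ e(1)])
        (use z in \<open>auto simp: openin_P1_Compl_finite\<close>)
    then show ?thesis using u(3) \<alpha>(2) z by simp
  qed
  ultimately show ?thesis using \<alpha>(1) by (intro exI[of _ \<alpha>]) simp
qed

text \<open>
  Here \<open>A / z = B / (z - 1)\<close> is a connection form \<open>\<omega>\<close> in the frame over the affine line, and \<open>C\<close> its
  counterpart at infinity for a frame \<open>z\<^sup>k\<close> times the first one.  The function
  \<open>P = z (z - 1) \<omega>\<close> is entire and its difference quotient \<open>Q\<close> at \<open>1\<close> has the limit \<open>- C None - k\<close> at
  infinity, so \<open>Q\<close> is constant; evaluation at \<open>0\<close> gives the sum.
\<close>

lemma residue_theorem_P1: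
  fixes A B :: "complex \<Rightarrow> complex" and C :: "P1 \<Rightarrow> complex"
  assumes A: "A holomorphic_on - {1}" and B: "B holomorphic_on - {0}"
    and C: "hol_fun (- {Some 0, Some 1}) C"
    and AB: "\<And>z. z \<noteq> 0 \<Longrightarrow> z \<noteq> 1 \<Longrightarrow> (z - 1) * A z = z * B z"
    and AC: "\<And>z. z \<noteq> 0 \<Longrightarrow> z \<noteq> 1 \<Longrightarrow> A z = - C (Some z) - k"
  shows "A 0 + B 1 + C None = - k"
proof -
  define P where "P = (\<lambda>z. if z = 1 then B 1 else (z - 1) * A z)"
  have "P holomorphic_on (- {1}) \<union> (- {0})"
  proof (rule holomorphic_on_Un)
    have "(\<lambda>z. (z - 1) * A z) holomorphic_on - {1}" by (intro holomorphic_intros A)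
    then show "P holomorphic_on - {1}" by (rule holomorphic_transform) (simp add: P_def)
    have "(\<lambda>z. z * B z) holomorphic_on - {0}" by (intro holomorphic_intros B)
    then show "P holomorphic_on - {0}" by (rule holomorphic_transform) (use AB in \<open>auto simp: P_def\<close>)
  qed auto
  moreover have "(- {1::complex}) \<union> (- {0}) = UNIV" by auto
  ultimately have P: "P holomorphic_on UNIV" by simp
  define Q where "Q = (\<lambda>z. if z = 1 then deriv P 1 else (P z - P 1) / (z - 1))"
  have Q: "Q holomorphic_on UNIV" unfolding Q_def by (rule pole_lemma[OF P]) simp
  have Qz: "Q z = A z - B 1 / (z - 1)" if "z \<noteq> 1" for z
    using that by (simp add: Q_def P_def diff_divide_distrib)
  have "((\<lambda>z. C (Some z)) \<longlongrightarrow> C None) at_infinity"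
  proof -
    have op: "open {w. chart_inf w \<in> - {Some 0, Some 1}}"
      by (intro open_inf_preimage openin_P1_Compl_finite) simp
    have "(\<lambda>w. C (chart_inf w)) holomorphic_on {w. chart_inf w \<in> - {Some 0, Some 1}}"
      using C unfolding hol_fun_def by (rule conjunct2)
    then have "continuous_on {w. chart_inf w \<in> - {Some 0, Some 1}} (\<lambda>w. C (chart_inf w))"
      by (rule holomorphic_on_imp_continuous_on)
    moreover have "0 \<in> {w. chart_inf w \<in> - {Some 0, Some 1}}" by (simp add: chart_inf_def)
    ultimately have "isCont (\<lambda>w. C (chart_inf w)) 0"
      using op by (simp add: continuous_on_eq_continuous_at)
    then have "((\<lambda>w. C (chart_inf w)) \<longlongrightarrow> C None) (at 0)"
      by (simp add: isCont_def chart_inf_def)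
    moreover have "\<forall>\<^sub>F w in at 0. C (chart_inf w) = C (Some (inverse w))"
      by (simp add: eventually_at_filter chart_inf_def inverse_eq_divide)
    ultimately have "((\<lambda>w. C (Some (inverse w))) \<longlongrightarrow> C None) (at 0)"
      by (rule Lim_transform_eventually)
    then show ?thesis by (simp add: lim_at_infinity_0 o_def)
  qed
  moreover have "((\<lambda>z. B 1 / (z - 1)) \<longlongrightarrow> 0) at_infinity"
  proof -
    have "filterlim (\<lambda>z::complex. -1 + z) at_infinity at_infinity"
      by (rule tendsto_add_filterlim_at_infinity[OF tendsto_const filterlim_ident])
    then show ?thesis by (intro tendsto_divide_0[OF tendsto_const]) simp
  qed
  ultimately have "((\<lambda>z. - C (Some z) - k - B 1 / (z - 1)) \<longlongrightarrow> - C None - k - 0) at_infinity"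
    by (intro tendsto_intros)
  moreover have "\<forall>\<^sub>F z in at_infinity. - C (Some z) - k - B 1 / (z - 1) = Q z"
    unfolding eventually_at_infinity
  proof (intro exI[of _ 2] allI impI)
    fix z :: complex assume "2 \<le> norm z"
    then have "z \<noteq> 0" "z \<noteq> 1" by auto
    then show "- C (Some z) - k - B 1 / (z - 1) = Q z" by (simp add: Qz AC)
  qed
  ultimately have "(Q \<longlongrightarrow> - C None - k - 0) at_infinity" by (rule Lim_transform_eventually)
  then have "Q 0 = - C None - k - 0" by (rule Liouville_weak[OF Q])
  then have "A 0 + B 1 = - C None - k" by (simp add: Qz)
  then have "A 0 + B 1 + C None = - C None - k + C None" by (simp only:)
  then show ?thesis by simp
qed

lemma degree_bounds:
  fixes E :: "1 presheaf"
  assumes ext: "log_extension \<rho> E D \<Phi>" and iso: "bundle_iso E (twisting_sheaf k)"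
  shows "-2 \<le> k \<and> k \<le> 0"
proof -
  obtain e ei where e: "e \<in> E (- {None})" "ei \<in> E (- {Some 0})" "\<forall>q. e q \<noteq> 0"
    "\<forall>q. q \<noteq> Some 0 \<longrightarrow> ei q \<noteq> 0" "\<forall>z. z \<noteq> 0 \<longrightarrow> ei (Some z) = zpow k (Some z) *s e (Some z)"
    using line_bundle_generators[OF iso] by (elim exE conjE)
  have D: "log_connection E D" by (rule log_extension_connection[OF ext])
  note E = log_connection_bundle[OF D]
  let ?D = "D (- punctures)"
  have Y: "openin P1_top (- punctures)" by (simp add: openin_P1_Compl_finite)
  have punct: "Some 0 \<in> punctures" "Some 1 \<in> punctures" "None \<in> punctures"
      "\<And>z. Some z \<in> punctures \<longleftrightarrow> z = 0 \<or> z = 1" by (auto simp: punctures_def)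
  have e': "e \<in> E (- (punctures - {p}))" if "p \<noteq> None" for p
    by (rule section_restrict[OF E openin_Compl_None openin_P1_Compl_finite _ e(1)])
      (use that in \<open>auto simp: punctures_def\<close>)
  have ei': "ei \<in> E (- (punctures - {None}))"
    by (rule section_restrict[OF E openin_Compl_0 openin_P1_Compl_finite _ e(2)])
      (auto simp: punctures_def)
  have ne: "\<forall>q\<in>X. e q \<noteq> 0" for X using e(3) by simp
  obtain a where a: "hol_fun (- (punctures - {Some 0})) a" "0 \<le> Re (a (Some 0))" "Re (a (Some 0)) < 1"
    "\<forall>z. Some z \<notin> punctures \<longrightarrow> log_factor (Some 0) z *s ?D e (Some z) = a (Some z) *s e (Some z)"
    using log_coefficient[OF ext punct(1) e'[OF option.distinct(2)] ne] by (elim exE conjE)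
  obtain b where b: "hol_fun (- (punctures - {Some 1})) b" "0 \<le> Re (b (Some 1))" "Re (b (Some 1)) < 1"
    "\<forall>z. Some z \<notin> punctures \<longrightarrow> log_factor (Some 1) z *s ?D e (Some z) = b (Some z) *s e (Some z)"
    using log_coefficient[OF ext punct(2) e'[OF option.distinct(2)] ne] by (elim exE conjE)
  have ne': "\<forall>q\<in>- (punctures - {None}). ei q \<noteq> 0"
    using e(4) by (auto simp: punctures_def)
  obtain c where c: "hol_fun (- (punctures - {None})) c" "0 \<le> Re (c None)" "Re (c None) < 1"
    "\<forall>z. Some z \<notin> punctures \<longrightarrow> log_factor None z *s ?D ei (Some z) = c (Some z) *s ei (Some z)"
    using log_coefficient[OF ext punct(3) ei' ne'] by (elim exE conjE)
  have "a (Some 0) + b (Some 1) + c None = - of_int k"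
  proof (rule residue_theorem_P1[of "\<lambda>z. a (Some z)" "\<lambda>z. b (Some z)" c])
    have "{z. Some z \<in> - (punctures - {Some 0})} = - {1}" by (auto simp: punctures_def)
    then show "(\<lambda>z. a (Some z)) holomorphic_on - {1}" using a(1) unfolding hol_fun_def by simp
    have "{z. Some z \<in> - (punctures - {Some 1})} = - {0}" by (auto simp: punctures_def)
    then show "(\<lambda>z. b (Some z)) holomorphic_on - {0}" using b(1) unfolding hol_fun_def by simp
    have "- (punctures - {None}) = - {Some 0, Some 1}" by (auto simp: punctures_def)
    then show "hol_fun (- {Some 0, Some 1}) c" using c(1) by simp
  next
    fix z :: complex assume z: "z \<noteq> 0" "z \<noteq> 1"
    then have zp: "Some z \<notin> punctures" by (simp add: punct)
    define d where "d = ?D e (Some z) $ 1"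
    define \<epsilon> where "\<epsilon> = e (Some z) $ 1"
    have \<epsilon>: "\<epsilon> \<noteq> 0" using e(3)[rule_format, of "Some z"] by (simp add: \<epsilon>_def vec_eq_iff forall_1)
    have a': "z * d = a (Some z) * \<epsilon>"
      using arg_cong[OF a(4)[rule_format, OF zp], of "\<lambda>v. v $ 1"] by (simp add: log_factor_def d_def \<epsilon>_def)
    have b': "(z - 1) * d = b (Some z) * \<epsilon>"
      using arg_cong[OF b(4)[rule_format, OF zp], of "\<lambda>v. v $ 1"] by (simp add: log_factor_def d_def \<epsilon>_def algebra_simps)
    have "((z - 1) * a (Some z)) * \<epsilon> = (z * b (Some z)) * \<epsilon>" using a' b' by algebra
    then show "(z - 1) * a (Some z) = z * b (Some z)" using \<epsilon> by simp
    have "?D ei (Some z) = ?D (\<lambda>q. zpow k q *s e q) (Some z)"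
    proof (rule log_connection_restrict[OF D Y Y order_refl])
      show "(\<lambda>q. zpow k q *s e q) \<in> E (- punctures)"
        by (rule section_scale[OF E Y section_restrict[OF E openin_Compl_None Y _ e(1)] hol_fun_zpow])
          (auto simp: punctures_def)
      show "ei q = zpow k q *s e q" if "q \<in> - punctures" for q
        using that e(5) by (cases q) (auto simp: punctures_def)
    qed (use zp in auto)
    also have "\<dots> = deriv (\<lambda>x. zpow k (Some x)) z *s e (Some z) + zpow k (Some z) *s ?D e (Some z)"
      by (rule log_connection_Leibniz[OF D Y section_restrict[OF E openin_Compl_None Y _ e(1)] hol_fun_zpow])
        (use zp in \<open>auto simp: punctures_def\<close>)
    also have "deriv (\<lambda>x. zpow k (Some x)) z = of_int k * z powi k / z"
    proof -
      have "((\<lambda>x. x powi k) has_field_derivative of_int k * z powi (k - 1)) (at z)"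
        using z by (auto intro!: derivative_eq_intros)
      then show ?thesis using z by (simp add: zpow_def DERIV_imp_deriv power_int_diff)
    qed
    finally have "?D ei (Some z) $ 1 = of_int k * z powi k / z * \<epsilon> + z powi k * d"
      by (simp add: zpow_def d_def \<epsilon>_def)
    moreover have "- z * ?D ei (Some z) $ 1 = c (Some z) * (z powi k * \<epsilon>)"
      using arg_cong[OF c(4)[rule_format, OF zp], of "\<lambda>v. v $ 1"] e(5)[rule_format, OF z(1)]
      by (simp add: log_factor_def \<epsilon>_def zpow_def)
    ultimately have "- (of_int k * z powi k * \<epsilon> + z powi k * (z * d)) = c (Some z) * (z powi k * \<epsilon>)"
      using z by (simp add: field_simps)
    then have "(z powi k * \<epsilon>) * (- of_int k - a (Some z)) = (z powi k * \<epsilon>) * c (Some z)"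
      unfolding a' by (simp add: algebra_simps)
    then have "- of_int k - a (Some z) = c (Some z)" using z \<epsilon> by (simp add: power_int_eq_0_iff)
    from this[symmetric] show "a (Some z) = - c (Some z) - of_int k" by simp
  qed
  then have "Re (a (Some 0)) + Re (b (Some 1)) + Re (c None) = - of_int k"
    by (metis Re_complex_of_real of_real_minus of_real_of_int_eq plus_complex.simps(1))
  then have "- of_int k < (3::real)" "(0::real) \<le> - of_int k" using a b c by linarith+
  then show ?thesis by linarith
qed

section \<open>Pairs of sections of a plane bundle\<close>

definition pair :: "complex^2 \<Rightarrow> complex^2 \<Rightarrow> complex^2^2" where
  "pair u v = (\<chi> i j. if j = 1 then u $ i else v $ i)"

definition independent2 :: "complex^2 \<Rightarrow> complex^2 \<Rightarrow> bool" where
  "independent2 u v \<longleftrightarrow> (\<forall>a b. a *s u + b *s v = 0 \<longrightarrow> a = 0 \<and> b = 0)"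

lemma pair_mult: "pair u v *v x = x $ 1 *s u + x $ 2 *s v"
  by (simp add: pair_def vec_eq_iff matrix_vector_mult_def sum_2 mult.commute)

lemma invertible_pair:
  assumes "independent2 u v"
  shows "invertible (pair u v)"
proof -
  have "x = 0" if "pair u v *v x = 0" for x
  proof -
    have "x $ 1 = 0 \<and> x $ 2 = 0"
      using assms that unfolding pair_mult independent2_def by blast
    then show ?thesis by (simp add: vec_eq_iff forall_2)
  qed
  then obtain B where "B ** pair u v = mat 1" using matrix_left_invertible_ker[of "pair u v"] by blast
  then show ?thesis using invertible_left_inverse by blast
qed

lemma independent2_coordinates:
  assumes V: "vector_bundle V" and U: "openin P1_top U" and uv: "u \<in> V U" "v \<in> V U"
    and ind: "\<forall>q\<in>U. independent2 (u q) (v q)" and s: "s \<in> V U"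
  shows "\<exists>a b. hol_fun U a \<and> hol_fun U b \<and> (\<forall>q\<in>U. s q = a q *s u q + b q *s v q)"
proof -
  have fr: "local_frame V U (\<lambda>q. pair (u q) (v q))"
  proof (rule local_frame_of_sections[OF V U])
    fix j :: 2
    have "column j (pair (u q) (v q)) = (if j = 1 then u q else v q)" for q
      by (simp add: pair_def column_def vec_eq_iff)
    then show "(\<lambda>q. column j (pair (u q) (v q))) \<in> V U" using uv by (cases "j = 1") simp_all
  qed (use ind invertible_pair in blast)
  obtain c where c: "\<forall>i. hol_fun U (\<lambda>q. c q $ i)" "\<forall>q\<in>U. s q = pair (u q) (v q) *v c q"
    using local_frame_coordinates[OF fr U order_refl s] by (elim exE conjE)
  show ?thesis
    by (intro exI[of _ "\<lambda>q. c q $ 1"] exI[of _ "\<lambda>q. c q $ 2"]) (use c in \<open>simp add: pair_mult\<close>)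
qed

text \<open>
  Two frames with a diagonal transition matrix identify the bundle with a sum of twisting sheaves.
  Outside \<open>X\<close> the first frame is continued by means of the second one; at infinity, where \<open>zpow\<close> is
  \<open>1\<close>, the result is the second frame itself.
\<close>

lemma bundle_iso_sum_of_transition:
  fixes V :: "2 presheaf"
  assumes V: "vector_bundle V" and X: "openin P1_top X" "None \<notin> X" and Y: "openin P1_top Y" "Some 0 \<notin> Y"
    and XY: "X \<union> Y = UNIV"
    and uv: "u \<in> V X" "v \<in> V X" "\<forall>q\<in>X. independent2 (u q) (v q)"
    and uv': "u' \<in> V Y" "v' \<in> V Y" "\<forall>q\<in>Y. independent2 (u' q) (v' q)"
    and tr: "\<forall>q\<in>X \<inter> Y. u' q = zpow m q *s u q" "\<forall>q\<in>X \<inter> Y. v' q = zpow n q *s v q"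
  shows "bundle_iso V (direct_sum (twisting_sheaf m) (twisting_sheaf n))"
proof -
  have inv: "zpow (- k) q * zpow k q = 1" if "q \<in> Y" for k q
    using that Y(2) zpow_nonzero[of q k] by (metis left_inverse zpow_minus)
  define a where "a = (\<lambda>q. if q \<in> X then u q else zpow (- m) q *s u' q)"
  define b where "b = (\<lambda>q. if q \<in> X then v q else zpow (- n) q *s v' q)"
  have aX: "a q = u q" "b q = v q" if "q \<in> X" for q using that by (simp_all add: a_def b_def)
  have aY: "a q = zpow (- m) q *s u' q" "b q = zpow (- n) q *s v' q" if "q \<in> Y" for q
    using that tr inv[OF that] by (auto simp: a_def b_def vector_smult_assoc)
  have ind: "independent2 (a q) (b q)" for q
  proof (cases "q \<in> X")
    case True
    then show ?thesis using uv(3) aX by simp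
  next
    case False
    then have q: "q \<in> Y" using XY by auto
    then have "independent2 (u' q) (v' q)" using uv'(3) by simp
    moreover have "zpow (- m) q \<noteq> 0" "zpow (- n) q \<noteq> 0" using q Y(2) zpow_nonzero by metis+
    ultimately show ?thesis
      unfolding independent2_def aY[OF q] vector_smult_assoc by (metis mult_eq_0_iff)
  qed
  define \<psi> :: "P1 \<Rightarrow> complex^(1 + 1)^2" where "\<psi> = (\<lambda>q. \<chi> i j. case j of Inl _ \<Rightarrow> a q $ i | Inr _ \<Rightarrow> b q $ i)"
  define \<phi> :: "P1 \<Rightarrow> complex^2^(1 + 1)" where "\<phi> = (\<lambda>q. \<chi> i j. case i of
      Inl _ \<Rightarrow> matrix_inv (pair (a q) (b q)) $ 1 $ j | Inr _ \<Rightarrow> matrix_inv (pair (a q) (b q)) $ 2 $ j)"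
  have sum_plus: "(\<Sum>j\<in>(UNIV::(1 + 1) set). h j) = h (Inl 1) + h (Inr 1)" for h :: "1 + 1 \<Rightarrow> complex"
    by (simp add: UNIV_Plus_UNIV[symmetric] sum.Plus sum_1 del: UNIV_Plus_UNIV)
  have \<psi>_mult: "\<psi> q *v x = x $ Inl 1 *s a q + x $ Inr 1 *s b q" for q x
    by (simp add: \<psi>_def vec_eq_iff matrix_vector_mult_def sum_plus mult.commute)
  have \<phi>_mult: "(\<phi> q *v s) $ Inl 1 = (matrix_inv (pair (a q) (b q)) *v s) $ 1"
    "(\<phi> q *v s) $ Inr 1 = (matrix_inv (pair (a q) (b q)) *v s) $ 2" for q s
    by (simp_all add: \<phi>_def matrix_vector_mult_def)
  have Plus_eq: "x = y" if "x $ Inl 1 = y $ Inl 1" "x $ Inr 1 = y $ Inr 1" for x y :: "complex^(1 + 1)"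
    unfolding vec_eq_iff
  proof
    fix i :: "1 + 1"
    show "x $ i = y $ i"
    proof (cases i)
      case (Inl k)
      then show ?thesis using that num1_eq1[of k] by simp
    next
      case (Inr k)
      then show ?thesis using that num1_eq1[of k] by simp
    qed
  qed
  have \<phi>_coords: "\<phi> q *v (\<alpha> *s a q + \<beta> *s b q) = (\<chi> i. case i of Inl _ \<Rightarrow> \<alpha> | Inr _ \<Rightarrow> \<beta>)" for q \<alpha> \<beta>
  proof -
    define x :: "complex^2" where "x = (\<chi> i. if i = 1 then \<alpha> else \<beta>)"
    have "\<alpha> *s a q + \<beta> *s b q = pair (a q) (b q) *v x" by (simp add: pair_mult x_def)
    then have "matrix_inv (pair (a q) (b q)) *v (\<alpha> *s a q + \<beta> *s b q) = x"
      using invertible_solve(2)[OF invertible_pair[OF ind]] by simp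
    then show ?thesis by (intro Plus_eq) (simp_all add: \<phi>_mult x_def)
  qed
  have \<psi>\<phi>: "\<psi> q *v (\<phi> q *v s) = s" for q s
  proof -
    have "\<psi> q *v (\<phi> q *v s) = pair (a q) (b q) *v (matrix_inv (pair (a q) (b q)) *v s)"
      by (simp add: \<psi>_mult \<phi>_mult pair_mult)
    then show ?thesis using invertible_solve(1)[OF invertible_pair[OF ind]] by simp
  qed
  have \<phi>\<psi>: "\<phi> q *v (\<psi> q *v x) = x" for q x
    unfolding \<psi>_mult \<phi>_coords by (rule Plus_eq) simp_all
  have hom\<psi>: "bundle_hom (direct_sum (twisting_sheaf m) (twisting_sheaf n)) V \<psi>"
    unfolding bundle_hom_def
  proof (intro allI impI, elim conjE)
    fix U s assume U: "openin P1_top U" and s: "s \<in> direct_sum (twisting_sheaf m) (twisting_sheaf n) U"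
    have h: "hol_fun (U - {None}) (\<lambda>q. s q $ Inl 1)" "hol_fun (U - {Some 0}) (\<lambda>q. zpow (- m) q * s q $ Inl 1)"
      "hol_fun (U - {None}) (\<lambda>q. s q $ Inr 1)" "hol_fun (U - {Some 0}) (\<lambda>q. zpow (- n) q * s q $ Inr 1)"
      using s unfolding direct_sum_def mem_Collect_eq twisting_sheaf_iff by simp_all
    have UX: "openin P1_top (U \<inter> X)" and UY: "openin P1_top (U \<inter> Y)" using U X(1) Y(1) by (simp_all add: openin_Int)
    have "(\<lambda>q. s q $ Inl 1 *s u q + s q $ Inr 1 *s v q) \<in> V (U \<inter> X)"
      by (rule section_combination[OF V UX section_restrict[OF V X(1) UX _ uv(1)] section_restrict[OF V X(1) UX _ uv(2)]
            hol_fun_subset[OF h(1)] hol_fun_subset[OF h(3)]]) (use X(2) in auto)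
    then have 1: "(\<lambda>q. \<psi> q *v s q) \<in> V (U \<inter> X)"
      by (rule section_cong[OF V UX]) (simp add: \<psi>_mult aX)
    have "(\<lambda>q. (zpow (- m) q * s q $ Inl 1) *s u' q + (zpow (- n) q * s q $ Inr 1) *s v' q) \<in> V (U \<inter> Y)"
      by (rule section_combination[OF V UY section_restrict[OF V Y(1) UY _ uv'(1)] section_restrict[OF V Y(1) UY _ uv'(2)]
            hol_fun_subset[OF h(2)] hol_fun_subset[OF h(4)]]) (use Y(2) in auto)
    then have 2: "(\<lambda>q. \<psi> q *v s q) \<in> V (U \<inter> Y)"
      by (rule section_cong[OF V UY]) (simp add: \<psi>_mult aY vector_smult_assoc mult.commute)
    have "U \<inter> X \<union> U \<inter> Y = U" using XY by blast
    then show "(\<lambda>q. \<psi> q *v s q) \<in> V U" using section_Union[OF V UX UY 1 2] by simp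
  qed
  have hom\<phi>: "bundle_hom V (direct_sum (twisting_sheaf m) (twisting_sheaf n)) \<phi>"
    unfolding bundle_hom_def
  proof (intro allI impI, elim conjE)
    fix U s assume U: "openin P1_top U" and s: "s \<in> V U"
    define x where "x = (\<lambda>q. (\<phi> q *v s q) $ Inl 1)"
    define y where "y = (\<lambda>q. (\<phi> q *v s q) $ Inr 1)"
    have UX: "openin P1_top (U \<inter> X)" and UY: "openin P1_top (U \<inter> Y)" using U X(1) Y(1) by (simp_all add: openin_Int)
    obtain c d where cd: "hol_fun (U \<inter> X) c" "hol_fun (U \<inter> X) d" "\<forall>q\<in>U \<inter> X. s q = c q *s u q + d q *s v q"
      using independent2_coordinates[OF V UX section_restrict[OF V X(1) UX _ uv(1)] section_restrict[OF V X(1) UX _ uv(2)]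
          _ section_restrict[OF V U UX _ s]] uv(3) by auto
    obtain c' d' where cd': "hol_fun (U \<inter> Y) c'" "hol_fun (U \<inter> Y) d'" "\<forall>q\<in>U \<inter> Y. s q = c' q *s u' q + d' q *s v' q"
      using independent2_coordinates[OF V UY section_restrict[OF V Y(1) UY _ uv'(1)] section_restrict[OF V Y(1) UY _ uv'(2)]
          _ section_restrict[OF V U UY _ s]] uv'(3) by auto
    have xX: "x q = c q" "y q = d q" if "q \<in> U \<inter> X" for q
      using cd(3) that \<phi>_coords[of q "c q" "d q"] aX[of q] by (simp_all add: x_def y_def)
    have u'Y: "u' q = zpow m q *s a q" "v' q = zpow n q *s b q" if "q \<in> Y" for q
      using aY[OF that] inv[OF that] by (simp_all add: vector_smult_assoc mult.commute)
    have xY: "x q = c' q * zpow m q" "y q = d' q * zpow n q" if "q \<in> U \<inter> Y" for q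
      using cd'(3) that \<phi>_coords[of q "c' q * zpow m q" "d' q * zpow n q"] u'Y[of q]
      by (simp_all add: x_def y_def vector_smult_assoc)
    have tw: "(\<lambda>q. \<chi> i. z q) \<in> twisting_sheaf k U"
      if e: "hol_fun (U \<inter> X) e" "hol_fun (U \<inter> Y) e'" "\<forall>q\<in>U \<inter> X. z q = e q" "\<forall>q\<in>U \<inter> Y. z q = e' q * zpow k q"
      for z e e' :: "P1 \<Rightarrow> complex" and k
      unfolding twisting_sheaf_iff
    proof
      have zX: "hol_fun (U \<inter> X) z" using hol_fun_cong[of "U \<inter> X" z e] e by simp
      have "hol_fun (U \<inter> Y - {None}) (\<lambda>q. e' q * zpow k q)"
        by (rule hol_fun_mult[OF hol_fun_subset[OF e(2)] hol_fun_zpow]) (use Y(2) in auto)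
      then have zY: "hol_fun (U \<inter> Y - {None}) z" using hol_fun_cong[of "U \<inter> Y - {None}" z] e(4) by simp
      have "hol_fun (U - {None}) z"
      proof (rule hol_fun_local)
        fix p assume p: "p \<in> U - {None}"
        show "\<exists>W. openin P1_top W \<and> p \<in> W \<and> hol_fun W z"
        proof (cases "p \<in> X")
          case True
          then show ?thesis using p UX zX by (intro exI[of _ "U \<inter> X"]) simp
        next
          case False
          then have "p \<in> Y" using XY by auto
          then show ?thesis using p openin_P1_Diff_finite[OF UY] zY by (intro exI[of _ "U \<inter> Y - {None}"]) simp
        qed
      qed
      then show "hol_fun (U - {None}) (\<lambda>q. (\<chi> i. z q) $ (1::1))" by simp
      have "hol_fun (U \<inter> X - {Some 0}) (\<lambda>q. zpow (- k) q * z q)"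
        by (rule hol_fun_mult[OF hol_fun_zpow hol_fun_subset[OF zX]]) (use X(2) in auto)
      moreover have "hol_fun (U \<inter> Y) (\<lambda>q. zpow (- k) q * z q)"
      proof -
        have "zpow (- k) q * z q = e' q" if "q \<in> U \<inter> Y" for q
          using e(4) that inv[of q k] by (simp add: mult.left_commute)
        then show ?thesis using hol_fun_cong[of "U \<inter> Y" "\<lambda>q. zpow (- k) q * z q" e'] e(2) by simp
      qed
      ultimately have zz: "hol_fun (U \<inter> X - {Some 0}) (\<lambda>q. zpow (- k) q * z q)"
        "hol_fun (U \<inter> Y) (\<lambda>q. zpow (- k) q * z q)" .
      have "hol_fun (U - {Some 0}) (\<lambda>q. zpow (- k) q * z q)"
      proof (rule hol_fun_local)
        fix p assume p: "p \<in> U - {Some 0}"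
        show "\<exists>W. openin P1_top W \<and> p \<in> W \<and> hol_fun W (\<lambda>q. zpow (- k) q * z q)"
        proof (cases "p \<in> X")
          case True
          then show ?thesis using p openin_P1_Diff_finite[OF UX] zz(1) by (intro exI[of _ "U \<inter> X - {Some 0}"]) simp
        next
          case False
          then have "p \<in> Y" using XY by auto
          then show ?thesis using p UY zz(2) by (intro exI[of _ "U \<inter> Y"]) simp
        qed
      qed
      then show "hol_fun (U - {Some 0}) (\<lambda>q. zpow (- k) q * (\<chi> i. z q) $ (1::1))" by simp
    qed
    have "(\<lambda>q. \<chi> i. x q) \<in> twisting_sheaf m U" "(\<lambda>q. \<chi> i. y q) \<in> twisting_sheaf n U"
      using tw[OF cd(1) cd'(1)] tw[OF cd(2) cd'(2)] xX xY by simp_all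
    moreover have "(\<chi> i. (\<phi> q *v s q) $ Inl i) = (\<chi> i. x q)" "(\<chi> i. (\<phi> q *v s q) $ Inr i) = (\<chi> i. y q)" for q
      by (simp_all add: vec_eq_iff forall_1 x_def y_def)
    ultimately show "(\<lambda>q. \<phi> q *v s q) \<in> direct_sum (twisting_sheaf m) (twisting_sheaf n) U"
      unfolding direct_sum_def mem_Collect_eq by simp
  qed
  have "\<phi> q ** \<psi> q = mat 1 \<and> \<psi> q ** \<phi> q = mat 1" for q
    unfolding matrix_eq using \<phi>\<psi> \<psi>\<phi> by (simp add: matrix_vector_mul_assoc[symmetric])
  then show ?thesis unfolding bundle_iso_def using hom\<phi> hom\<psi> by (intro exI[of _ \<phi>] exI[of _ \<psi>]) simp
qed

section \<open>Lifting a generator of the quotient\<close>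

locale plane_extension =
  fixes V' V'' :: "1 presheaf" and V :: "2 presheaf"
    and f :: "P1 \<Rightarrow> complex^1^2" and g :: "P1 \<Rightarrow> complex^2^1"
  assumes V': "vector_bundle V'" and V: "vector_bundle V" and V'': "vector_bundle V''"
    and exact: "bundle_short_exact V' V V'' f g"
begin

lemma f_section: "openin P1_top U \<Longrightarrow> s \<in> V' U \<Longrightarrow> (\<lambda>q. f q *v s q) \<in> V U"
  and g_section: "openin P1_top U \<Longrightarrow> t \<in> V U \<Longrightarrow> (\<lambda>q. g q *v t q) \<in> V'' U"
  using exact unfolding bundle_short_exact_def bundle_hom_def by simp_all

lemma fibre_exact: "exact_maps (f q) (g q)"
  using exact unfolding bundle_short_exact_def by (elim conjE) (rule spec)

lemma f_eq_0: "f q *v x = 0 \<longleftrightarrow> x = 0"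
proof
  have "inj ((*v) (f q))" using fibre_exact unfolding exact_maps_def by (rule conjunct1)
  then show "x = 0" if "f q *v x = 0" using that by (metis injD matrix_vector_mult_0_right)
qed simp

lemma g_f: "g q *v (f q *v x) = 0"
proof -
  have "range ((*v) (f q)) = {v. g q *v v = 0}"
    using fibre_exact[of q] unfolding exact_maps_def by (elim conjE)
  then show ?thesis by blast
qed

lemma lift_independent:
  assumes "e' \<noteq> 0" "g q *v s \<noteq> 0"
  shows "independent2 (f q *v e') s"
  unfolding independent2_def
proof (intro allI impI)
  fix a b assume ab: "a *s (f q *v e') + b *s s = 0"
  then have "g q *v (a *s (f q *v e') + b *s s) = 0" by simp
  then have "b *s (g q *v s) = 0"
    by (simp add: matrix_vector_right_distrib vector_scalar_commute g_f)
  then have "b = 0" using assms by simp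
  then show "a = 0 \<and> b = 0" using ab assms by (simp add: f_eq_0)
qed

text \<open>
  The lift \<open>s\<close> and the generator of the subbundle form a frame; in this frame the second coordinate of
  \<open>t\<close> is read off from its image in the quotient.
\<close>

lemma lift_difference:
  assumes U: "openin P1_top U" and e': "e' \<in> V' U" "\<forall>q\<in>U. e' q \<noteq> 0" and e'': "\<forall>q\<in>U. e'' q \<noteq> 0"
    and s: "s \<in> V U" "\<forall>q\<in>U. g q *v s q = e'' q" and t: "t \<in> V U" "\<forall>q\<in>U. g q *v t q = e'' q"
  shows "\<exists>h. hol_fun U h \<and> (\<forall>q\<in>U. t q = s q + h q *s (f q *v e' q))"
proof -
  have ind: "\<forall>q\<in>U. independent2 (f q *v e' q) (s q)"
    using e' e'' s(2) lift_independent by simp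
  obtain a b where ab: "hol_fun U a" "hol_fun U b" "\<forall>q\<in>U. t q = a q *s (f q *v e' q) + b q *s s q"
    using independent2_coordinates[OF V U f_section[OF U e'(1)] s(1) ind t(1)] by (elim exE conjE)
  have "t q = s q + a q *s (f q *v e' q)" if q: "q \<in> U" for q
  proof -
    have "e'' q = g q *v (a q *s (f q *v e' q) + b q *s s q)" using t(2) ab(3) q by metis
    also have "\<dots> = b q *s e'' q"
      using s(2) q by (simp add: matrix_vector_right_distrib vector_scalar_commute g_f)
    finally have "(b q - 1) *s e'' q = 0" by (simp add: vector_sub_rdistrib)
    then have "b q - 1 = 0 \<or> e'' q = 0" by (simp only: vector_mul_eq_0)
    then have "b q = 1" using e'' q by auto
    then show ?thesis using ab(3) q by (simp add: add.commute)
  qed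
  then show ?thesis using ab(1) by (intro exI[of _ a]) simp
qed

text \<open>
  The map to the quotient is onto at \<open>p\<close>, so some vector of a frame has nonzero image at \<open>p\<close> and can
  be normalised near \<open>p\<close>.
\<close>

lemma local_lift:
  assumes U: "openin P1_top U" and p: "p \<in> U" and e'': "e'' \<in> V'' U" "\<forall>q\<in>U. e'' q \<noteq> 0"
  shows "\<exists>W s. openin P1_top W \<and> p \<in> W \<and> W \<subseteq> U \<and> s \<in> V W \<and> (\<forall>q\<in>W. g q *v s q = e'' q)"
proof -
  obtain W e where W: "openin P1_top W" "p \<in> W" "W \<subseteq> U" and e: "local_frame V W e"
    by (rule vector_bundle_frame[OF V U p])
  have sec: "(\<lambda>q. column j (e q)) \<in> V W" for j by (rule local_frame_column[OF e W(1) order_refl])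
  have e''W: "e'' \<in> V'' W" "\<forall>q\<in>W. e'' q \<noteq> 0"
    using section_restrict[OF V'' U W(1,3) e''(1)] e''(2) W(3) by auto
  have "\<exists>c. hol_fun W c \<and> (\<forall>q\<in>W. g q *v column j (e q) = c q *s e'' q)" for j
    by (rule line_bundle_coordinate[OF V'' W(1) e''W g_section[OF W(1) sec]])
  then obtain c where c: "\<And>j. hol_fun W (c j)" "\<And>j q. q \<in> W \<Longrightarrow> g q *v column j (e q) = c j q *s e'' q"
    by metis
  have "\<exists>j. c j p \<noteq> 0"
  proof (rule ccontr)
    assume "\<not> ?thesis"
    then have z: "g p *v column j (e p) = 0" for j using c(2)[OF W(2)] by simp
    have "g p *v x = 0" for x
    proof -
      have "invertible (e p)" using e W(2) unfolding local_frame_def by simp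
      then have "x = e p *v (matrix_inv (e p) *v x)" using invertible_solve(1) by metis
      also have "\<dots> = (\<Sum>j\<in>UNIV. (matrix_inv (e p) *v x) $ j *s column j (e p))"
        by (rule matrix_vector_mult_columns)
      finally have x: "x = (\<Sum>j\<in>UNIV. (matrix_inv (e p) *v x) $ j *s column j (e p))" .
      have "g p *v (\<Sum>j\<in>UNIV. (matrix_inv (e p) *v x) $ j *s column j (e p)) = 0"
        by (simp add: sum_2 matrix_vector_right_distrib vector_scalar_commute z)
      then show ?thesis by (subst x)
    qed
    moreover have "surj ((*v) (g p))" using fibre_exact[of p] unfolding exact_maps_def by (elim conjE)
    ultimately have "e'' p = 0" by (metis surjD)
    then show False using e''W(2) W(2) by simp
  qed
  then obtain j where j: "c j p \<noteq> 0" by blast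
  define X where "X = {q \<in> W. c j q \<noteq> 0}"
  have X: "openin P1_top X" unfolding X_def by (rule hol_fun_nonzero_open[OF W(1) c(1)])
  have XW: "X \<subseteq> W" by (auto simp: X_def)
  have "hol_fun X (\<lambda>q. 1 / c j q)"
    by (rule hol_fun_divide[OF hol_fun_const hol_fun_subset[OF c(1) XW]]) (simp add: X_def)
  then have "(\<lambda>q. (1 / c j q) *s column j (e q)) \<in> V X"
    by (rule section_scale[OF V X section_restrict[OF V W(1) X XW sec]])
  moreover have "\<forall>q\<in>X. g q *v ((1 / c j q) *s column j (e q)) = e'' q"
    using c(2) by (simp add: X_def vector_scalar_commute vector_smult_assoc)
  ultimately show ?thesis
    using X XW W j by (intro exI[of _ X] exI[of _ "\<lambda>q. (1 / c j q) *s column j (e q)"]) (auto simp: X_def)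
qed

text \<open>
  Translates functions on the affine line into sections; the value at infinity is a dummy, because the
  result is only considered over subsets of the affine line.
\<close>

definition extend :: "(complex \<Rightarrow> complex^2) \<Rightarrow> P1 \<Rightarrow> complex^2" where
  "extend s q = (case q of Some z \<Rightarrow> s z | None \<Rightarrow> 0)"

lemma extend_Some [simp]: "extend s (Some z) = s z"
  by (simp add: extend_def)

definition is_lift :: "(P1 \<Rightarrow> complex^1) \<Rightarrow> complex set \<Rightarrow> (complex \<Rightarrow> complex^2) \<Rightarrow> bool" where
  "is_lift e'' U s \<longleftrightarrow> extend s \<in> V (Some ` U) \<and> (\<forall>z\<in>U. g (Some z) *v s z = e'' (Some z))"

lemma is_lift_torsor:
  assumes e': "e' \<in> V' (- {None})" "\<forall>q. e' q \<noteq> 0" and e'': "e'' \<in> V'' (- {None})" "\<forall>q. e'' q \<noteq> 0"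
  shows "holomorphic_torsor (is_lift e'') (\<lambda>z. f (Some z) *v e' (Some z))"
proof
  let ?k = "\<lambda>z. f (Some z) *v e' (Some z)"
  have op: "openin P1_top (Some ` U)" if "open U" for U using that by (simp add: openin_P1_Some_image)
  have e'U: "e' \<in> V' (Some ` U)" if "open U" for U
    by (rule section_restrict[OF V' openin_Compl_None op[OF that] _ e'(1)]) auto
  fix U :: "complex set" and s t assume U: "open U"
  {
    fix h assume s: "is_lift e'' U s" and h: "h holomorphic_on U"
    define hh where "hh = (\<lambda>q. case q of Some z \<Rightarrow> h z | None \<Rightarrow> 0)"
    have "{z. Some z \<in> Some ` U} = U" by auto
    then have "hol_fun (Some ` U) hh" using h hol_fun_Some_iff[of "Some ` U" hh] by (auto simp: hh_def)
    then have "(\<lambda>q. 1 *s extend s q + hh q *s (f q *v e' q)) \<in> V (Some ` U)"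
      using s f_section[OF op[OF U] e'U[OF U]] unfolding is_lift_def
      by (intro section_combination[OF V op[OF U]] hol_fun_const) simp_all
    then have "extend (\<lambda>z. s z + h z *s ?k z) \<in> V (Some ` U)"
      by (rule section_cong[OF V op[OF U]]) (auto simp: extend_def hh_def)
    then show "is_lift e'' U (\<lambda>z. s z + h z *s ?k z)"
      using s unfolding is_lift_def by (simp add: matrix_vector_right_distrib vector_scalar_commute g_f)
  next
    assume s: "is_lift e'' U s" and t: "is_lift e'' U t"
    have "\<exists>h. hol_fun (Some ` U) h \<and> (\<forall>q\<in>Some ` U. extend t q = extend s q + h q *s (f q *v e' q))"
      by (rule lift_difference[OF op[OF U] e'U[OF U], where e'' = e''])
        (use s t e' e'' in \<open>auto simp: is_lift_def\<close>)
    then obtain h where h: "hol_fun (Some ` U) h"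
      "\<forall>q\<in>Some ` U. extend t q = extend s q + h q *s (f q *v e' q)" by (elim exE conjE)
    have "{z. Some z \<in> Some ` U} = U" by auto
    then have "(\<lambda>z. h (Some z)) holomorphic_on U" using h(1) unfolding hol_fun_def by simp
    then show "\<exists>h. h holomorphic_on U \<and> (\<forall>z\<in>U. t z = s z + h z *s ?k z)"
      using h(2) by (intro exI[of _ "\<lambda>z. h (Some z)"]) (simp add: extend_def)
  next
    fix W assume W: "open W" and "W \<subseteq> U" and s: "is_lift e'' U s"
    then have "extend s \<in> V (Some ` W)"
      using section_restrict[OF V op[OF U] op[OF W]] unfolding is_lift_def by (simp add: image_mono)
    then show "is_lift e'' W s" using s \<open>W \<subseteq> U\<close> unfolding is_lift_def by auto
  next
    fix W assume W: "open W" and s: "is_lift e'' U s" and t: "is_lift e'' W t"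
      and st: "\<forall>z\<in>U \<inter> W. s z = t z"
    let ?u = "\<lambda>z. if z \<in> U then s z else t z"
    have "extend ?u \<in> V (Some ` U)"
      by (rule section_cong[OF V op[OF U], of "extend s"]) (use s in \<open>auto simp: is_lift_def\<close>)
    moreover have "extend ?u \<in> V (Some ` W)"
      by (rule section_cong[OF V op[OF W], of "extend t"]) (use t st in \<open>auto simp: is_lift_def\<close>)
    ultimately have "extend ?u \<in> V (Some ` U \<union> Some ` W)"
      by (rule section_Union[OF V op[OF U] op[OF W]])
    then have "extend ?u \<in> V (Some ` (U \<union> W))" by (simp only: image_Un)
    then show "is_lift e'' (U \<union> W) ?u" using s t unfolding is_lift_def by auto
  }
next
  fix z :: complex
  have "Some z \<in> - {None}" by simp
  from local_lift[OF openin_Compl_None this e''(1)] obtain W s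
    where W: "openin P1_top W" "Some z \<in> W" "W \<subseteq> - {None}" "s \<in> V W" "\<forall>q\<in>W. g q *v s q = e'' q"
    using e''(2) by auto
  define A where "A = {z. Some z \<in> W}"
  have WA: "W = Some ` A" unfolding A_def
  proof
    show "W \<subseteq> Some ` {z. Some z \<in> W}"
    proof
      fix q assume "q \<in> W"
      then show "q \<in> Some ` {z. Some z \<in> W}" using W(3) by (cases q) auto
    qed
  qed auto
  have "extend (\<lambda>z. s (Some z)) \<in> V W"
    by (rule section_cong[OF V W(1,4)]) (auto simp: WA extend_def)
  then have "is_lift e'' A (\<lambda>z. s (Some z))"
    unfolding is_lift_def using W(5) WA by auto
  moreover have "open A" unfolding A_def by (rule open_Some_preimage[OF W(1)])
  ultimately show "\<exists>U s. open U \<and> z \<in> U \<and> is_lift e'' U s"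
    using W(2) A_def by auto
qed

lemma lift_on_ball:
  assumes "e' \<in> V' (- {None})" "\<forall>q. e' q \<noteq> 0" "e'' \<in> V'' (- {None})" "\<forall>q. e'' q \<noteq> 0"
  shows "\<exists>s. s \<in> V (Some ` ball 0 r) \<and> (\<forall>q\<in>Some ` ball 0 r. g q *v s q = e'' q)"
proof -
  obtain s where "is_lift e'' (ball 0 r) s"
    using holomorphic_torsor.exists_on_ball[OF is_lift_torsor[OF assms], of r] by (elim exE)
  then show ?thesis unfolding is_lift_def
    by (intro exI[of _ "extend s"]) (auto simp: extend_def)
qed

text \<open>
  Write \<open>k\<close> for the image of \<open>e'\<close> in \<open>V\<close> and \<open>d = a - b\<close>.  A lift near infinity may be changed by
  holomorphic multiples of \<open>z powi a\<close> times \<open>k\<close>, and in terms of lifts of \<open>e''\<close> these are the multiples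
  of \<open>k\<close> by functions of order at most \<open>d\<close> in \<open>z\<close> at infinity.  As \<open>d \<ge> -2\<close>, they include
  \<open>z powi j\<close> for all \<open>j \<le> -2\<close>, and they include \<open>1 / z\<close> if \<open>d \<ge> -1\<close>.
\<close>

lemma normal_form:
  assumes e': "e' \<in> V' (- {None})" "e'i \<in> V' (- {Some 0})" "\<forall>q. e' q \<noteq> 0"
      "\<forall>q. q \<noteq> Some 0 \<longrightarrow> e'i q \<noteq> 0" "\<forall>z. z \<noteq> 0 \<longrightarrow> e'i (Some z) = zpow a (Some z) *s e' (Some z)"
    and e'': "e'' \<in> V'' (- {None})" "e''i \<in> V'' (- {Some 0})" "\<forall>q. e'' q \<noteq> 0"
      "\<forall>q. q \<noteq> Some 0 \<longrightarrow> e''i q \<noteq> 0" "\<forall>z. z \<noteq> 0 \<longrightarrow> e''i (Some z) = zpow b (Some z) *s e'' (Some z)"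
    and ab: "a - b \<ge> - 2"
  shows "\<exists>X Y s si c. openin P1_top X \<and> None \<notin> X \<and> openin P1_top Y \<and> Some 0 \<notin> Y \<and> X \<union> Y = UNIV \<and>
    s \<in> V X \<and> (\<forall>q\<in>X. g q *v s q = e'' q) \<and> si \<in> V Y \<and> (\<forall>q\<in>Y. g q *v si q = e''i q) \<and>
    (a - b \<ge> - 1 \<longrightarrow> c = 0) \<and>
    (\<forall>z. Some z \<in> X \<inter> Y \<longrightarrow> si (Some z) =
      zpow b (Some z) *s (s (Some z) - (c / z) *s (f (Some z) *v e' (Some z))))"
proof -
  have "None \<in> - {Some 0}" by simp
  from local_lift[OF openin_Compl_0 this e''(2)] obtain W t
    where W: "openin P1_top W" "None \<in> W" "W \<subseteq> - {Some 0}" "t \<in> V W" "\<forall>q\<in>W. g q *v t q = e''i q"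
    using e''(4) by auto
  obtain \<rho> where \<rho>: "\<rho> > 0" "chart None ` ball 0 \<rho> \<subseteq> W" by (rule chart_in_open[OF W(1,2)])
  define r where "r = 1 / \<rho>"
  have r: "r > 0" "\<rho> = 1 / r" using \<rho> by (simp_all add: r_def)
  define R where "R = r + 1"
  obtain s0 where s0: "s0 \<in> V (Some ` ball 0 R)" "\<forall>q\<in>Some ` ball 0 R. g q *v s0 q = e'' q"
    using lift_on_ball[OF e'(1,3) e''(1,3), of R] by (elim exE conjE)
  define A where "A = {z::complex. r < norm z \<and> norm z < R}"
  have oA: "open A" unfolding A_def
    by (intro open_Collect_conj open_Collect_less continuous_intros)
  then have A: "openin P1_top (Some ` A)" by (simp add: openin_P1_Some_image)
  have B: "openin P1_top (Some ` ball 0 R)" by (simp add: openin_P1_Some_image)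
  have AW: "Some ` A \<subseteq> W"
  proof
    fix q assume "q \<in> Some ` A"
    then obtain z where "q = Some z" "r < norm z" by (auto simp: A_def)
    then show "q \<in> W" using Some_in_chart_inf_ball[OF r(1), of z] \<rho>(2) r(2) by blast
  qed
  have A0: "z \<noteq> 0" if "z \<in> A" for z using that r by (auto simp: A_def)
  have zinv: "zpow (- n) (Some z) * zpow n (Some z) = 1" if "z \<noteq> 0" for n z
    using that zpow_nonzero[of "Some z" n] by (simp add: zpow_minus)
  have "hol_fun (Some ` A) (zpow (- b))" by (rule hol_fun_zpow) (use A0 in auto)
  then have "(\<lambda>q. zpow (- b) q *s t q) \<in> V (Some ` A)"
    by (rule section_scale[OF V A section_restrict[OF V W(1) A AW W(4)]])
  moreover have "\<forall>q\<in>Some ` A. g q *v (zpow (- b) q *s t q) = e'' q"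
  proof
    fix q assume q: "q \<in> Some ` A"
    then obtain z where z: "q = Some z" "z \<noteq> 0" using A0 by auto
    have "g q *v (zpow (- b) q *s t q) = zpow (- b) q *s e''i q"
      using W(5) q AW by (auto simp: vector_scalar_commute)
    then show "g q *v (zpow (- b) q *s t q) = e'' q"
      using e''(5) z zinv[OF z(2)] by (simp add: vector_smult_assoc)
  qed
  moreover have "s0 \<in> V (Some ` A)"
    by (rule section_restrict[OF V B A _ s0(1)]) (auto simp: A_def)
  moreover have "\<forall>q\<in>Some ` A. g q *v s0 q = e'' q" using s0(2) by (auto simp: A_def)
  moreover have "e' \<in> V' (Some ` A)"
    by (rule section_restrict[OF V' openin_Compl_None A _ e'(1)]) auto
  ultimately have "\<exists>h. hol_fun (Some ` A) h \<and>
      (\<forall>q\<in>Some ` A. s0 q = zpow (- b) q *s t q + h q *s (f q *v e' q))"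
    using lift_difference[OF A, of e' e'' "\<lambda>q. zpow (- b) q *s t q" s0] e'(3) e''(3) by simp
  then obtain h where h: "hol_fun (Some ` A) h"
      "\<forall>q\<in>Some ` A. s0 q = zpow (- b) q *s t q + h q *s (f q *v e' q)" by (elim exE conjE)
  have "{z. Some z \<in> Some ` A} = A" by auto
  then have "(\<lambda>z. h (Some z)) holomorphic_on A" using h(1) unfolding hol_fun_def by simp
  then have hA: "(\<lambda>z. h (Some z)) holomorphic_on {z. r < norm z \<and> norm z < R}" unfolding A_def .
  have rR: "0 \<le> r" "r < R" using r(1) by (simp_all add: R_def)
  obtain l c0 G r' R' where lG: "r < r'" "r' < R'" "R' < R" "l holomorphic_on ball 0 R'"
    "G holomorphic_on ball 0 (1 / r')"
    "\<forall>z. r' < norm z \<longrightarrow> norm z < R' \<longrightarrow> h (Some z) = l z + c0 / z + G (1 / z) / z ^ 2"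
    using annulus_split[OF hA rR] by metis
  have r'0: "r' > 0" using lG(1) r(1) by simp
  define X where "X = Some ` ball (0::complex) R'"
  define Y where "Y = chart None ` ball 0 (1 / r')"
  have X: "openin P1_top X" "None \<notin> X" by (auto simp: X_def openin_P1_Some_image)
  have Y: "openin P1_top Y" unfolding Y_def using r'0 by (intro openin_chart_ball) simp
  have SY: "Some z \<in> Y \<longleftrightarrow> r' < norm z" for z unfolding Y_def by (rule Some_in_chart_inf_ball[OF r'0])
  have NY: "None \<in> Y" unfolding Y_def using r'0 by (intro image_eqI[of _ _ 0]) simp_all
  have Y0: "Some 0 \<notin> Y" using SY[of 0] r'0 by simp
  have YW: "Y \<subseteq> W"
  proof
    fix q assume "q \<in> Y"
    then show "q \<in> W"
      using W(2) SY Some_in_chart_inf_ball[OF r(1)] lG(1) \<rho>(2) r(2) by (cases q) fastforce+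
  qed
  have XB: "X \<subseteq> Some ` ball 0 R" using lG(3) by (auto simp: X_def)
  have XY: "X \<union> Y = UNIV"
  proof -
    have "q \<in> X \<union> Y" for q
    proof (cases q)
      case (Some z)
      then show ?thesis using SY[of z] lG(2) by (cases "norm z < R'") (auto simp: X_def)
    qed (use NY in simp)
    then show ?thesis by auto
  qed
  define d where "d = a - b"
  define c where "c = (if d \<ge> - 1 then 0 else c0)"
  \<comment> \<open>The correction of the lift at infinity, as a function of \<open>w = 1 / z\<close>.\<close>
  define H where "H = (\<lambda>w. w ^ nat (d + int 2) * G w + (if d \<ge> - 1 then c0 * w ^ nat (d + int 1) else 0))"
  define Hq where "Hq = (\<lambda>q. case q of Some z \<Rightarrow> H (1 / z) | None \<Rightarrow> H 0)"
  define lq where "lq = (\<lambda>q. case q of Some z \<Rightarrow> l z | None \<Rightarrow> 0)"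
  have lq: "hol_fun X lq"
  proof -
    have "{z. Some z \<in> X} = ball 0 R'" by (auto simp: X_def)
    then show ?thesis unfolding hol_fun_Some_iff[OF X(2)] using lG(4) by (simp add: lq_def)
  qed
  have Hq: "hol_fun Y Hq"
  proof -
    have "{w. chart_inf w \<in> Y} \<subseteq> ball 0 (1 / r')"
    proof
      fix w assume "w \<in> {w. chart_inf w \<in> Y}"
      then obtain w' where "norm w' < 1 / r'" "chart_inf w = chart_inf w'" by (auto simp: Y_def chart_def)
      then show "w \<in> ball 0 (1 / r')" by (auto simp: chart_inf_def split: if_splits)
    qed
    moreover have "H holomorphic_on ball 0 (1 / r')"
      unfolding H_def by (cases "d \<ge> - 1") (auto intro!: holomorphic_intros lG(5))
    moreover have "Hq (chart_inf w) = H w" for w by (simp add: Hq_def chart_inf_def)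
    ultimately show ?thesis unfolding hol_fun_inf_iff[OF Y0] using holomorphic_on_subset by simp
  qed
  define s where "s = (\<lambda>q. 1 *s s0 q + (- lq q) *s (f q *v e' q))"
  define si where "si = (\<lambda>q. 1 *s t q + Hq q *s (f q *v e'i q))"
  have e'X: "e' \<in> V' X" by (rule section_restrict[OF V' openin_Compl_None X(1) _ e'(1)]) (use X(2) in auto)
  have e'iY: "e'i \<in> V' Y" by (rule section_restrict[OF V' openin_Compl_0 Y _ e'(2)]) (use Y0 in auto)
  have sX: "s \<in> V X" unfolding s_def
    by (rule section_combination[OF V X(1) section_restrict[OF V B X(1) XB s0(1)] f_section[OF X(1) e'X]
          hol_fun_const hol_fun_minus[OF lq]])
  have siY: "si \<in> V Y" unfolding si_def
    by (rule section_combination[OF V Y section_restrict[OF V W(1) Y YW W(4)] f_section[OF Y e'iY]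
          hol_fun_const Hq])
  have gs: "\<forall>q\<in>X. g q *v s q = e'' q"
    using s0(2) XB by (auto simp: s_def matrix_vector_right_distrib matrix_vector_mult_diff_distrib
        vector_scalar_commute g_f)
  have gsi: "\<forall>q\<in>Y. g q *v si q = e''i q"
    using W(5) YW by (auto simp: si_def matrix_vector_right_distrib vector_scalar_commute g_f)
  have tr: "si (Some z) = zpow b (Some z) *s (s (Some z) - (c / z) *s (f (Some z) *v e' (Some z)))"
    if z: "Some z \<in> X \<inter> Y" for z
  proof -
    let ?q = "Some z" and ?k = "f (Some z) *v e' (Some z)"
    have n: "r' < norm z" "norm z < R'" using z SY[of z] by (auto simp: X_def)
    have z0: "z \<noteq> 0" using n r'0 by auto
    have zA: "?q \<in> Some ` A" using n lG by (auto simp: A_def)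
    have t: "t ?q = zpow b ?q *s (s0 ?q - h ?q *s ?k)"
    proof -
      have "s0 ?q - h ?q *s ?k = zpow (- b) ?q *s t ?q" using bspec[OF h(2) zA] by simp
      then show ?thesis using zinv[OF z0, of b] by (simp add: vector_smult_assoc mult.commute)
    qed
    have zd: "zpow a ?q = zpow b ?q * zpow d ?q"
      using z0 by (simp add: zpow_def d_def power_int_diff)
    have key: "h ?q - zpow d ?q * H (1 / z) = l z + c / z"
    proof -
      have "zpow d ?q * H (1 / z) = G (1 / z) / z ^ 2 + (if d \<ge> - 1 then c0 / z else 0)"
      proof -
        have 1: "zpow d ?q * (1 / z) ^ nat (d + int 2) = 1 / z ^ 2"
          by (rule zpow_cancel[OF z0]) (use ab in \<open>simp add: d_def\<close>)
        have 2: "zpow d ?q * (1 / z) ^ nat (d + int 1) = 1 / z ^ 1" if "d \<ge> - 1"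
          by (rule zpow_cancel[OF z0]) (use that in simp)
        have "zpow d ?q * H (1 / z) = (zpow d ?q * (1 / z) ^ nat (d + int 2)) * G (1 / z) +
            (if d \<ge> - 1 then c0 * (zpow d ?q * (1 / z) ^ nat (d + int 1)) else 0)"
          unfolding H_def by (simp only: distrib_left mult.assoc mult.left_commute if_distrib[of "(*) _"] mult_zero_right)
        then show ?thesis using 1 2 by (cases "d \<ge> - 1") simp_all
      qed
      moreover have "h ?q = l z + c0 / z + G (1 / z) / z ^ 2" using lG(6) n by simp
      ultimately show ?thesis by (simp add: c_def)
    qed
    have fk: "f ?q *v e'i ?q = (zpow b ?q * zpow d ?q) *s ?k"
      using e'(5) z0 zd by (simp add: vector_scalar_commute)
    have "si ?q = zpow b ?q *s (s0 ?q - (h ?q - zpow d ?q * H (1 / z)) *s ?k)"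
      by (simp add: si_def Hq_def t fk vec_eq_iff algebra_simps)
    also have "\<dots> = zpow b ?q *s (s ?q - (c / z) *s ?k)"
      unfolding key by (simp add: s_def lq_def vec_eq_iff algebra_simps)
    finally show ?thesis .
  qed
  have c: "a - b \<ge> - 1 \<longrightarrow> c = 0" by (simp add: c_def d_def)
  show ?thesis
    using X Y Y0 XY sX gs siY gsi c tr
    by (intro exI[of _ X] exI[of _ Y] exI[of _ s] exI[of _ si] exI[of _ c] conjI) simp_all
qed

text \<open>
  Sending a generator of the quotient to its lift defines the splitting; on the overlap the two
  definitions agree because generators and lifts change by the same factor.
\<close>

lemma splits_if_lifts_agree:
  assumes X: "openin P1_top X" and Y: "openin P1_top Y" and XY: "X \<union> Y = UNIV"
    and e: "e \<in> V'' X" "\<forall>q\<in>X. e q \<noteq> 0" and s: "s \<in> V X" "\<forall>q\<in>X. g q *v s q = e q"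
    and e': "e' \<in> V'' Y" "\<forall>q\<in>Y. e' q \<noteq> 0" and s': "s' \<in> V Y" "\<forall>q\<in>Y. g q *v s' q = e' q"
    and tr: "\<forall>q\<in>X \<inter> Y. \<exists>c. c \<noteq> 0 \<and> e' q = c *s e q \<and> s' q = c *s s q"
  shows "bundle_split_exact V' V V'' f g"
proof -
  define \<sigma> :: "P1 \<Rightarrow> complex^1^2" where "\<sigma> = (\<lambda>q. \<chi> i j.
      if q \<in> X then s q $ i / e q $ 1 else s' q $ i / e' q $ 1)"
  have vec1: "x $ 1 \<noteq> 0" if "x \<noteq> 0" for x :: "complex^1" using that by (simp add: vec_eq_iff forall_1)
  have \<sigma>X: "\<sigma> q *v (c *s e q) = c *s s q" if "q \<in> X" for q c
  proof -
    have "e q $ 1 \<noteq> 0" using that e(2) vec1 by simp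
    then show ?thesis using that
      by (simp add: \<sigma>_def vec_eq_iff matrix_vector_mult_def sum_1)
  qed
  have \<sigma>Y: "\<sigma> q *v (c *s e' q) = c *s s' q" if q: "q \<in> Y" for q c
  proof (cases "q \<in> X")
    case True
    then obtain k where "e' q = k *s e q" "s' q = k *s s q" using tr q by blast
    then show ?thesis using \<sigma>X[OF True, of "c * k"] by (simp add: vector_smult_assoc)
  next
    case False
    have "e' q $ 1 \<noteq> 0" using q e'(2) vec1 by simp
    then show ?thesis using False
      by (simp add: \<sigma>_def vec_eq_iff matrix_vector_mult_def sum_1)
  qed
  have "bundle_hom V'' V \<sigma>"
    unfolding bundle_hom_def
  proof (intro allI impI, elim conjE)
    fix U t assume U: "openin P1_top U" and t: "t \<in> V'' U"
    have part: "(\<lambda>q. \<sigma> q *v t q) \<in> V (U \<inter> Z)"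
      if Z: "openin P1_top Z" and e: "e \<in> V'' Z" "\<forall>q\<in>Z. e q \<noteq> 0" and s: "s \<in> V Z"
        and \<sigma>: "\<And>q c. q \<in> Z \<Longrightarrow> \<sigma> q *v (c *s e q) = c *s s q" for Z e s
    proof -
      have UZ: "openin P1_top (U \<inter> Z)" using U Z by (rule openin_Int)
      have eZ: "\<forall>q\<in>U \<inter> Z. e q \<noteq> 0" using e(2) by simp
      obtain c where c: "hol_fun (U \<inter> Z) c" "\<forall>q\<in>U \<inter> Z. t q = c q *s e q"
        using line_bundle_coordinate[OF V'' UZ section_restrict[OF V'' Z UZ Int_lower2 e(1)] eZ
            section_restrict[OF V'' U UZ Int_lower1 t]] by (elim exE conjE)
      have "(\<lambda>q. c q *s s q) \<in> V (U \<inter> Z)"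
        by (rule section_scale[OF V UZ section_restrict[OF V Z UZ Int_lower2 s] c(1)])
      then show ?thesis by (rule section_cong[OF V UZ]) (use c(2) \<sigma> in simp)
    qed
    have "U \<inter> X \<union> U \<inter> Y = U" using XY by blast
    then show "(\<lambda>q. \<sigma> q *v t q) \<in> V U"
      using section_Union[OF V openin_Int[OF U X] openin_Int[OF U Y]
          part[OF X e s(1) \<sigma>X] part[OF Y e' s'(1) \<sigma>Y]] by simp
  qed
  moreover have "g q ** \<sigma> q = mat 1" for q
  proof -
    have id: "g q ** \<sigma> q = mat 1" if "g q *v (\<sigma> q *v u) = u" "u \<noteq> 0" for u
    proof -
      have "(g q ** \<sigma> q) $ 1 $ 1 * u $ 1 = u $ 1"
        using arg_cong[OF that(1), of "\<lambda>v. v $ 1"]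
        by (simp add: matrix_vector_mul_assoc) (simp add: matrix_vector_mult_def sum_1)
      then have "(g q ** \<sigma> q) $ 1 $ 1 = 1" using vec1[OF that(2)] by simp
      then show ?thesis by (simp add: vec_eq_iff forall_1 mat_def)
    qed
    show ?thesis
    proof (cases "q \<in> X")
      case True
      then show ?thesis using id[of "e q"] \<sigma>X[of q 1] s(2) e(2) by simp
    next
      case False
      then have "q \<in> Y" using XY by auto
      then show ?thesis using id[of "e' q"] \<sigma>Y[of q 1] s'(2) e'(2) by simp
    qed
  qed
  ultimately show ?thesis unfolding bundle_split_exact_def using exact by (intro conjI exI[of _ \<sigma>]) simp_all
qed

end

theorem theorem2:
  fixes \<rho>' \<rho>'' :: "1 rep" and \<rho> :: "2 rep"
    and \<alpha> :: "complex^1^2" and \<beta> :: "complex^2^1"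
    and V' V'' :: "1 presheaf" and V :: "2 presheaf"
    and D' D'' :: "1 conn" and D :: "2 conn"
    and \<Phi>' \<Phi>'' :: "complex^1^1" and \<Phi> :: "complex^2^2"
    and f :: "P1 \<Rightarrow> complex^1^2" and g :: "P1 \<Rightarrow> complex^2^1"
    and \<xi>' \<xi>'' :: int
  assumes "monodromy_rep \<rho>'" and "monodromy_rep \<rho>" and "monodromy_rep \<rho>''"
    and "rep_short_exact \<rho>' \<rho> \<rho>'' \<alpha> \<beta>"
    and "log_extension \<rho>' V' D' \<Phi>'"
    and "log_extension \<rho> V D \<Phi>"
    and "log_extension \<rho>'' V'' D'' \<Phi>''"
    and "induced_hom V' D' \<Phi>' V D \<Phi> \<alpha> f"
    and "induced_hom V D \<Phi> V'' D'' \<Phi>'' \<beta> g"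
    and "bundle_iso V' (twisting_sheaf \<xi>')"
    and "bundle_iso V'' (twisting_sheaf \<xi>'')"
  shows "((\<xi>', \<xi>'') \<noteq> (- 2, 0) \<longrightarrow> bundle_split_exact V' V V'' f g) \<and>
         ((\<xi>', \<xi>'') = (- 2, 0) \<longrightarrow>
            bundle_iso V (direct_sum (twisting_sheaf (- 1)) (twisting_sheaf (- 1))) \<or>
            bundle_iso V (direct_sum (twisting_sheaf 0) (twisting_sheaf (- 2))))"
proof -
  have VB: "vector_bundle V'" "vector_bundle V" "vector_bundle V''"
    using assms(5-7) by (auto intro!: log_connection_bundle log_extension_connection)
  interpret plane_extension V' V'' V f g
    by (unfold_locales) (rule VB induced_short_exact[OF assms(4-9)])+
  have deg: "- 2 \<le> \<xi>'" "\<xi>' \<le> 0" "- 2 \<le> \<xi>''" "\<xi>'' \<le> 0"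
    using degree_bounds[OF assms(5,10)] degree_bounds[OF assms(7,11)] by auto
  obtain k k' where k: "k \<in> V' (- {None})" "k' \<in> V' (- {Some 0})" "\<forall>q. k q \<noteq> 0"
      "\<forall>q. q \<noteq> Some 0 \<longrightarrow> k' q \<noteq> 0" "\<forall>z. z \<noteq> 0 \<longrightarrow> k' (Some z) = zpow \<xi>' (Some z) *s k (Some z)"
    using line_bundle_generators[OF assms(10)] by (elim exE conjE)
  obtain e e' where e: "e \<in> V'' (- {None})" "e' \<in> V'' (- {Some 0})" "\<forall>q. e q \<noteq> 0"
      "\<forall>q. q \<noteq> Some 0 \<longrightarrow> e' q \<noteq> 0" "\<forall>z. z \<noteq> 0 \<longrightarrow> e' (Some z) = zpow \<xi>'' (Some z) *s e (Some z)"
    using line_bundle_generators[OF assms(11)] by (elim exE conjE)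
  have "\<xi>' - \<xi>'' \<ge> - 2" using deg by simp
  from normal_form[OF k e this] obtain X Y s s' c where
    X: "openin P1_top X" "None \<notin> X" and Y: "openin P1_top Y" "Some 0 \<notin> Y" and XY: "X \<union> Y = UNIV"
    and s: "s \<in> V X" "\<forall>q\<in>X. g q *v s q = e q" and s': "s' \<in> V Y" "\<forall>q\<in>Y. g q *v s' q = e' q"
    and c: "\<xi>' - \<xi>'' \<ge> - 1 \<longrightarrow> c = 0"
    and tr: "\<forall>z. Some z \<in> X \<inter> Y \<longrightarrow> s' (Some z) =
      zpow \<xi>'' (Some z) *s (s (Some z) - (c / z) *s (f (Some z) *v k (Some z)))"
    by (elim exE conjE)
  have overlap: "\<exists>z. q = Some z \<and> z \<noteq> 0" if "q \<in> X \<inter> Y" for q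
    using that X(2) Y(2) by (cases q) auto
  have sub: "X \<subseteq> - {None}" "Y \<subseteq> - {Some 0}" using X(2) Y(2) by auto
  note eX = section_restrict[OF VB(3) openin_Compl_None X(1) sub(1) e(1)]
  note e'Y = section_restrict[OF VB(3) openin_Compl_0 Y(1) sub(2) e(2)]
  note kX = section_restrict[OF VB(1) openin_Compl_None X(1) sub(1) k(1)]
  note k'Y = section_restrict[OF VB(1) openin_Compl_0 Y(1) sub(2) k(2)]
  have nz: "\<forall>q\<in>Y. e' q \<noteq> 0" "\<forall>q\<in>Y. k' q \<noteq> 0" using sub(2) e(4) k(4) by (simp_all add: subset_iff)
  have 1: "bundle_split_exact V' V V'' f g" if "(\<xi>', \<xi>'') \<noteq> (- 2, 0)"
  proof -
    have c0: "c = 0" using c deg that by auto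
    show ?thesis
    proof (rule splits_if_lifts_agree[OF X(1) Y(1) XY eX _ s e'Y nz(1) s'])
      show "\<forall>q\<in>X \<inter> Y. \<exists>c. c \<noteq> 0 \<and> e' q = c *s e q \<and> s' q = c *s s q"
      proof
        fix q assume q: "q \<in> X \<inter> Y"
        then obtain z where z: "q = Some z" "z \<noteq> 0" using overlap by blast
        show "\<exists>c. c \<noteq> 0 \<and> e' q = c *s e q \<and> s' q = c *s s q"
          using tr e(5) q z c0 by (intro exI[of _ "zpow \<xi>'' q"]) (auto simp: zpow_nonzero)
      qed
    qed (use e(3) in simp)
  qed
  have 2: "bundle_iso V (direct_sum (twisting_sheaf (- 1)) (twisting_sheaf (- 1))) \<or>
      bundle_iso V (direct_sum (twisting_sheaf 0) (twisting_sheaf (- 2)))" if xi: "(\<xi>', \<xi>'') = (- 2, 0)"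
  proof -
    let ?k = "\<lambda>q. f q *v k q" and ?k' = "\<lambda>q. f q *v k' q"
    have indX: "independent2 (?k q) (s q)" if "q \<in> X" for q
      using lift_independent[of "k q" q "s q"] k(3) s(2) e(3) that by simp
    have indY: "independent2 (?k' q) (s' q)" if "q \<in> Y" for q
      using lift_independent[of "k' q" q "s' q"] nz s'(2) that by simp
    have kX': "?k \<in> V X" and k'Y': "?k' \<in> V Y"
      using f_section[OF X(1) kX] f_section[OF Y(1) k'Y] .
    have zp: "zpow 0 q = 1" for q by (cases q) (simp_all add: zpow_def)
    have k't: "?k' q = zpow (- 2) q *s ?k q" if "q \<in> X \<inter> Y" for q
      using overlap[OF that] k(5) xi by (auto simp: vector_scalar_commute)
    have s't: "s' q = s q - (c / z) *s ?k q" if "q \<in> X \<inter> Y" "q = Some z" for q z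
      using tr that xi zp by auto
    show ?thesis
    proof (cases "c = 0")
      case True
      have "bundle_iso V (direct_sum (twisting_sheaf 0) (twisting_sheaf (- 2)))"
      proof (rule bundle_iso_sum_of_transition[OF VB(2) X Y XY s(1) kX' _ s'(1) k'Y'])
        show "\<forall>q\<in>X \<inter> Y. s' q = zpow 0 q *s s q"
          using s't overlap True by (fastforce simp: zp)
        show "\<forall>q\<in>X. independent2 (s q) (?k q)" "\<forall>q\<in>Y. independent2 (s' q) (?k' q)"
          using indX indY by (auto simp: independent2_def add.commute)
      qed (use k't in auto)
      then show ?thesis ..
    next
      case False
      define \<zeta> where "\<zeta> = (\<lambda>q. case q of Some z \<Rightarrow> z | None \<Rightarrow> (0::complex))"
      define \<omega> where "\<omega> = (\<lambda>q. case q of Some z \<Rightarrow> 1 / z | None \<Rightarrow> (0::complex))"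
      have hz: "hol_fun X \<zeta>" unfolding hol_fun_Some_iff[OF X(2)] by (simp add: \<zeta>_def holomorphic_on_ident)
      have "\<omega> (chart_inf w) = w" for w by (simp add: \<omega>_def chart_inf_def)
      then have hw: "hol_fun Y \<omega>" unfolding hol_fun_inf_iff[OF Y(2)] by (simp add: holomorphic_on_ident)
      \<comment> \<open>Since \<open>s' = s - (c / z) k\<close>, the section \<open>c k - z s\<close> over \<open>X\<close> equals \<open>- z s'\<close>; this is the first
        vector of the new frame, and \<open>s\<close> is the second.\<close>
      let ?u = "\<lambda>q. c *s ?k q + (- \<zeta> q) *s s q" and ?v' = "\<lambda>q. \<omega> q *s s' q + c *s ?k' q"
      let ?u' = "\<lambda>q. (- 1) *s s' q"
      have "bundle_iso V (direct_sum (twisting_sheaf (- 1)) (twisting_sheaf (- 1)))"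
      proof (rule bundle_iso_sum_of_transition[OF VB(2) X Y XY _ s(1) _ _ _ _])
        show "?u \<in> V X"
          by (rule section_combination[OF VB(2) X(1) kX' s(1) hol_fun_const hol_fun_minus[OF hz]])
        show "?u' \<in> V Y" by (rule section_scale[OF VB(2) Y(1) s'(1) hol_fun_const])
        show "?v' \<in> V Y"
          by (rule section_combination[OF VB(2) Y(1) s'(1) k'Y' hw hol_fun_const])
        show "\<forall>q\<in>X. independent2 (?u q) (s q)"
        proof
          fix q assume q: "q \<in> X"
          show "independent2 (?u q) (s q)"
            unfolding independent2_def
          proof (intro allI impI)
            fix a b assume "a *s ?u q + b *s s q = 0"
            then have "(a * c) *s ?k q + (b - a * \<zeta> q) *s s q = 0"
              by (simp add: vec_eq_iff algebra_simps)
            then have "a * c = 0" "b - a * \<zeta> q = 0"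
              using indX[OF q] unfolding independent2_def by blast+
            then show "a = 0 \<and> b = 0" using False by simp
          qed
        qed
        show "\<forall>q\<in>Y. independent2 (?u' q) (?v' q)"
        proof
          fix q assume q: "q \<in> Y"
          show "independent2 (?u' q) (?v' q)"
            unfolding independent2_def
          proof (intro allI impI)
            fix a b assume "a *s ?u' q + b *s ?v' q = 0"
            then have "(b * c) *s ?k' q + (b * \<omega> q - a) *s s' q = 0"
              by (simp add: vec_eq_iff algebra_simps)
            then have "b * c = 0" "b * \<omega> q - a = 0"
              using indY[OF q] unfolding independent2_def by blast+
            then show "a = 0 \<and> b = 0" using False by simp
          qed
        qed
        show "\<forall>q\<in>X \<inter> Y. ?u' q = zpow (- 1) q *s ?u q"
        proof
          fix q assume q: "q \<in> X \<inter> Y"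
          then obtain z where z: "q = Some z" "z \<noteq> 0" using overlap by blast
          show "?u' q = zpow (- 1) q *s ?u q"
            using z(2) unfolding s't[OF q z(1)]
            by (simp add: vec_eq_iff z(1) zpow_def \<zeta>_def power_int_minus field_simps)
        qed
        show "\<forall>q\<in>X \<inter> Y. ?v' q = zpow (- 1) q *s s q"
        proof
          fix q assume q: "q \<in> X \<inter> Y"
          then obtain z where z: "q = Some z" "z \<noteq> 0" using overlap by blast
          show "?v' q = zpow (- 1) q *s s q"
            using z(2) unfolding s't[OF q z(1)] k't[OF q]
            by (simp add: vec_eq_iff z(1) zpow_def \<omega>_def power_int_minus power2_eq_square field_simps)
        qed
      qed
      then show ?thesis ..
    qed
  qed
  show ?thesis using 1 2 by blast
qed

end
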